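(* Let $G=(L,R,E)$ be a bipartite graph with $|L|=|R|=m$ having a perfect matching, let $f$ be a symmetric monotone norm and $\boldsymbol{v}\in\mathbb{R}^E_{\ge0}$ a value vector, and let $D^*$ be a perfect matching minimizing $f(\boldsymbol{v}[D^*])$. For any constants $\epsilon,\delta\in(0,1)$ there is a polynomial-time algorithm that outputs a matching $D$ with at least $(1-\epsilon)m$ edges and $f(\boldsymbol{v}[D])\le(8+\delta)f(\boldsymbol{v}[D^*])$.
   Context: $\boldsymbol{v}[D]$ is the vector with entries $v_e\mathbf{1}[e\in D]$. A norm $f$ is monotone if $f(v)\le f(u)$ for $0\le v\le u$ and symmetric if invariant under coordinate permutations. *)

theory Defs
  imports "HOL-Computational_Algebra.Polynomial" "HOL-Combinatorics.Permutations"
begin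

section \<open>Bipartite graphs and matchings\<close>

text \<open>The sides are sets over two separate types, so they are disjoint by construction, and the
  edge joining \<open>a\<close> and \<open>b\<close> is the pair \<open>(a, b)\<close>.\<close>

definition bipartite_graph :: "'l set \<Rightarrow> 'r set \<Rightarrow> ('l \<times> 'r) set \<Rightarrow> bool" where
  "bipartite_graph L R E \<longleftrightarrow> finite L \<and> finite R \<and> E \<subseteq> L \<times> R"

definition matching :: "('l \<times> 'r) set \<Rightarrow> ('l \<times> 'r) set \<Rightarrow> bool" where
  "matching E D \<longleftrightarrow>
     D \<subseteq> E \<and> (\<forall>d\<in>D. \<forall>e\<in>D. d \<noteq> e \<longrightarrow> fst d \<noteq> fst e \<and> snd d \<noteq> snd e)"

definition perfect_matching ::
  "'l set \<Rightarrow> 'r set \<Rightarrow> ('l \<times> 'r) set \<Rightarrow> ('l \<times> 'r) set \<Rightarrow> bool" where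
  "perfect_matching L R E D \<longleftrightarrow> matching E D \<and> fst ` D = L \<and> snd ` D = R"


section \<open>Symmetric monotone norms\<close>

text \<open>A vector indexed by \<open>E\<close> is a function on the whole type that vanishes outside \<open>E\<close>.\<close>

definition vectors_on :: "'e set \<Rightarrow> ('e \<Rightarrow> real) set" where
  "vectors_on E = {x. \<forall>e. e \<notin> E \<longrightarrow> x e = 0}"

definition restrict_vec :: "('e \<Rightarrow> real) \<Rightarrow> 'e set \<Rightarrow> 'e \<Rightarrow> real" where
  "restrict_vec v D = (\<lambda>e. if e \<in> D then v e else 0)"

definition norm_on :: "'e set \<Rightarrow> (('e \<Rightarrow> real) \<Rightarrow> real) \<Rightarrow> bool" where
  "norm_on E f \<longleftrightarrow>
     (\<forall>x\<in>vectors_on E. 0 \<le> f x) \<and>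
     (\<forall>x\<in>vectors_on E. f x = 0 \<longleftrightarrow> x = (\<lambda>_. 0)) \<and>
     (\<forall>c. \<forall>x\<in>vectors_on E. f (\<lambda>e. c * x e) = \<bar>c\<bar> * f x) \<and>
     (\<forall>x\<in>vectors_on E. \<forall>y\<in>vectors_on E. f (\<lambda>e. x e + y e) \<le> f x + f y)"

definition monotone_norm_on :: "'e set \<Rightarrow> (('e \<Rightarrow> real) \<Rightarrow> real) \<Rightarrow> bool" where
  "monotone_norm_on E f \<longleftrightarrow>
     (\<forall>x\<in>vectors_on E. \<forall>y\<in>vectors_on E. (\<forall>e. 0 \<le> x e \<and> x e \<le> y e) \<longrightarrow> f x \<le> f y)"

definition symmetric_norm_on :: "'e set \<Rightarrow> (('e \<Rightarrow> real) \<Rightarrow> real) \<Rightarrow> bool" where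
  "symmetric_norm_on E f \<longleftrightarrow>
     (\<forall>x\<in>vectors_on E. \<forall>\<pi>. \<pi> permutes E \<longrightarrow> f (x \<circ> \<pi>) = f x)"


section \<open>Algorithms with a value oracle\<close>

text \<open>
  Algorithms are programs of a small deterministic imperative language with scalar variables and
  arrays, over natural numbers (indices, counters) and over real numbers (the input values and the
  values of the norm). The norm is accessible only through a value oracle. A program is a finite
  object with natural and rational constants only.

  Every command takes one time unit and an oracle query additionally one unit per coordinate.
  Both kinds of numbers offer addition, (truncated, for the naturals) subtraction and comparison
  only. There is deliberately no unit-cost multiplication, division, rounding or conversion
  between the two sorts, so unit cost is not more powerful than bit cost: on rational data, once
  denominators are cleared, a step of a fixed program lengthens the numbers involved by at most a
  constant number of bits. A polynomial number of steps therefore also means polynomial time in the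
  bit model, measured in the total length of the input and of the oracle answers.
\<close>

type_synonym vname = string

datatype nexp =
    NConst nat
  | NVar vname
  | NArr vname nexp
  | NPlus nexp nexp
  | NMinus nexp nexp

datatype rexp =
    RConst rat
  | RVar vname
  | RArr vname nexp
  | RPlus rexp rexp
  | RMinus rexp rexp

datatype bexp =
    NLess nexp nexp
  | RLess rexp rexp
  | BNot bexp
  | BAnd bexp bexp

datatype com =
    Skip
  | NAssign vname nexp
  | NArrAssign vname nexp nexp
  | RAssign vname rexp
  | RArrAssign vname nexp rexp
  | Query vname vname nexp
  | Seq com com
  | Cond bexp com com
  | While bexp com

record state =
  nvar :: "vname \<Rightarrow> nat"
  rvar :: "vname \<Rightarrow> real"
  narr :: "vname \<Rightarrow> nat \<Rightarrow> nat"
  rarr :: "vname \<Rightarrow> nat \<Rightarrow> real"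

primrec nval :: "nexp \<Rightarrow> state \<Rightarrow> nat" where
  "nval (NConst k) s = k"
| "nval (NVar x) s = nvar s x"
| "nval (NArr x i) s = narr s x (nval i s)"
| "nval (NPlus a b) s = nval a s + nval b s"
| "nval (NMinus a b) s = nval a s - nval b s"

primrec rval :: "rexp \<Rightarrow> state \<Rightarrow> real" where
  "rval (RConst q) s = of_rat q"
| "rval (RVar x) s = rvar s x"
| "rval (RArr x i) s = rarr s x (nval i s)"
| "rval (RPlus a b) s = rval a s + rval b s"
| "rval (RMinus a b) s = rval a s - rval b s"

primrec bval :: "bexp \<Rightarrow> state \<Rightarrow> bool" where
  "bval (NLess a b) s \<longleftrightarrow> nval a s < nval b s"
| "bval (RLess a b) s \<longleftrightarrow> rval a s < rval b s"
| "bval (BNot b) s \<longleftrightarrow> \<not> bval b s"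
| "bval (BAnd a b) s \<longleftrightarrow> bval a s \<and> bval b s"

text \<open>\<open>exec orc c s t s'\<close>: started in \<open>s\<close>, the program \<open>c\<close> with oracle \<open>orc\<close> halts in state \<open>s'\<close>
  after exactly \<open>t\<close> time units. \<open>Query x a k\<close> asks for the vector held in the first \<open>k\<close> cells of the
  real array \<open>a\<close> and stores the answer in \<open>x\<close>.\<close>

inductive exec :: "(real list \<Rightarrow> real) \<Rightarrow> com \<Rightarrow> state \<Rightarrow> nat \<Rightarrow> state \<Rightarrow> bool"
  for orc :: "real list \<Rightarrow> real" where
  Skip: "exec orc Skip s 1 s"
| NAssign: "exec orc (NAssign x a) s 1 (s\<lparr>nvar := (nvar s)(x := nval a s)\<rparr>)"
| NArrAssign: "exec orc (NArrAssign x i a) s 1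
    (s\<lparr>narr := (narr s)(x := (narr s x)(nval i s := nval a s))\<rparr>)"
| RAssign: "exec orc (RAssign x a) s 1 (s\<lparr>rvar := (rvar s)(x := rval a s)\<rparr>)"
| RArrAssign: "exec orc (RArrAssign x i a) s 1
    (s\<lparr>rarr := (rarr s)(x := (rarr s x)(nval i s := rval a s))\<rparr>)"
| Query: "exec orc (Query x a k) s (1 + nval k s)
    (s\<lparr>rvar := (rvar s)(x := orc (map (rarr s a) [0..<nval k s]))\<rparr>)"
| Seq: "exec orc c1 s t1 s1 \<Longrightarrow> exec orc c2 s1 t2 s2 \<Longrightarrow> exec orc (Seq c1 c2) s (1 + t1 + t2) s2"
| CondTrue: "bval b s \<Longrightarrow> exec orc c1 s t s' \<Longrightarrow> exec orc (Cond b c1 c2) s (1 + t) s'"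
| CondFalse: "\<not> bval b s \<Longrightarrow> exec orc c2 s t s' \<Longrightarrow> exec orc (Cond b c1 c2) s (1 + t) s'"
| WhileFalse: "\<not> bval b s \<Longrightarrow> exec orc (While b c) s 1 s"
| WhileTrue: "bval b s \<Longrightarrow> exec orc c s t1 s1 \<Longrightarrow> exec orc (While b c) s1 t2 s2 \<Longrightarrow>
    exec orc (While b c) s (1 + t1 + t2) s2"

lemma exec_deterministic:
  "exec orc c s t s' \<Longrightarrow> exec orc c s u s'' \<Longrightarrow> u = t \<and> s'' = s'"
proof (induction arbitrary: u s'' rule: exec.induct)
  case (WhileTrue b s c t1 s1 t2 s2)
  from WhileTrue.prems WhileTrue.hyps(1) obtain u1 r1 u2
    where "exec orc c s u1 r1" "exec orc (While b c) r1 u2 s''" "u = 1 + u1 + u2"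
    by (cases rule: exec.cases) auto
  with WhileTrue.IH show ?case by blast
next
  case (Seq c1 s t1 s1 c2 t2 s2)
  from Seq.prems obtain u1 r1 u2
    where "exec orc c1 s u1 r1" "exec orc c2 r1 u2 s''" "u = 1 + u1 + u2"
    by (cases rule: exec.cases) auto
  with Seq.IH show ?case by blast
next
  case (CondTrue b s c1 t s' c2)
  from CondTrue.prems CondTrue.hyps(1) CondTrue.IH show ?case
    by (cases rule: exec.cases) auto
next
  case (CondFalse b s c2 t s' c1)
  from CondFalse.prems CondFalse.hyps(1) CondFalse.IH show ?case
    by (cases rule: exec.cases) auto
next
  case (WhileFalse b s c)
  from WhileFalse.prems WhileFalse.hyps(1) show ?case
    by (cases rule: exec.cases) auto
qed (erule exec.cases; simp)+


section \<open>Encoding of instances and outputs\<close>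

text \<open>An instance is presented to a program by numbering its vertices (\<open>\<alpha>\<close> on the left, \<open>\<beta>\<close> on the
  right) and by listing its edges as \<open>es\<close>.\<close>

definition presentation ::
  "'l set \<Rightarrow> 'r set \<Rightarrow> ('l \<times> 'r) set \<Rightarrow> ('l \<Rightarrow> nat) \<Rightarrow> ('r \<Rightarrow> nat) \<Rightarrow> ('l \<times> 'r) list \<Rightarrow> bool" where
  "presentation L R E \<alpha> \<beta> es \<longleftrightarrow>
     bij_betw \<alpha> L {..<card L} \<and> bij_betw \<beta> R {..<card R} \<and> distinct es \<and> set es = E"

definition input_state ::
  "nat \<Rightarrow> ('l \<Rightarrow> nat) \<Rightarrow> ('r \<Rightarrow> nat) \<Rightarrow> ('l \<times> 'r) list \<Rightarrow> ('l \<times> 'r \<Rightarrow> real) \<Rightarrow> state" where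
  "input_state m \<alpha> \<beta> es v =
     \<lparr> nvar = (\<lambda>_. 0)(''m'' := m, ''n'' := length es),
       rvar = (\<lambda>_. 0),
       narr = (\<lambda>_ _. 0)
         (''left'' := (\<lambda>i. if i < length es then \<alpha> (fst (es ! i)) else 0),
          ''right'' := (\<lambda>i. if i < length es then \<beta> (snd (es ! i)) else 0)),
       rarr = (\<lambda>_ _. 0)
         (''val'' := (\<lambda>i. if i < length es then v (es ! i) else 0)) \<rparr>"

definition output_edges :: "('l \<times> 'r) list \<Rightarrow> state \<Rightarrow> ('l \<times> 'r) set" where
  "output_edges es s = {es ! i | i. i < length es \<and> narr s ''out'' i \<noteq> 0}"

text \<open>The value oracle of \<open>f\<close> reads the coordinates in the order of \<open>es\<close>. Queries of the wrong length
  are padded with zeros or truncated, so that the argument of \<open>f\<close> always lies in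
  \<open>vectors_on (set es)\<close>.\<close>

definition value_oracle :: "'e list \<Rightarrow> (('e \<Rightarrow> real) \<Rightarrow> real) \<Rightarrow> real list \<Rightarrow> real" where
  "value_oracle es f xs =
     f (\<lambda>e. case map_of (zip es xs) e of None \<Rightarrow> 0 | Some r \<Rightarrow> r)"

end

theory Submission
  imports Defs
begin

text \<open>The algorithm is a local search, run for polynomially many guesses about an optimal matching \<open>M\<close>.
  Fix an edge of \<open>M\<close> that is the \<open>C\<close>-th heaviest for a constant \<open>C\<close>, of value \<open>V\<close>, forbid heavier edges,
  and let the level of an edge be \<open>j\<close> if its value is about \<open>V/2\<^sup>j\<close>. The number of edges of \<open>M\<close> of level
  at most \<open>j\<close> is nondecreasing in \<open>j\<close>, so up to a factor \<open>3/2\<close> this profile is a monotone path in a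
  grid of logarithmic size, that is, a bit string of logarithmic length. Each level gets the guessed
  number plus a constant as its capacity, and the search maximises the number of edges of a matching
  within the capacities, with a convex penalty for levels that are nearly full. If \<open>D\<close> is
  optimal under exchanges of constantly many edges, cutting the components of the union of \<open>D\<close> and
  \<open>M\<close> into short pieces shows that \<open>D\<close> misses only a small fraction of the vertices.

  At every level \<open>j\<close> then \<open>D\<close> has at most twice as many edges as \<open>M\<close> has at levels up to \<open>j\<close>, as \<open>C\<close>
  absorbs the constant excess. Rounding the values to levels costs a factor 2, the two copies of \<open>M\<close>
  another 2, and comparing with the levels up to \<open>j\<close> instead of \<open>j\<close> itself a geometric series with
  sum 2, which gives 8; the lightest edges contribute the \<open>\<delta>\<close>.\<close>

section \<open>Matchings and local optimality\<close>

text \<open>With hard capacities alone the exchange argument breaks down: an exchange cannot add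
  edges at a full level, and the edges of \<open>M\<close> there would be lost. Therefore the
  penalty starts \<open>3 * K\<close> above the guess and its marginal cost grows by one per edge,
  while the hard limit lies \<open>S + 6 * K\<close> above the guess. Within \<open>K\<close> of
  that limit every deleted edge saves at least \<open>S\<close>, the price of one missing edge, and
  this pays for the loss. The constants come from the resulting bound. Divided by
  \<open>K * S\<close>, it says that the missing edges number at most the forbidden edges of
  \<open>M\<close>, plus \<open>2 * m / K\<close> for edges of \<open>D\<close> between two blocks,
  plus \<open>3 * K * m / S\<close> for the variation of the marginal cost. With
  \<open>S = 3 * K * K\<close>, fewer than \<open>C \<le> m / K\<close> forbidden edges and
  \<open>K = 4 * q\<close> this is at most \<open>m / q\<close>. Taking
  \<open>C = 2 * (S + 6 * K)\<close> lets the excess fit between 3/2 and 2 times the true count, but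
  \<open>C * K \<le> m\<close> then needs a large \<open>m\<close>. For smaller \<open>m\<close>
  there is no excess, \<open>C = 1\<close>, and an exchange can reach \<open>M\<close> itself. The
  potential is a natural number that starts at \<open>S * m\<close>, so the search makes
  polynomially many improvements.\<close>

definition cut :: "'a set \<Rightarrow> ('a \<times> 'a) set \<Rightarrow> 'a set \<Rightarrow> ('a \<times> 'a) set" where
  "cut M R W = {r \<in> R. r \<in> M \<times> M \<and> (fst r \<in> W) \<noteq> (snd r \<in> W)}"

lemma card_fibre_le_1:
  assumes "inj_on f R"
  shows "card {r \<in> R. f r = b} \<le> 1" "finite {r \<in> R. f r = b}"
proof -
  have "\<exists>x. {r \<in> R. f r = b} \<subseteq> {x}" using assms by (auto simp: inj_on_def)
  then obtain x where "{r \<in> R. f r = b} \<subseteq> {x}" by blast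
  then show "card {r \<in> R. f r = b} \<le> 1" "finite {r \<in> R. f r = b}"
    by (auto dest: card_mono[rotated] intro: finite_subset)
qed

text \<open>\<open>R\<close> is a directed graph with in- and outdegrees at most 1, so its
  components are paths and cycles. Among the nonempty sets of at most \<open>K\<close> vertices with
  at most two cut arcs, a largest one is taken. If it had fewer than \<open>K\<close> vertices and a
  cut arc, adding the other end of that arc would remove the arc from the cut and bring in at most
  one new arc. So \<open>card W = K\<close> or nothing is cut, and either case gives the
  inequality.\<close>

lemma ex_small_cut:
  assumes "finite M" "M \<noteq> {}" "K \<ge> 1" "inj_on fst R" "inj_on snd R"
  obtains W where "W \<subseteq> M" "W \<noteq> {}" "card W \<le> K" "K * card (cut M R W) \<le> 2 * card W"
proof -
  have fin: "finite (cut M R W)" for W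
    by (rule finite_subset[of _ "M \<times> M"]) (auto simp: cut_def assms)
  define Q where "Q W \<longleftrightarrow> W \<subseteq> M \<and> W \<noteq> {} \<and> card W \<le> K \<and> card (cut M R W) \<le> 2" for W
  obtain y where y: "y \<in> M" using assms by auto
  have "cut M R {y} \<subseteq> {r \<in> R. fst r = y} \<union> {r \<in> R. snd r = y}" by (auto simp: cut_def)
  then have "card (cut M R {y}) \<le> card ({r \<in> R. fst r = y} \<union> {r \<in> R. snd r = y})"
    by (intro card_mono) (auto intro: card_fibre_le_1 assms)
  also have "\<dots> \<le> card {r \<in> R. fst r = y} + card {r \<in> R. snd r = y}" by (rule card_Un_le)
  also have "\<dots> \<le> 2"
    using card_fibre_le_1(1)[OF assms(4), of y] card_fibre_le_1(1)[OF assms(5), of y] by linarith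
  finally have "Q {y}" using y assms by (auto simp: Q_def)
  moreover have "\<forall>W. Q W \<longrightarrow> card W < Suc K" by (auto simp: Q_def)
  ultimately obtain W where W: "Q W" and max: "\<And>W'. Q W' \<Longrightarrow> card W' \<le> card W"
    using ex_has_greatest_nat[of Q "{y}" card "Suc K"] by auto
  have finW: "finite W" using W assms by (auto simp: Q_def intro: finite_subset)
  have False if "card W < K" and r0: "r0 \<in> cut M R W" for r0
  proof -
    have grow: False
      if ab: "b \<notin> W" "b \<in> M" and sub: "cut M R (insert b W) \<subseteq> (cut M R W - {r0}) \<union> {r \<in> R. h r = b}"
        and h: "inj_on h R" for b and h :: "_ \<Rightarrow> 'a"
    proof -
      have "card (cut M R (insert b W)) \<le> card ((cut M R W - {r0}) \<union> {r \<in> R. h r = b})"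
        by (intro card_mono sub finite_UnI finite_Diff fin card_fibre_le_1 h)
      also have "\<dots> \<le> card (cut M R W - {r0}) + card {r \<in> R. h r = b}" by (rule card_Un_le)
      also have "\<dots> \<le> (card (cut M R W) - 1) + 1"
        using card_fibre_le_1(1)[OF h, of b] r0 fin by (simp add: card_Diff_singleton)
      also have "\<dots> \<le> 2" using W by (auto simp: Q_def)
      finally have "Q (insert b W)" using W ab that(1) \<open>card W < K\<close> finW by (auto simp: Q_def)
      from max[OF this] show False using ab finW by simp
    qed
    have r0R: "r0 \<in> R" "fst r0 \<in> M" "snd r0 \<in> M" "(fst r0 \<in> W) \<noteq> (snd r0 \<in> W)"
      using r0 by (auto simp: cut_def)
    show False
    proof (cases "fst r0 \<in> W")
      case True
      \<comment> \<open>No other arc enters \<open>snd r0\<close>, so only the arc leaving it can be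
        new in the cut.\<close>
      have "r = r0" if "r \<in> R" "snd r = snd r0" for r using that r0R assms(5) by (auto dest: inj_onD)
      then have "cut M R (insert (snd r0) W) \<subseteq> (cut M R W - {r0}) \<union> {r \<in> R. fst r = snd r0}"
        using True r0R unfolding cut_def by fastforce
      from grow[OF _ _ this assms(4)] True r0R show False by auto
    next
      case False
      have "r = r0" if "r \<in> R" "fst r = fst r0" for r using that r0R assms(4) by (auto dest: inj_onD)
      then have "cut M R (insert (fst r0) W) \<subseteq> (cut M R W - {r0}) \<union> {r \<in> R. snd r = fst r0}"
        using False r0R unfolding cut_def by fastforce
      from grow[OF _ _ this assms(5)] False r0R show False by auto
    qed
  qed
  then have "card W = K \<or> cut M R W = {}" using W by (auto simp: Q_def order.order_iff_strict)
  then have "K * card (cut M R W) \<le> 2 * card W" using W by (auto simp: Q_def)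
  then show thesis using W that[of W] by (auto simp: Q_def)
qed

text \<open>Sets with small cuts are split off one after the other. An arc between different blocks
  is charged to the block that is split off first, and the bounds \<open>2 * card W\<close> add up
  to \<open>2 * card M\<close>.\<close>

lemma ex_block_partition:
  assumes "finite M" "K \<ge> 1" "inj_on fst R" "inj_on snd R"
  shows "\<exists>P. finite P \<and> \<Union>P = M \<and> disjoint P \<and> (\<forall>B\<in>P. card B \<le> K) \<and>
    K * card {r \<in> R. r \<in> M \<times> M \<and> (\<forall>B\<in>P. \<not> (fst r \<in> B \<and> snd r \<in> B))} \<le> 2 * card M"
  using assms(1)
proof (induction "card M" arbitrary: M rule: less_induct)
  case less
  let ?X = "\<lambda>M P. {r \<in> R. r \<in> M \<times> M \<and> (\<forall>B\<in>P. \<not> (fst r \<in> B \<and> snd r \<in> B))}"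
  show ?case
  proof (cases "M = {}")
    case True
    then show ?thesis by (intro exI[of _ "{}"]) auto
  next
    case False
    obtain W where W: "W \<subseteq> M" "W \<noteq> {}" "card W \<le> K" "K * card (cut M R W) \<le> 2 * card W"
      by (rule ex_small_cut[OF less.prems False assms(2-4)])
    have finW: "finite W" using W less.prems by (meson finite_subset)
    have "card (M - W) < card M" using W less.prems by (intro psubset_card_mono) auto
    from less.hyps[OF this finite_Diff[OF less.prems]] obtain P where P: "finite P" "\<Union>P = M - W" "disjoint P"
      "\<forall>B\<in>P. card B \<le> K" "K * card (?X (M - W) P) \<le> 2 * card (M - W)" by blast
    have sub: "cut M R W \<subseteq> M \<times> M" "?X (M - W) P \<subseteq> M \<times> M" by (auto simp: cut_def)
    then have "finite (cut M R W \<union> ?X (M - W) P)"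
      using less.prems by (meson finite_SigmaI finite_UnI finite_subset)
    moreover have "?X M (insert W P) \<subseteq> cut M R W \<union> ?X (M - W) P"
    proof
      fix r assume "r \<in> ?X M (insert W P)"
      then have "r \<in> R" "r \<in> M \<times> M" "\<not> (fst r \<in> W \<and> snd r \<in> W)" "\<forall>B\<in>P. \<not> (fst r \<in> B \<and> snd r \<in> B)"
        by blast+
      then show "r \<in> cut M R W \<union> ?X (M - W) P"
        by (cases "(fst r \<in> W) \<noteq> (snd r \<in> W)") (simp_all add: cut_def mem_Times_iff)
    qed
    ultimately have "card (?X M (insert W P)) \<le> card (cut M R W \<union> ?X (M - W) P)"
      by (rule card_mono)
    also have "\<dots> \<le> card (cut M R W) + card (?X (M - W) P)" by (rule card_Un_le)
    finally have "K * card (?X M (insert W P)) \<le> K * (card (cut M R W) + card (?X (M - W) P))"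
      by (rule mult_le_mono2)
    also have "\<dots> = K * card (cut M R W) + K * card (?X (M - W) P)" by (rule add_mult_distrib2)
    also have "\<dots> \<le> 2 * card W + 2 * card (M - W)" using W P by linarith
    also have "\<dots> = 2 * card M"
      using card_Diff_subset[OF finW W(1)] card_mono[OF less.prems W(1)] by simp
    finally have "K * card (?X M (insert W P)) \<le> 2 * card M" .
    moreover have "disjoint (insert W P)" using P(2,3)
      unfolding pairwise_insert disjnt_def by blast
    moreover have "finite (insert W P)" "\<Union>(insert W P) = M" "\<forall>B\<in>insert W P. card B \<le> K"
      using P W by auto
    ultimately show ?thesis by blast
  qed
qed

section \<open>Soft capacities and exchanges\<close>

definition lcount :: "('e \<Rightarrow> nat) \<Rightarrow> 'e set \<Rightarrow> nat \<Rightarrow> nat" where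
  "lcount lv I j = card {i \<in> I. lv i = j}"

text \<open>This is the binomial coefficient of \<open>n - T\<close> over 2: edge number
  \<open>k + 1\<close> costs \<open>k - T\<close>, truncated at 0. The program adds up these
  increments and needs no multiplication.\<close>

definition soft :: "nat \<Rightarrow> nat \<Rightarrow> nat" where
  "soft T n = (\<Sum>k<n. k - T)"

text \<open>\<open>S\<close> is the price of a missing edge. The offset \<open>3 * K\<close> keeps
  the marginal penalty at 0 throughout an exchange at levels that hold fewer than
  \<open>cp j\<close> edges.\<close>

definition cost :: "nat \<Rightarrow> nat \<Rightarrow> nat \<Rightarrow> ('e \<Rightarrow> nat) \<Rightarrow> (nat \<Rightarrow> nat) \<Rightarrow> 'e set \<Rightarrow> 'e set \<Rightarrow> nat" where
  "cost S K m lv cp E I = S * (m - card I) + (\<Sum>j\<in>lv ` E. soft (cp j + 3 * K) (lcount lv I j))"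

text \<open>Edges are abstract labels with endpoint maps, so that array positions can serve as edges
  in the program. A level without edges meets its capacity trivially, so testing the levels that
  occur suffices.\<close>

definition feasible :: "('e \<Rightarrow> 'a) \<Rightarrow> ('e \<Rightarrow> 'b) \<Rightarrow> ('e \<Rightarrow> nat) \<Rightarrow> (nat \<Rightarrow> nat) \<Rightarrow> ('e \<Rightarrow> bool) \<Rightarrow> nat
    \<Rightarrow> 'e set \<Rightarrow> bool" where
  "feasible lft rgt lv cp ok add I \<longleftrightarrow> inj_on lft I \<and> inj_on rgt I \<and> (\<forall>i\<in>I. ok i) \<and>
     (\<forall>i\<in>I. lcount lv I (lv i) \<le> cp (lv i) + add)"

definition local_opt :: "nat \<Rightarrow> 'e set \<Rightarrow> ('e set \<Rightarrow> bool) \<Rightarrow> ('e set \<Rightarrow> nat) \<Rightarrow> 'e set \<Rightarrow> bool" where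
  "local_opt k E F \<Phi> D \<longleftrightarrow> (\<forall>X\<subseteq>E. card X \<le> k \<longrightarrow> F (sym_diff D X) \<longrightarrow> \<Phi> D \<le> \<Phi> (sym_diff D X))"

lemma soft_add:
  "soft T (a + b) \<le> soft T a + b * (a + b - T)" "soft T a + b * (a - T) \<le> soft T (a + b)"
proof (induction b)
  case (Suc b)
  have s: "soft T (a + Suc b) = soft T (a + b) + (a + b - T)" by (simp add: soft_def)
  { case 1
    have "Suc b * (a + b - T) \<le> Suc b * (a + Suc b - T)" by (intro mult_le_mono2 diff_le_mono) simp
    then have "b * (a + b - T) + (a + b - T) \<le> Suc b * (a + Suc b - T)" by simp
    then show ?case using Suc s by linarith }
  { case 2
    have "a - T \<le> a + b - T" by simp
    then show ?case using Suc s by simp }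
qed (auto)

text \<open>At one level an exchange removes \<open>x\<close> edges and adds \<open>y\<close>. By
  convexity all marginal costs met on the way lie between the rates \<open>n - 2 * K - T\<close> and
  \<open>n + K - T\<close>. The bound is linear in \<open>x\<close> and \<open>y\<close>, with rates
  that depend only on the state before the exchange, so it can be summed over all blocks.\<close>

lemma soft_change:
  assumes "n' + x = n + y" "x \<le> n" "y \<le> K" "x \<le> 2 * K"
  shows "int (soft T n') - int (soft T n) \<le> int y * int (n + K - T) - int x * int (n - 2 * K - T)"
proof (cases "x \<le> y")
  case True
  then obtain b where b: "y = x + b" by (auto simp: le_iff_add)
  then have n': "n' = n + b" using assms by simp
  have "int (soft T n') \<le> int (soft T n) + int b * int (n + b - T)"
    unfolding n' using soft_add(1)[of T n b] by (metis of_nat_add of_nat_le_iff of_nat_mult)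
  also have "int b * int (n + b - T) \<le> int b * int (n + K - T)"
    using assms b by (intro mult_left_mono) auto
  moreover have "int x * int (n - 2 * K - T) \<le> int x * int (n + K - T)"
    by (intro mult_left_mono) auto
  ultimately show ?thesis by (simp add: b algebra_simps)
next
  case False
  then obtain b where b: "x = y + b" by (metis le_iff_add nat_le_linear)
  then have n: "n = n' + b" using assms by simp
  have "int (soft T n') + int b * int (n' - T) \<le> int (soft T n)"
    unfolding n using soft_add(2)[of T n' b] by (metis of_nat_add of_nat_le_iff of_nat_mult)
  moreover have "int b * int (n - 2 * K - T) \<le> int b * int (n' - T)"
    using assms b n by (intro mult_left_mono) auto
  moreover have "int y * int (n - 2 * K - T) \<le> int y * int (n + K - T)"
    by (intro mult_left_mono) auto
  ultimately show ?thesis by (simp add: b algebra_simps)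
qed

lemma lcount_mono: "finite B \<Longrightarrow> A \<subseteq> B \<Longrightarrow> lcount lv A j \<le> lcount lv B j"
  unfolding lcount_def by (intro card_mono) auto

lemma lcount_le_card: "finite A \<Longrightarrow> lcount lv A j \<le> card A"
  unfolding lcount_def by (intro card_mono) auto

lemma lcount_exchange:
  assumes "finite D" "finite Y" "X \<subseteq> D" "(D - X) \<inter> Y = {}"
  shows "lcount lv ((D - X) \<union> Y) j + lcount lv X j = lcount lv D j + lcount lv Y j"
proof -
  have 1: "{i \<in> (D - X) \<union> Y. lv i = j} = ({i \<in> D. lv i = j} - {i \<in> X. lv i = j}) \<union> {i \<in> Y. lv i = j}"
    by auto
  have 2: "({i \<in> D. lv i = j} - {i \<in> X. lv i = j}) \<inter> {i \<in> Y. lv i = j} = {}" using assms by auto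
  have 3: "finite {i \<in> X. lv i = j}" "{i \<in> X. lv i = j} \<subseteq> {i \<in> D. lv i = j}"
    using assms by (auto intro: finite_subset)
  then have "card {i \<in> X. lv i = j} \<le> card {i \<in> D. lv i = j}"
    using assms by (intro card_mono) auto
  then show ?thesis unfolding lcount_def 1 using assms 2 3
    by (subst card_Un_disjoint) (auto simp: card_Diff_subset)
qed

lemma inj_on_exchange:
  assumes "inj_on h D" "inj_on h M" "Y \<subseteq> M" "\<And>d a. d \<in> D - X \<Longrightarrow> a \<in> Y \<Longrightarrow> h d \<noteq> h a"
  shows "inj_on h ((D - X) \<union> Y)"
proof -
  have "inj_on h (D - X)" "inj_on h Y" using assms by (auto intro: inj_on_subset inj_on_diff)
  moreover have "h ` (D - X) \<inter> h ` Y = {}" using assms(4) by blast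
  ultimately show ?thesis unfolding inj_on_Un by blast
qed

lemma sum_lcount: "finite I \<Longrightarrow> finite J \<Longrightarrow> (\<Sum>j\<in>J. lcount lv I j) = card {i \<in> I. lv i \<in> J}"
proof -
  assume fin: "finite I" "finite J"
  have "{i \<in> I. lv i \<in> J} = (\<Union>j\<in>J. {i \<in> I. lv i = j})" by auto
  then show ?thesis unfolding lcount_def using fin by (simp add: card_UN_disjoint disjoint_iff)
qed

text \<open>The symmetric difference of \<open>D\<close> and \<open>M\<close> has at most
  \<open>2 * m\<close> edges, so replacing \<open>D\<close> by \<open>M\<close> is one exchange.
  \<open>M\<close> respects the capacities and misses nothing, so its potential is 0; then so is
  that of \<open>D\<close>, and \<open>S > 0\<close> forces \<open>card D = m\<close>.\<close>

lemma local_opt_small: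
  assumes "finite E" "D \<subseteq> E" "M \<subseteq> E" "card M = m" "feasible lft rgt lv cp ok add M"
    and cap: "\<And>j. lcount lv M j \<le> cp j" and "2 * m \<le> k" "card D \<le> m" "S > 0"
    and opt: "local_opt k E (feasible lft rgt lv cp ok add) (cost S K m lv cp E) D"
  shows "card D = m"
proof -
  have fin: "finite D" "finite M" using assms by (auto intro: finite_subset)
  have "card (sym_diff D M) \<le> card D + card M"
    using fin by (meson card_Un_le card_mono Diff_subset add_mono le_trans finite_Diff)
  then have "card (sym_diff D M) \<le> k" using assms by linarith
  moreover have "sym_diff D (sym_diff D M) = M" by auto
  moreover have "sym_diff D M \<subseteq> E" using assms by auto
  ultimately have "cost S K m lv cp E D \<le> cost S K m lv cp E M"
    using opt assms(5) unfolding local_opt_def by metis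
  also have "cost S K m lv cp E M = 0"
  proof -
    have "soft (cp j + 3 * K) (lcount lv M j) = 0" for j
      using cap[of j] unfolding soft_def by (intro sum.neutral) auto
    then show ?thesis using assms by (simp add: cost_def)
  qed
  finally show ?thesis using assms by (simp add: cost_def)
qed

text \<open>Along the components of the union of \<open>D\<close> and \<open>M\<close>, cut into blocks of at most \<open>K\<close> edges of \<open>M\<close>,
  one may exchange the edges of \<open>D\<close> by those of \<open>M\<close>. Summing the local optimality conditions of all
  blocks compares \<open>D\<close> with \<open>M\<close>: a level where \<open>D\<close> has more edges than \<open>M\<close> does not get more expensive,
  as its marginal cost hardly varies within one exchange. Edges of \<open>M\<close> that are not
  allowed or whose level is full are left out; for a full level the saved marginal cost pays for this.\<close>

lemma local_opt_card:
  assumes fin: "finite E" and sub: "D \<subseteq> E" "M \<subseteq> E" and inj: "inj_on lft M" "inj_on rgt M"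
    and "card M = m" and perf: "lft ` E \<subseteq> lft ` M" "rgt ` E \<subseteq> rgt ` M"
    and feas: "feasible lft rgt lv cp ok (S + 6 * K) D"
    and cap: "\<And>j. lcount lv M j \<le> cp j" and K: "K \<ge> 1" "3 * K \<le> k"
    and opt: "local_opt k E (feasible lft rgt lv cp ok (S + 6 * K)) (cost S K m lv cp E) D"
  shows "K * S * (m - card D) \<le> K * S * card {a \<in> M. \<not> ok a} + 2 * S * m + 3 * K * K * m"
proof -
  have finD: "finite D" and finM: "finite M" using fin sub by (auto intro: finite_subset)
  have injD: "inj_on lft D" "inj_on rgt D" using feas by (auto simp: feasible_def)
  \<comment> \<open>The neighbours of \<open>d\<close> in the union of \<open>D\<close> and
    \<open>M\<close>: the edges of \<open>M\<close> at its left and at its right end.\<close>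
  define al where "al d = (SOME a. a \<in> M \<and> lft a = lft d)" for d
  define ar where "ar d = (SOME a. a \<in> M \<and> rgt a = rgt d)" for d
  have al: "al d \<in> M" "lft (al d) = lft d" if "d \<in> D" for d
  proof -
    have "\<exists>a. a \<in> M \<and> lft a = lft d" using that sub perf by (metis imageE image_subset_iff subsetD)
    from someI_ex[OF this] show "al d \<in> M" "lft (al d) = lft d" by (auto simp: al_def)
  qed
  have ar: "ar d \<in> M" "rgt (ar d) = rgt d" if "d \<in> D" for d
  proof -
    have "\<exists>a. a \<in> M \<and> rgt a = rgt d" using that sub perf by (metis imageE image_subset_iff subsetD)
    from someI_ex[OF this] show "ar d \<in> M" "rgt (ar d) = rgt d" by (auto simp: ar_def)
  qed
  have al_inj: "inj_on al D" using al injD by (metis inj_on_def)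
  have ar_inj: "inj_on ar D" using ar injD by (metis inj_on_def)
  \<comment> \<open>Every edge of \<open>D\<close> becomes an arc between edges of \<open>M\<close>,
    and an edge common to both becomes a loop. Injectivity of \<open>al\<close> and
    \<open>ar\<close> gives the degree bounds.\<close>
  define R where "R = (\<lambda>d. (ar d, al d)) ` D"
  have "inj_on fst R" "inj_on snd R" using al_inj ar_inj by (auto simp: R_def inj_on_def)
  from ex_block_partition[OF finM K(1) this] obtain P where P: "finite P" "\<Union>P = M" "disjoint P"
    "\<And>B. B \<in> P \<Longrightarrow> card B \<le> K"
    and cross: "K * card {r \<in> R. r \<in> M \<times> M \<and> (\<forall>B\<in>P. \<not> (fst r \<in> B \<and> snd r \<in> B))} \<le> 2 * card M" by auto
  define n where "n = lcount lv D"
  define T where "T j = cp j + 3 * K" for j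
  \<comment> \<open>A block brings up to \<open>K\<close> edges, so only at these levels can an
    exchange exceed the hard capacity.\<close>
  define full where "full j \<longleftrightarrow> n j + K > cp j + (S + 6 * K)" for j
  \<comment> \<open>The rates of \<open>soft_change\<close>: the least that a removed edge saves,
    and the most that an added edge costs.\<close>
  define g0 where "g0 j = int (n j - 2 * K - T j)" for j
  define g1 where "g1 j = int (n j + K - T j)" for j
  \<comment> \<open>The exchange of block \<open>B\<close> inserts its allowed edges at levels that
    are not full and deletes every edge of \<open>D\<close> that meets an edge of
    \<open>B\<close>.\<close>
  define Y where "Y B = {a \<in> B. ok a \<and> \<not> full (lv a)}" for B
  define X where "X B = {d \<in> D. al d \<in> B \<or> ar d \<in> B}" for B
  \<comment> \<open>An edge of \<open>D\<close> between two blocks is deleted in both exchanges, any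
    other in one only; \<open>cr\<close> counts the repetitions.\<close>
  define cr where "cr = card {d \<in> D. \<forall>B\<in>P. \<not> (ar d \<in> B \<and> al d \<in> B)}"
  define F where "F = card {a \<in> M. \<not> ok a}"
  have cr: "K * cr \<le> 2 * m"
  proof -
    have "{r \<in> R. r \<in> M \<times> M \<and> (\<forall>B\<in>P. \<not> (fst r \<in> B \<and> snd r \<in> B))} =
       (\<lambda>d. (ar d, al d)) ` {d \<in> D. \<forall>B\<in>P. \<not> (ar d \<in> B \<and> al d \<in> B)}"
      using al ar by (auto simp: R_def)
    moreover have "inj_on (\<lambda>d. (ar d, al d)) D" using al_inj by (auto simp: inj_on_def)
    ultimately show ?thesis using cross \<open>card M = m\<close> unfolding cr_def
      by (metis (no_types, lifting) card_image inj_on_subset mem_Collect_eq subsetI)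
  qed
  have disj: "B \<inter> B' = {}" if "B \<in> P" "B' \<in> P" "B \<noteq> B'" for B B'
    using P(3) that by (auto simp: pairwise_def disjnt_def)
  have block: "int S * (int (card (Y B)) - int (card (X B))) \<le>
      (\<Sum>j\<in>lv ` E. int (lcount lv (Y B) j) * g1 j - int (lcount lv (X B) j) * g0 j)"
    if B: "B \<in> P" for B
  proof -
    have BM: "B \<subseteq> M" using P B by auto
    have finB: "finite B" using BM finM by (auto intro: finite_subset)
    have YB: "Y B \<subseteq> B" and finY: "finite (Y B)" using finB by (auto simp: Y_def)
    have XD: "X B \<subseteq> D" by (auto simp: X_def)
    have finX: "finite (X B)" using XD finD by (auto intro: finite_subset)
    have cY: "card (Y B) \<le> K" using P(4)[OF B] card_mono[OF finB YB] by simp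
    have "X B \<subseteq> {d \<in> D. al d \<in> B} \<union> {d \<in> D. ar d \<in> B}" by (auto simp: X_def)
    then have "card (X B) \<le> card ({d \<in> D. al d \<in> B} \<union> {d \<in> D. ar d \<in> B})"
      by (intro card_mono) (use finD in auto)
    also have "\<dots> \<le> card {d \<in> D. al d \<in> B} + card {d \<in> D. ar d \<in> B}" by (rule card_Un_le)
    also have "\<dots> \<le> card B + card B"
      by (intro add_mono card_inj_on_le[of al] card_inj_on_le[of ar])
        (use finB al_inj ar_inj in \<open>auto intro: inj_on_subset\<close>)
    finally have cX: "card (X B) \<le> 2 * K" using P(4)[OF B] by simp
    define D' where "D' = (D - X B) \<union> Y B"
    have avoid: "lft d \<noteq> lft a \<and> rgt d \<noteq> rgt a" if "d \<in> D - X B" "a \<in> B" for d a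
      using that al[of d] ar[of d] inj BM unfolding X_def
      by (metis (no_types, lifting) DiffD1 DiffD2 inj_onD mem_Collect_eq subsetD)
    then have dis: "(D - X B) \<inter> Y B = {}" using YB by blast
    have count: "lcount lv D' j + lcount lv (X B) j = n j + lcount lv (Y B) j" for j
      unfolding D'_def n_def by (rule lcount_exchange[OF finD finY XD dis])
    have x: "lcount lv (X B) j \<le> n j" "lcount lv (X B) j \<le> 2 * K" "lcount lv (Y B) j \<le> K" for j
      using lcount_mono[OF finD XD] lcount_le_card[OF finX, of lv j] lcount_le_card[OF finY, of lv j] cX cY
      by (auto simp: n_def)
    have feas': "feasible lft rgt lv cp ok (S + 6 * K) D'"
    proof -
      have "inj_on lft D'" "inj_on rgt D'" unfolding D'_def
        using avoid YB BM by (intro inj_on_exchange[OF injD(1) inj(1)] inj_on_exchange[OF injD(2) inj(2)]; blast)+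
      moreover have "ok i" if "i \<in> D'" for i using that feas by (auto simp: D'_def Y_def feasible_def)
      moreover have "lcount lv D' (lv i) \<le> cp (lv i) + (S + 6 * K)" if "i \<in> D'" for i
      proof (cases "full (lv i)")
        \<comment> \<open>A full level receives no edge, so its count cannot grow.\<close>
        case True
        then have "{a \<in> Y B. lv a = lv i} = {}" by (auto simp: Y_def)
        then have "lcount lv (Y B) (lv i) = 0" unfolding lcount_def by (simp only: card.empty)
        then have "lcount lv D' (lv i) \<le> n (lv i)" using count[of "lv i"] by linarith
        moreover have "i \<in> D" using that True by (auto simp: D'_def Y_def)
        ultimately show ?thesis using feas unfolding feasible_def n_def by force
      next
        case False
        then show ?thesis using count[of "lv i"] x(3)[of "lv i"] unfolding full_def by linarith
      qed
      ultimately show ?thesis by (simp add: feasible_def)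
    qed
    have sd: "D' = sym_diff D (sym_diff D D')" "sym_diff D D' \<subseteq> E"
      "sym_diff D D' \<subseteq> X B \<union> Y B" using YB BM sub by (auto simp: D'_def X_def)
    have "card (sym_diff D D') \<le> card (X B \<union> Y B)" by (intro card_mono sd) (use finX finY in auto)
    also have "\<dots> \<le> card (X B) + card (Y B)" by (rule card_Un_le)
    finally have "card (sym_diff D D') \<le> k" using cX cY K by simp
    then have "cost S K m lv cp E D \<le> cost S K m lv cp E D'"
      using opt feas' sd unfolding local_opt_def by metis
    then have "int (S * (m - card D) + (\<Sum>j\<in>lv ` E. soft (T j) (n j))) \<le>
      int (S * (m - card D') + (\<Sum>j\<in>lv ` E. soft (T j) (lcount lv D' j)))"
      by (simp only: cost_def T_def n_def of_nat_le_iff)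
    \<comment> \<open>\<open>cost\<close> contains truncated differences; as \<open>card D\<close>
      and \<open>card D'\<close> are at most \<open>m\<close>, they may be computed in the
      integers.\<close>
    moreover have le_m: "card A \<le> m" if "A \<subseteq> E" "inj_on lft A" for A
    proof -
      have "card A = card (lft ` A)" using that by (simp add: card_image)
      also have "\<dots> \<le> card (lft ` M)" using that perf finM by (intro card_mono) auto
      also have "\<dots> = m" using inj \<open>card M = m\<close> by (simp add: card_image)
      finally show ?thesis .
    qed
    moreover have "card D' + card (X B) = card D + card (Y B)"
    proof -
      have "card D' = card (D - X B) + card (Y B)"
        unfolding D'_def using dis finD finY by (intro card_Un_disjoint) auto
      then show ?thesis using card_Diff_subset[OF finX XD] card_mono[OF finD XD] by simp
    qed
    moreover have "D' \<subseteq> E" "inj_on lft D'" using sd sub feas' YB BM by (auto simp: D'_def feasible_def)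
    ultimately have cD: "card D \<le> m" "card D' \<le> m" "int (card D') = int (card D) + int (card (Y B)) - int (card (X B))"
      and "int S * int (m - card D) + (\<Sum>j\<in>lv ` E. int (soft (T j) (n j))) \<le>
       int S * int (m - card D') + (\<Sum>j\<in>lv ` E. int (soft (T j) (lcount lv D' j)))"
      using le_m[OF sub(1) injD(1)] le_m[of D'] by (simp_all only: of_nat_add of_nat_mult of_nat_sum)
    moreover have "int S * int (m - card D) - int S * int (m - card D') =
        int S * (int (card (Y B)) - int (card (X B)))"
    proof -
      have "int (m - card D) - int (m - card D') = int (card (Y B)) - int (card (X B))"
        using cD by (simp add: of_nat_diff)
      then show ?thesis by (simp flip: right_diff_distrib)
    qed
    ultimately have "int S * (int (card (Y B)) - int (card (X B))) \<le>
       (\<Sum>j\<in>lv ` E. int (soft (T j) (lcount lv D' j))) - (\<Sum>j\<in>lv ` E. int (soft (T j) (n j)))"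
      by linarith
    also have "\<dots> = (\<Sum>j\<in>lv ` E. int (soft (T j) (lcount lv D' j)) - int (soft (T j) (n j)))"
      by (simp add: sum_subtractf)
    also have "\<dots> \<le> (\<Sum>j\<in>lv ` E. int (lcount lv (Y B) j) * g1 j - int (lcount lv (X B) j) * g0 j)"
      unfolding g0_def g1_def by (intro sum_mono soft_change count x)
    finally show ?thesis .
  qed
  define Ys where "Ys = {a \<in> M. ok a \<and> \<not> full (lv a)}"
  have finYs: "finite Ys" using finM by (auto simp: Ys_def)
  have part: "(\<Sum>B\<in>P. card {a \<in> A. h a \<in> B}) = card {a \<in> A. h a \<in> M}" if "finite A" for A and h :: "'a \<Rightarrow> 'a"
  proof -
    have "{a \<in> A. h a \<in> M} = (\<Union>B\<in>P. {a \<in> A. h a \<in> B})" using P by auto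
    also have "card \<dots> = (\<Sum>B\<in>P. card {a \<in> A. h a \<in> B})"
    proof (rule card_UN_disjoint[OF P(1)])
      show "\<forall>B\<in>P. finite {a \<in> A. h a \<in> B}" using that by simp
      show "\<forall>B\<in>P. \<forall>B'\<in>P. B \<noteq> B' \<longrightarrow> {a \<in> A. h a \<in> B} \<inter> {a \<in> A. h a \<in> B'} = {}"
        using disj by blast
    qed
    finally show ?thesis by simp
  qed
  have sumY: "(\<Sum>B\<in>P. card (Y B)) = card Ys"
  proof -
    have "Y B = {a \<in> Ys. id a \<in> B}" if "B \<in> P" for B using P that by (auto simp: Y_def Ys_def)
    then have "(\<Sum>B\<in>P. card (Y B)) = (\<Sum>B\<in>P. card {a \<in> Ys. id a \<in> B})" by simp
    also have "\<dots> = card {a \<in> Ys. id a \<in> M}" by (rule part[OF finYs])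
    also have "{a \<in> Ys. id a \<in> M} = Ys" by (auto simp: Ys_def)
    finally show ?thesis .
  qed
  have sumYl: "(\<Sum>B\<in>P. lcount lv (Y B) j) = lcount lv Ys j" for j
  proof -
    have "{a \<in> Y B. lv a = j} = {a \<in> {a \<in> Ys. lv a = j}. id a \<in> B}" if "B \<in> P" for B
      using P that by (auto simp: Y_def Ys_def)
    then have "(\<Sum>B\<in>P. lcount lv (Y B) j) = (\<Sum>B\<in>P. card {a \<in> {a \<in> Ys. lv a = j}. id a \<in> B})"
      by (simp add: lcount_def)
    also have "\<dots> = card {a \<in> {a \<in> Ys. lv a = j}. id a \<in> M}" by (rule part) (use finYs in simp)
    also have "{a \<in> {a \<in> Ys. lv a = j}. id a \<in> M} = {a \<in> Ys. lv a = j}" by (auto simp: Ys_def)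
    finally show ?thesis by (simp add: lcount_def)
  qed
  have sumX: "(\<Sum>B\<in>P. card (X B)) \<le> card D + cr"
  proof -
    \<comment> \<open>Counting \<open>d\<close> at the block of \<open>al d\<close> misses it only
      at the block of \<open>ar d\<close>, and only if the two blocks differ.\<close>
    have "card (X B) \<le> card {d \<in> D. al d \<in> B} + card {d \<in> {d \<in> D. \<forall>B\<in>P. \<not> (ar d \<in> B \<and> al d \<in> B)}. ar d \<in> B}"
      if "B \<in> P" for B
    proof -
      have "X B \<subseteq> {d \<in> D. al d \<in> B} \<union> {d \<in> {d \<in> D. \<forall>B\<in>P. \<not> (ar d \<in> B \<and> al d \<in> B)}. ar d \<in> B}"
        using disj that unfolding X_def by blast
      then have "card (X B) \<le> card ({d \<in> D. al d \<in> B} \<union> {d \<in> {d \<in> D. \<forall>B\<in>P. \<not> (ar d \<in> B \<and> al d \<in> B)}. ar d \<in> B})"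
        by (intro card_mono) (use finD in auto)
      also note card_Un_le
      finally show ?thesis .
    qed
    then have "(\<Sum>B\<in>P. card (X B)) \<le> (\<Sum>B\<in>P. card {d \<in> D. al d \<in> B} +
        card {d \<in> {d \<in> D. \<forall>B\<in>P. \<not> (ar d \<in> B \<and> al d \<in> B)}. ar d \<in> B})" by (rule sum_mono)
    also have "\<dots> = card {d \<in> D. al d \<in> M} + card {d \<in> {d \<in> D. \<forall>B\<in>P. \<not> (ar d \<in> B \<and> al d \<in> B)}. ar d \<in> M}"
      unfolding sum.distrib by (intro arg_cong2[of _ _ _ _ "(+)"] part) (use finD in auto)
    also have "\<dots> \<le> card D + cr" unfolding cr_def
      by (intro add_mono card_mono) (use finD in auto)
    finally show ?thesis .
  qed
  \<comment> \<open>A lower bound is enough, because the sum enters with the factor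
    \<open>- g0 j\<close>, which is not positive.\<close>
  have sumXl: "n j \<le> (\<Sum>B\<in>P. lcount lv (X B) j)" for j
  proof -
    have "{d \<in> D. lv d = j} \<subseteq> (\<Union>B\<in>P. {d \<in> X B. lv d = j})" using al P by (auto simp: X_def)
    then have "n j \<le> card (\<Union>B\<in>P. {d \<in> X B. lv d = j})" unfolding n_def lcount_def
      by (intro card_mono) (use P finD in \<open>auto simp: X_def\<close>)
    also have "\<dots> \<le> (\<Sum>B\<in>P. card {d \<in> X B. lv d = j})" by (rule card_UN_le[OF P(1)])
    finally show ?thesis by (simp add: lcount_def)
  qed
  have "int S * (int (card Ys) - (int (card D) + int cr)) \<le>
      int S * ((\<Sum>B\<in>P. int (card (Y B))) - (\<Sum>B\<in>P. int (card (X B))))"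
    using sumY sumX by (intro mult_left_mono) (simp_all flip: of_nat_sum)
  also have "\<dots> = (\<Sum>B\<in>P. int S * (int (card (Y B)) - int (card (X B))))"
    by (simp add: sum_distrib_left sum_subtractf algebra_simps)
  also have "\<dots> \<le> (\<Sum>B\<in>P. \<Sum>j\<in>lv ` E. int (lcount lv (Y B) j) * g1 j - int (lcount lv (X B) j) * g0 j)"
    by (intro sum_mono block)
  also have "\<dots> = (\<Sum>j\<in>lv ` E. \<Sum>B\<in>P. int (lcount lv (Y B) j) * g1 j - int (lcount lv (X B) j) * g0 j)"
    by (rule sum.swap)
  also have "\<dots> = (\<Sum>j\<in>lv ` E. int (lcount lv Ys j) * g1 j - int (\<Sum>B\<in>P. lcount lv (X B) j) * g0 j)"
    by (simp add: sum_subtractf flip: sum_distrib_right sumYl)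
  also have "\<dots> \<le> (\<Sum>j\<in>lv ` E. int (3 * K) * int (lcount lv M j) -
      int S * (if full j then int (lcount lv M j) else 0))"
  proof (intro sum_mono)
    fix j
    have "int (n j) * g0 j \<le> int (\<Sum>B\<in>P. lcount lv (X B) j) * g0 j"
      using sumXl[of j] by (intro mult_right_mono) (simp_all only: g0_def of_nat_le_iff of_nat_0_le_iff)
    moreover have "int (lcount lv Ys j) * g1 j - int (n j) * g0 j \<le>
        int (3 * K) * int (lcount lv M j) - int S * (if full j then int (lcount lv M j) else 0)"
    proof (cases "full j")
      \<comment> \<open>Nothing is inserted at a full level, but each of its \<open>n j\<close>
        edges saves at least \<open>S\<close> when it is deleted. Since
        \<open>lcount lv M j \<le> n j\<close>, this pays for all edges of \<open>M\<close> left out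
        there.\<close>
      case True
      then have "{a \<in> Ys. lv a = j} = {}" by (auto simp: Ys_def)
      then have "lcount lv Ys j = 0" unfolding lcount_def by (simp only: card.empty)
      moreover have "lcount lv M j \<le> n j" "int S \<le> g0 j"
        using True cap[of j] by (auto simp: full_def g0_def T_def)
      then have "int (lcount lv M j) * int S \<le> int (n j) * g0 j" by (intro mult_mono) auto
      moreover have "0 \<le> int (3 * K) * int (lcount lv M j)" by simp
      ultimately show ?thesis using True
        by (simp only: if_True of_nat_0 mult_zero_left mult.commute[of "int S"])
    next
      case False
      have le: "int (lcount lv Ys j) * g1 j \<le> int (lcount lv M j) * g1 j"
        using lcount_mono[OF finM, of Ys lv j] by (intro mult_right_mono) (auto simp: Ys_def g1_def)
      show ?thesis
      proof (cases "lcount lv M j \<le> n j")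
        case True
        \<comment> \<open>The two rates differ by at most \<open>3 * K\<close>, so no more than this
          is lost per edge of \<open>M\<close>.\<close>
        have "int (lcount lv M j) * g1 j \<le> int (lcount lv M j) * (g0 j + int (3 * K))"
          by (intro mult_left_mono) (auto simp: g0_def g1_def)
        moreover have "int (lcount lv M j) * g0 j \<le> int (n j) * g0 j"
          using True by (intro mult_right_mono) (auto simp: g0_def)
        ultimately show ?thesis using le False by (simp add: algebra_simps)
      next
        case nle: False
        \<comment> \<open>Here \<open>n j < cp j\<close>, so both rates lie below the threshold of
          the penalty.\<close>
        then have "g1 j = 0" "g0 j = 0" using cap[of j] by (auto simp: g0_def g1_def T_def)
        then show ?thesis using False by simp
      qed
    qed
    ultimately show "int (lcount lv Ys j) * g1 j - int (\<Sum>B\<in>P. lcount lv (X B) j) * g0 j \<le>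
        int (3 * K) * int (lcount lv M j) - int S * (if full j then int (lcount lv M j) else 0)"
      by linarith
  qed
  also have "\<dots> = int (3 * K) * int m - int S * int (card {a \<in> M. full (lv a)})"
  proof -
    have "{a \<in> M. lv a \<in> lv ` E} = M" using sub by auto
    then have 1: "(\<Sum>j\<in>lv ` E. lcount lv M j) = m"
      using sum_lcount[OF finM, of "lv ` E" lv] fin \<open>card M = m\<close> by simp
    have "(\<Sum>j\<in>lv ` E. if full j then lcount lv M j else 0) = (\<Sum>j\<in>{j \<in> lv ` E. full j}. lcount lv M j)"
      using fin by (subst sum.inter_filter) auto
    also have "\<dots> = card {a \<in> M. lv a \<in> {j \<in> lv ` E. full j}}" using fin finM by (intro sum_lcount) auto
    also have "{a \<in> M. lv a \<in> {j \<in> lv ` E. full j}} = {a \<in> M. full (lv a)}" using sub by auto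
    finally have 2: "(\<Sum>j\<in>lv ` E. if full j then lcount lv M j else 0) = card {a \<in> M. full (lv a)}" .
    have if_int: "(if full j then int (lcount lv M j) else 0) = int (if full j then lcount lv M j else 0)" for j
      by simp
    show ?thesis
      unfolding if_int sum_subtractf sum_distrib_left[symmetric] of_nat_sum[symmetric] 1 2 ..
  qed
  finally have main: "int S * (int (card Ys) - (int (card D) + int cr)) \<le>
    int (3 * K) * int m - int S * int (card {a \<in> M. full (lv a)})" .
  have "m \<le> card Ys + F + card {a \<in> M. full (lv a)}"
  proof -
    have "M \<subseteq> Ys \<union> {a \<in> M. \<not> ok a} \<union> {a \<in> M. full (lv a)}" by (auto simp: Ys_def)
    then have "card M \<le> card (Ys \<union> {a \<in> M. \<not> ok a} \<union> {a \<in> M. full (lv a)})"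
      by (rule card_mono[rotated]) (use finYs finM in simp)
    also have "\<dots> \<le> card Ys + F + card {a \<in> M. full (lv a)}"
      unfolding F_def by (rule order.trans[OF card_Un_le add_right_mono[OF card_Un_le]])
    finally show ?thesis using \<open>card M = m\<close> by simp
  qed
  \<comment> \<open>The edges of \<open>M\<close> at full levels appear in \<open>main\<close> with
    the same weight \<open>S\<close> and cancel.\<close>
  then have "int S * (int m - int F - int (card {a \<in> M. full (lv a)}) - (int (card D) + int cr))
      \<le> int S * (int (card Ys) - (int (card D) + int cr))" by (intro mult_left_mono) auto
  with main have "int S * (int m - int F - int (card D) - int cr) \<le> int (3 * K) * int m"
    by (simp add: algebra_simps)
  then have "int K * (int S * (int m - int F - int (card D) - int cr)) \<le> int K * (int (3 * K) * int m)"
    by (intro mult_left_mono) auto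
  moreover have "int S * (int K * int cr) \<le> int S * (2 * int m)"
    using cr by (intro mult_left_mono) (simp_all flip: of_nat_mult)
  ultimately have "int K * int S * (int m - int (card D)) \<le>
      int K * int S * int F + 2 * int S * int m + 3 * int K * int K * int m"
    by (simp add: algebra_simps)
  moreover have "card D \<le> m"
    using card_inj_on_le[OF al_inj, of M] al finM \<open>card M = m\<close> by auto
  ultimately have "int (K * S * (m - card D)) \<le> int (K * S * F + 2 * S * m + 3 * K * K * m)"
    by (simp add: of_nat_diff)
  then show ?thesis unfolding F_def by linarith
qed

section \<open>Symmetric monotone norms and levels\<close>

text \<open>The least \<open>j\<close> with \<open>V < 2 ^ Suc j * x\<close>, or \<open>J\<close> if
  there is none below \<open>J\<close>. Doubling \<open>x\<close> instead of halving
  \<open>V\<close> uses additions only.\<close>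

fun level :: "nat \<Rightarrow> real \<Rightarrow> real \<Rightarrow> nat" where
  "level 0 V x = 0"
| "level (Suc J) V x = (if V < x + x then 0 else Suc (level J V (x + x)))"

lemma level_le: "level J V x \<le> J"
  by (induction J V x rule: level.induct) auto

lemma level_lower: "level J V x < J \<Longrightarrow> V < 2 ^ Suc (level J V x) * x"
proof (induction J V x rule: level.induct)
  case (2 J V x)
  show ?case
  proof (cases "V < x + x")
    case False
    then have "V < 2 ^ Suc (level J V (x + x)) * (x + x)" using 2 by simp
    then show ?thesis using False by (simp add: mult.assoc flip: mult_2)
  qed simp
qed simp

lemma level_upper: "x \<le> V \<Longrightarrow> 2 ^ level J V x * x \<le> V"
proof (induction J V x rule: level.induct)
  case (2 J V x)
  show ?case
  proof (cases "V < x + x")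
    case False
    then have "2 ^ level J V (x + x) * (x + x) \<le> V" using 2 by simp
    then show ?thesis using False by (simp add: mult.assoc flip: mult_2)
  qed (use 2 in simp)
qed simp

lemma ex_permutes_extension:
  assumes "finite E" "D \<subseteq> E" "inj_on h D" "h ` D \<subseteq> E"
  shows "\<exists>\<pi>. \<pi> permutes E \<and> (\<forall>d\<in>D. \<pi> d = h d)"
proof -
  have fin: "finite D" "finite (h ` D)" using assms by (auto intro: finite_subset)
  have "card (E - D) = card (E - h ` D)"
    using assms fin by (simp add: card_Diff_subset card_image)
  then obtain g where g: "bij_betw g (E - D) (E - h ` D)"
    using assms fin by (metis bij_betw_iff_card finite_Diff)
  define \<pi> where "\<pi> x = (if x \<in> D then h x else if x \<in> E then g x else x)" for x
  have "bij_betw \<pi> D (h ` D)" using assms by (auto simp: bij_betw_def \<pi>_def inj_on_def)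
  moreover have "bij_betw \<pi> (E - D) (E - h ` D)"
    using g by (subst bij_betw_cong[of _ _ g]) (auto simp: \<pi>_def)
  ultimately have "bij_betw \<pi> (D \<union> (E - D)) (h ` D \<union> (E - h ` D))"
    by (rule bij_betw_combine) auto
  then have "bij_betw \<pi> E E" using assms by (simp add: Un_absorb1)
  then have "\<pi> permutes E" by (rule bij_imp_permutes) (use assms in \<open>auto simp: \<pi>_def\<close>)
  then show ?thesis by (auto simp: \<pi>_def)
qed

section \<open>Norm comparisons from symmetry and monotonicity\<close>

locale monotone_symmetric_norm =
  fixes E :: "'e set" and f :: "('e \<Rightarrow> real) \<Rightarrow> real" and v :: "'e \<Rightarrow> real"
  assumes finite_E: "finite E" and norm: "norm_on E f" and mono: "monotone_norm_on E f"
    and symm: "symmetric_norm_on E f" and v_nonneg: "\<And>e. e \<in> E \<Longrightarrow> 0 \<le> v e"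
begin

lemma restrict_in: "D \<subseteq> E \<Longrightarrow> restrict_vec v D \<in> vectors_on E"
  by (auto simp: vectors_on_def restrict_vec_def)

lemma f_nonneg: "D \<subseteq> E \<Longrightarrow> 0 \<le> f (restrict_vec v D)"
  using norm restrict_in by (auto simp: norm_on_def)

lemma f_mono:
  "x \<in> vectors_on E \<Longrightarrow> y \<in> vectors_on E \<Longrightarrow> (\<And>e. 0 \<le> x e) \<Longrightarrow> (\<And>e. x e \<le> y e) \<Longrightarrow> f x \<le> f y"
  using mono by (auto simp: monotone_norm_on_def)

text \<open>The comparison principle behind all norm bounds: moved along a permutation extending
  \<open>h\<close>, \<open>c\<close> times the vector of \<open>D'\<close> dominates the vector of
  \<open>D\<close> in every coordinate.\<close>

lemma f_inj_le:
  assumes "D \<subseteq> E" "D' \<subseteq> E" "inj_on h D" "h ` D \<subseteq> D'" "0 \<le> c"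
    and le: "\<And>d. d \<in> D \<Longrightarrow> v d \<le> c * v (h d)"
  shows "f (restrict_vec v D) \<le> c * f (restrict_vec v D')"
proof -
  obtain \<pi> where \<pi>: "\<pi> permutes E" "\<And>d. d \<in> D \<Longrightarrow> \<pi> d = h d"
    using ex_permutes_extension[OF finite_E assms(1,3)] assms by blast
  define w where "w = (\<lambda>e. c * restrict_vec v D' e)"
  have w: "w \<in> vectors_on E" using assms by (auto simp: w_def vectors_on_def restrict_vec_def)
  have wn: "0 \<le> w e" for e using assms v_nonneg by (auto simp: w_def restrict_vec_def)
  have "f (restrict_vec v D) \<le> f (w \<circ> \<pi>)"
  proof (rule f_mono)
    show "restrict_vec v D \<in> vectors_on E" by (rule restrict_in[OF assms(1)])
    show "w \<circ> \<pi> \<in> vectors_on E" using w \<pi>(1) by (auto simp: vectors_on_def permutes_not_in)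
    show "0 \<le> restrict_vec v D e" for e using assms v_nonneg by (auto simp: restrict_vec_def)
    show "restrict_vec v D e \<le> (w \<circ> \<pi>) e" for e
      using wn[of "\<pi> e"] le[of e] \<pi>(2)[of e] assms by (auto simp: restrict_vec_def w_def)
  qed
  also have "\<dots> = f w" using symm w \<pi> by (auto simp: symmetric_norm_on_def)
  also have "\<dots> = c * f (restrict_vec v D')"
    using norm restrict_in[OF assms(2)] assms(5) by (simp add: w_def norm_on_def)
  finally show ?thesis .
qed

lemma f_UN_le:
  assumes "finite I" "\<And>i. i \<in> I \<Longrightarrow> A i \<subseteq> E"
  shows "f (restrict_vec v (\<Union>i\<in>I. A i)) \<le> (\<Sum>i\<in>I. f (restrict_vec v (A i)))"
  using assms
proof (induction I)
  case empty
  have "restrict_vec v {} = (\<lambda>_. 0)" by (simp add: restrict_vec_def)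
  then show ?case using norm by (auto simp: norm_on_def vectors_on_def)
next
  case (insert i I)
  have sub: "A i \<subseteq> E" "(\<Union>i\<in>I. A i) \<subseteq> E" using insert by auto
  let ?s = "\<lambda>e. restrict_vec v (A i) e + restrict_vec v (\<Union>i\<in>I. A i) e"
  have "f (restrict_vec v (\<Union>i\<in>insert i I. A i)) \<le> f ?s"
    by (rule f_mono) (use sub v_nonneg insert.prems in \<open>auto simp: restrict_vec_def vectors_on_def subset_iff\<close>)
  also have "\<dots> \<le> f (restrict_vec v (A i)) + f (restrict_vec v (\<Union>i\<in>I. A i))"
    using norm sub[THEN restrict_in] by (auto simp: norm_on_def)
  also have "\<dots> \<le> f (restrict_vec v (A i)) + (\<Sum>i\<in>I. f (restrict_vec v (A i)))"
    using insert by auto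
  finally show ?case using insert by simp
qed

text \<open>The edges of \<open>D\<close> of level \<open>j\<close> are mapped injectively to two copies of the edges of \<open>M\<close> of level at
  most \<open>j\<close>. Those edges of \<open>D\<close> whose level drops by \<open>k\<close> under this map form, for each copy, a vector
  of norm at most \<open>2\<^sup>1\<^sup>-\<^sup>k\<close> times that of \<open>M\<close>, and these bounds add up to \<open>8\<close>.\<close>

lemma f_le_level_counts:
  assumes D: "D \<subseteq> E" "\<And>d. d \<in> D \<Longrightarrow> v d \<le> V" "real (card D) \<le> \<delta> * 2 ^ J"
    and M: "M \<subseteq> E" "e0 \<in> M" "V \<le> v e0"
    and count: "\<And>j. j < J \<Longrightarrow> card {d \<in> D. level J V (v d) = j} \<le> 2 * card {e \<in> M. level J V (v e) \<le> j}"
  shows "f (restrict_vec v D) \<le> (8 + \<delta>) * f (restrict_vec v M)"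
proof -
  let ?lv = "\<lambda>e. level J V (v e)"
  have fin: "finite D" "finite M" using D M finite_E by (auto intro: finite_subset)
  \<comment> \<open>\<open>bool\<close> labels the two copies of \<open>M\<close>, which turns the
    factor 2 in \<open>count\<close> into an injection.\<close>
  let ?Q = "\<lambda>j g. inj_on g {d \<in> D. ?lv d = j} \<and> g ` {d \<in> D. ?lv d = j} \<subseteq> {e \<in> M. ?lv e \<le> j} \<times> (UNIV :: bool set)"
  have ex: "\<exists>g. ?Q j g" if "j < J" for j
  proof -
    have "card {d \<in> D. ?lv d = j} \<le> card ({e \<in> M. ?lv e \<le> j} \<times> (UNIV :: bool set))"
      using count[OF that] by (simp add: card_cartesian_product mult.commute)
    then show ?thesis by (intro inj_on_iff_card_le[THEN iffD2]) (use fin in simp_all)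
  qed
  define g where "g j = (SOME g. ?Q j g)" for j
  have g: "inj_on (g j) {d \<in> D. ?lv d = j}"
    "g j ` {d \<in> D. ?lv d = j} \<subseteq> {e \<in> M. ?lv e \<le> j} \<times> (UNIV :: bool set)" if "j < J" for j
    using someI_ex[OF ex[OF that]] unfolding g_def by blast+
  define h where "h d = fst (g (?lv d) d)" for d
  define t where "t d = snd (g (?lv d) d)" for d
  have h: "h d \<in> M" "?lv (h d) \<le> ?lv d" if "d \<in> D" "?lv d < J" for d
    using g(2)[OF that(2)] that by (auto simp: h_def image_subset_iff mem_Times_iff)
  \<comment> \<open>The injections \<open>g j\<close> of different levels may hit the same edge of
    \<open>M\<close>. Sorting by the drop \<open>k\<close> and the copy \<open>b\<close> repairs
    this: \<open>h d\<close> and \<open>k\<close> determine the level of \<open>d\<close>, so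
    \<open>h\<close> is injective on each class.\<close>
  define A where "A = (\<lambda>(k, b). {d \<in> D. ?lv d < J \<and> t d = b \<and> ?lv d = ?lv (h d) + k})"
  have part: "f (restrict_vec v (A (k, b))) \<le> 2 * (1/2) ^ k * f (restrict_vec v M)" for k b
  proof (rule f_inj_le)
    show "A (k, b) \<subseteq> E" "M \<subseteq> E" "h ` A (k, b) \<subseteq> M" using D M h by (auto simp: A_def)
    show "inj_on h (A (k, b))"
    proof (rule inj_onI)
      fix x y assume xy: "x \<in> A (k, b)" "y \<in> A (k, b)" "h x = h y"
      then have "?lv x = ?lv y" by (auto simp: A_def)
      moreover from this have "g (?lv x) x = g (?lv x) y"
        using xy by (auto simp: A_def h_def t_def prod_eq_iff)
      ultimately show "x = y" using xy g(1)[of "?lv x"] by (auto simp: A_def inj_on_def)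
    qed
    show "v d \<le> 2 * (1/2) ^ k * v (h d)" if "d \<in> A (k, b)" for d
    proof -
      have d: "d \<in> D" "?lv d < J" "?lv d = ?lv (h d) + k" using that by (auto simp: A_def)
      have "2 ^ ?lv d * v d \<le> V" using D d by (intro level_upper) auto
      also have "V \<le> 2 ^ Suc (?lv (h d)) * v (h d)" using d by (intro less_imp_le level_lower) auto
      finally have "2 ^ ?lv (h d) * (2 ^ k * v d) \<le> 2 ^ ?lv (h d) * (2 * v (h d))"
        using d(3) by (simp add: power_add algebra_simps)
      then have "2 ^ k * v d \<le> 2 * v (h d)" by simp
      then show ?thesis by (simp add: field_simps)
    qed
  qed simp
  define B where "B = {d \<in> D. ?lv d = J}"
  have bot: "f (restrict_vec v B) \<le> \<delta> * f (restrict_vec v M)"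
  proof -
    \<comment> \<open>The at most \<open>\<delta> * 2 ^ J\<close> bottom edges are compared one at a
      time with the single edge \<open>e0\<close>, whose value is at least \<open>2 ^ J\<close>
      times as large.\<close>
    have "f (restrict_vec v {d}) \<le> (1/2) ^ J * f (restrict_vec v M)" if "d \<in> B" for d
    proof (rule f_inj_le)
      show "{d} \<subseteq> E" "M \<subseteq> E" "inj_on (\<lambda>_. e0) {d}" "(\<lambda>_. e0) ` {d} \<subseteq> M" using that D M by (auto simp: B_def)
      show "v x \<le> (1/2) ^ J * v e0" if "x \<in> {d}" for x
      proof -
        have "2 ^ ?lv d * v d \<le> V" using D \<open>d \<in> B\<close> by (intro level_upper) (auto simp: B_def)
        then have "2 ^ J * v d \<le> v e0" using \<open>d \<in> B\<close> M by (simp add: B_def)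
        then show ?thesis using that by (simp add: field_simps)
      qed
    qed simp
    then have "(\<Sum>d\<in>B. f (restrict_vec v {d})) \<le> (\<Sum>d\<in>B. (1/2) ^ J * f (restrict_vec v M))"
      by (rule sum_mono)
    moreover have "f (restrict_vec v (\<Union>d\<in>B. {d})) \<le> (\<Sum>d\<in>B. f (restrict_vec v {d}))"
      by (rule f_UN_le) (use fin D in \<open>auto simp: B_def\<close>)
    ultimately have "f (restrict_vec v B) \<le> (real (card B) * (1/2) ^ J) * f (restrict_vec v M)" by simp
    also have "\<dots> \<le> \<delta> * f (restrict_vec v M)"
    proof (intro mult_right_mono f_nonneg M)
      have "card B \<le> card D" using fin by (intro card_mono) (auto simp: B_def)
      then have "real (card B) \<le> \<delta> * 2 ^ J" using D(3) by linarith
      then show "real (card B) * (1/2) ^ J \<le> \<delta>" by (simp add: field_simps)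
    qed
    finally show ?thesis .
  qed
  define I where "I = {..<J} \<times> (UNIV :: bool set)"
  have AE: "A i \<subseteq> E" for i using D by (auto simp: A_def)
  have "D \<subseteq> (\<Union>i\<in>I. A i) \<union> B"
  proof
    fix d assume d: "d \<in> D"
    show "d \<in> (\<Union>i\<in>I. A i) \<union> B"
    proof (cases "?lv d = J")
      case False
      then have lt: "?lv d < J" using level_le[of J V "v d"] by simp
      then have "d \<in> A (?lv d - ?lv (h d), t d)" using h(2)[OF d lt] d by (auto simp: A_def)
      then show ?thesis using lt by (auto simp: I_def)
    qed (use d in \<open>auto simp: B_def\<close>)
  qed
  moreover have "(\<Union>i\<in>I. A i) \<union> B \<subseteq> D" by (auto simp: A_def B_def)
  ultimately have "D = (\<Union>b\<in>UNIV. if b then (\<Union>i\<in>I. A i) else B)" by (auto split: if_splits)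
  moreover have "f (restrict_vec v (\<Union>b\<in>UNIV. if b then (\<Union>i\<in>I. A i) else B)) \<le>
      (\<Sum>b\<in>UNIV. f (restrict_vec v (if b then (\<Union>i\<in>I. A i) else B)))"
    by (rule f_UN_le) (use AE D in \<open>auto simp: B_def split: if_splits\<close>)
  ultimately have "f (restrict_vec v D) \<le> f (restrict_vec v (\<Union>i\<in>I. A i)) + f (restrict_vec v B)"
    by (simp add: UNIV_bool)
  also have "f (restrict_vec v (\<Union>i\<in>I. A i)) \<le> (\<Sum>i\<in>I. f (restrict_vec v (A i)))"
    by (rule f_UN_le) (use AE in \<open>auto simp: I_def\<close>)
  also have "\<dots> \<le> (\<Sum>(k, b)\<in>I. 2 * (1/2) ^ k * f (restrict_vec v M))"
    by (intro sum_mono) (use part in auto)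
  also have "\<dots> = (\<Sum>k<J. (1/2) ^ k) * (4 * f (restrict_vec v M))"
    unfolding I_def sum.cartesian_product[symmetric]
    by (simp add: UNIV_bool sum_distrib_right sum_distrib_left algebra_simps sum.distrib)
  also have "\<dots> \<le> 2 * (4 * f (restrict_vec v M))"
    by (intro mult_right_mono) (use f_nonneg[OF M(1)] in \<open>auto simp: sum_gp_strict\<close>)
  finally show ?thesis using bot by (simp add: algebra_simps)
qed

end

section \<open>Guessing the value profile of an optimal matching\<close>

text \<open>The values \<open>2, 3, 4, 6, 8, 12, \<dots>\<close> grow by factors of at most \<open>3/2\<close>, which leaves room for the constant
  excess below twice the true count, and can be computed by additions only.\<close>

fun cap_seq :: "nat \<Rightarrow> nat" where
  "cap_seq 0 = 2"
| "cap_seq (Suc 0) = 3"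
| "cap_seq (Suc (Suc k)) = 2 * cap_seq k"

lemma cap_seq_Suc: "2 * cap_seq (Suc k) \<le> 3 * cap_seq k"
  by (induction k rule: cap_seq.induct) auto

lemma cap_seq_even: "cap_seq (2 * l) = 2 * 2 ^ l"
  by (induction l) auto

definition cap_index :: "nat \<Rightarrow> nat" where
  "cap_index u = (LEAST k. u \<le> cap_seq k)"

lemma cap_index_exists: "\<exists>k. u \<le> cap_seq k"
proof -
  have "u < 2 ^ u" by (rule less_exp)
  then have "u \<le> cap_seq (2 * u)" by (simp only: cap_seq_even)
  then show ?thesis by blast
qed

lemma cap_index_ge: "u \<le> cap_seq (cap_index u)"
  unfolding cap_index_def using cap_index_exists by (rule LeastI_ex)

lemma cap_index_le: "u \<le> cap_seq k \<Longrightarrow> cap_index u \<le> k"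
  unfolding cap_index_def by (rule Least_le)

lemma cap_index_mono: "u \<le> u' \<Longrightarrow> cap_index u \<le> cap_index u'"
  by (rule cap_index_le) (rule order.trans[OF _ cap_index_ge])

text \<open>By minimality the preceding value is below \<open>u\<close>, and one step grows by at
  most 3/2. At index 0 the value is 2, which \<open>u \<ge> 2\<close> covers.\<close>

lemma cap_index_upper: "u \<ge> 2 \<Longrightarrow> 2 * cap_seq (cap_index u) \<le> 3 * u"
proof (cases "cap_index u")
  case (Suc k)
  then have "\<not> u \<le> cap_seq k" using cap_index_le[of u k] by auto
  then show ?thesis using cap_seq_Suc[of k] Suc by simp
qed simp

text \<open>For the instances without excess. At \<open>u = 1\<close> the bound is tight, as the
  sequence starts with 2.\<close>

lemma cap_index_double: "u \<ge> 1 \<Longrightarrow> cap_seq (cap_index u) \<le> 2 * u"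
proof (cases "u = 1")
  case True
  then have "cap_index u = 0" using cap_index_le[of u 0] by simp
  then show ?thesis using True by simp
qed (use cap_index_upper[of u] in simp)

text \<open>The binary digits of \<open>g\<close>, leading digit first, describe a monotone path: a digit 1 increases the
  current capacity, a digit 0 assigns it to level \<open>j\<close> and moves on to the next level.\<close>

fun decode :: "nat \<Rightarrow> nat \<Rightarrow> nat \<Rightarrow> nat \<Rightarrow> (nat \<Rightarrow> nat) \<Rightarrow> nat \<Rightarrow> nat" where
  "decode 0 g j i c = c"
| "decode (Suc k) g j i c =
     (if g < 2 ^ k then decode k g (Suc j) i (c(j := cap_seq i)) else decode k (g - 2 ^ k) j (Suc i) c)"

text \<open>A lattice path from \<open>(j, i)\<close> to \<open>(J, I)\<close> has \<open>k\<close>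
  steps. The premise \<open>i \<le> \<kappa> j\<close> says that the path has not overshot, and
  monotonicity of \<open>\<kappa>\<close> preserves it when \<open>j\<close> moves on. After the
  last level the remaining digits are 1 and change nothing.\<close>

lemma ex_decode:
  assumes "\<And>a b. a \<le> b \<Longrightarrow> \<kappa> a \<le> \<kappa> b" "\<And>j. j < J \<Longrightarrow> \<kappa> j \<le> I"
  shows "j \<le> J \<Longrightarrow> i \<le> I \<Longrightarrow> (j < J \<longrightarrow> i \<le> \<kappa> j) \<Longrightarrow> k = (J - j) + (I - i) \<Longrightarrow>
    \<exists>g<2 ^ k. \<forall>c a. decode k g j i c a = (if j \<le> a \<and> a < J then cap_seq (\<kappa> a) else c a)"
proof (induction k arbitrary: j i)
  case (Suc k)
  show ?case
  proof (cases "j < J \<and> \<kappa> j = i")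
    case True
    have "Suc j < J \<longrightarrow> i \<le> \<kappa> (Suc j)" using True assms(1)[of j "Suc j"] by auto
    then obtain g where g: "g < 2 ^ k"
      "\<And>c a. decode k g (Suc j) i c a = (if Suc j \<le> a \<and> a < J then cap_seq (\<kappa> a) else c a)"
    proof -
      have "k = (J - Suc j) + (I - i)" using Suc.prems True by linarith
      from Suc.IH[OF _ Suc.prems(2) \<open>Suc j < J \<longrightarrow> i \<le> \<kappa> (Suc j)\<close> this] show ?thesis
        using True that by auto
    qed
    have "decode (Suc k) g j i c a = (if j \<le> a \<and> a < J then cap_seq (\<kappa> a) else c a)" for c a
      using g True by (cases "a = j") auto
    then show ?thesis using g(1) by (intro exI[of _ g]) auto
  next
    case False
    have "Suc i \<le> I" "j < J \<longrightarrow> Suc i \<le> \<kappa> j"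
      using False Suc.prems assms(2)[of j] by (cases "j < J"; fastforce)+
    then obtain g where g: "g < 2 ^ k"
      "\<And>c a. decode k g j (Suc i) c a = (if j \<le> a \<and> a < J then cap_seq (\<kappa> a) else c a)"
    proof -
      have "k = (J - j) + (I - Suc i)" using Suc.prems \<open>Suc i \<le> I\<close> by linarith
      from Suc.IH[OF Suc.prems(1) \<open>Suc i \<le> I\<close> \<open>j < J \<longrightarrow> Suc i \<le> \<kappa> j\<close> this] show ?thesis
        using that by auto
    qed
    have "decode (Suc k) (2 ^ k + g) j i c a = (if j \<le> a \<and> a < J then cap_seq (\<kappa> a) else c a)" for c a
      using g by simp
    then show ?thesis using g(1) by (intro exI[of _ "2 ^ k + g"]) auto
  qed
qed auto

text \<open>Because of ties, both a strict and a weak count are stated. Among the elements with at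
  least \<open>C\<close> elements of at least their value, one of largest value is taken; if
  \<open>C\<close> elements were strictly larger, the least of these would qualify too.\<close>

lemma ex_kth_largest:
  fixes w :: "'i \<Rightarrow> real"
  assumes "finite M" "1 \<le> C" "C \<le> card M"
  shows "\<exists>e\<in>M. card {x \<in> M. w e < w x} < C \<and> C \<le> card {x \<in> M. w e \<le> w x}"
proof -
  define Q where "Q = {e \<in> M. C \<le> card {x \<in> M. w e \<le> w x}}"
  have ne: "M \<noteq> {}" using assms by auto
  obtain e1 where e1: "e1 \<in> M" "\<And>x. x \<in> M \<Longrightarrow> w e1 \<le> w x"
  proof -
    have "Min (w ` M) \<in> w ` M" using assms ne by (intro Min_in) auto
    then obtain e1 where "e1 \<in> M" "w e1 = Min (w ` M)" by auto
    then show ?thesis using assms that[of e1] by simp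
  qed
  then have "{x \<in> M. w e1 \<le> w x} = M" by auto
  then have "e1 \<in> Q" using e1 assms by (auto simp: Q_def)
  moreover have "finite Q" using assms by (auto simp: Q_def)
  ultimately have "Max (w ` Q) \<in> w ` Q" by (intro Max_in) auto
  then obtain e where e: "e \<in> Q" "w e = Max (w ` Q)" by auto
  have max: "w x \<le> w e" if "x \<in> Q" for x using that e \<open>finite Q\<close> by simp
  have "card {x \<in> M. w e < w x} < C"
  proof (rule ccontr)
    let ?A = "{x \<in> M. w e < w x}"
    assume large: "\<not> card ?A < C"
    then have "?A \<noteq> {}" using assms by (metis card.empty less_le_trans less_one not_less)
    moreover have "finite ?A" using assms by simp
    ultimately have "Min (w ` ?A) \<in> w ` ?A" by (intro Min_in) auto
    then obtain y where y: "y \<in> ?A" "w y = Min (w ` ?A)" by auto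
    have "?A \<subseteq> {x \<in> M. w y \<le> w x}" using y \<open>finite ?A\<close> by auto
    then have "card ?A \<le> card {x \<in> M. w y \<le> w x}" using assms by (intro card_mono) auto
    then have "y \<in> Q" using large y by (auto simp: Q_def)
    then show False using max[of y] y by simp
  qed
  moreover have "e \<in> M" "C \<le> card {x \<in> M. w e \<le> w x}" using e(1) unfolding Q_def by blast+
  ultimately show ?thesis by blast
qed

lemma level_ge: "0 < V \<Longrightarrow> V \<le> x \<Longrightarrow> level J V x = 0"
  by (cases J) auto

lemma level_zero: "0 \<le> V \<Longrightarrow> level J V 0 = J"
  by (induction J) auto

text \<open>The parameters of the algorithm, as functions of \<open>q \<ge> 1/\<epsilon>\<close>: block size, value of an edge of the
  matching in the potential, excess allowed in every level, size of the instances that are solved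
  without excess, and size of the exchanges.\<close>

definition blk :: "nat \<Rightarrow> nat" where "blk q = 4 * q"
definition wgt :: "nat \<Rightarrow> nat" where "wgt q = 3 * blk q * blk q"
definition exc :: "nat \<Rightarrow> nat" where "exc q = wgt q + 6 * blk q"
definition small :: "nat \<Rightarrow> nat" where "small q = 2 * exc q * blk q"
definition mv :: "nat \<Rightarrow> nat" where "mv q = 3 * blk q + 2 * small q"

context monotone_symmetric_norm
begin

text \<open>The interface between combinatorics and program. It speaks of every local optimum
  \<open>D\<close>, as it is not known which one the search finds, and of every \<open>cp\<close>
  that agrees with the decoded guess up to level \<open>J\<close>, as other array cells hold
  leftovers. \<open>N\<close> and \<open>p\<close> number the edges by array positions.\<close>

lemma ex_right_guess:
  fixes p :: "'i \<Rightarrow> 'e" and lft :: "'i \<Rightarrow> 'a" and rgt :: "'i \<Rightarrow> 'b" and m l dc q :: nat and w :: "'i \<Rightarrow> real" and \<delta> :: real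
  assumes p: "bij_betw p N E" and w: "\<And>i. i \<in> N \<Longrightarrow> w i = v (p i)"
    and M: "M \<subseteq> N" "inj_on lft M" "inj_on rgt M" "card M = m" "lft ` N \<subseteq> lft ` M" "rgt ` N \<subseteq> rgt ` M"
    and q: "q \<ge> 1" and m: "m \<ge> 1" "m \<le> 2 ^ l" and \<delta>: "1 \<le> \<delta> * 2 ^ dc"
  defines "J \<equiv> l + dc" and "add \<equiv> if m < small q then 0 else exc q"
  shows "\<exists>e\<in>N. \<exists>g<2 ^ (J + 2 * l). \<forall>D cp c. D \<subseteq> N \<longrightarrow> (\<forall>j\<le>J. c j = m) \<longrightarrow>
    (\<forall>j\<le>J. cp j = decode (J + 2 * l) g 0 0 c j) \<longrightarrow>
    feasible lft rgt (\<lambda>i. level J (w e) (w i)) cp (\<lambda>i. w i \<le> w e) add D \<longrightarrow>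
    local_opt (mv q) N (feasible lft rgt (\<lambda>i. level J (w e) (w i)) cp (\<lambda>i. w i \<le> w e) add)
      (cost (wgt q) (blk q) m (\<lambda>i. level J (w e) (w i)) cp N) D \<longrightarrow>
    q * (m - card D) \<le> m \<and> f (restrict_vec v (p ` D)) \<le> (8 + \<delta>) * f (restrict_vec v (p ` M))"
proof -
  have finN: "finite N" using p finite_E by (simp add: bij_betw_finite)
  have finM: "finite M" using M finN by (auto intro: finite_subset)
  \<comment> \<open>For large \<open>m\<close>, \<open>u j \<ge> 2 * exc q\<close> gives
    \<open>3/2 * u j + exc q \<le> 2 * u j\<close>, and \<open>m \<ge> small q\<close> gives
    \<open>C * blk q \<le> m\<close>, so that forbidding fewer than \<open>C\<close> edges of
    \<open>M\<close> is affordable. For small \<open>m\<close>, \<open>C = 1\<close> forbids no edge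
    of \<open>M\<close>.\<close>
  define C where "C = (if m < small q then 1 else 2 * exc q)"
  have par: "blk q \<ge> 1" "wgt q \<ge> 1" using q by (auto simp: blk_def wgt_def)
  have C: "1 \<le> C" "C \<le> m" "m < small q \<or> C * blk q \<le> m"
  proof -
    have "2 * exc q \<le> 2 * exc q * blk q" using par by simp
    then show "C \<le> m" using m unfolding C_def small_def[symmetric]
      by (smt (verit) linorder_not_less order_trans)
    show "1 \<le> C" using par by (auto simp: C_def exc_def)
    show "m < small q \<or> C * blk q \<le> m" by (auto simp: C_def small_def)
  qed
  obtain e where e: "e \<in> M" "card {x \<in> M. w e < w x} < C" "C \<le> card {x \<in> M. w e \<le> w x}"
    using ex_kth_largest[OF finM C(1), of w] C(2) M(4) by auto
  define V where "V = w e"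
  have pE: "p i \<in> E" if "i \<in> N" for i using p that by (auto simp: bij_betw_def)
  have w0: "0 \<le> w i" if "i \<in> N" for i using w[OF that] v_nonneg[OF pE[OF that]] by simp
  have V0: "0 \<le> V" unfolding V_def using e M w0 by blast
  define lv where "lv i = level J V (w i)" for i
  define u where "u j = card {i \<in> M. lv i \<le> j}" for j
  have u_mono: "u a \<le> u b" if "a \<le> b" for a b
    unfolding u_def using that finM by (intro card_mono) auto
  have u_m: "u j \<le> m" for j unfolding u_def M(4)[symmetric] using finM by (intro card_mono) auto
  \<comment> \<open>For \<open>V = 0\<close> even an edge of value \<open>V\<close> has level
    \<open>J\<close>, so positivity is required.\<close>
  have u_C: "C \<le> u j" if "V > 0" for j
  proof -
    have "{x \<in> M. w e \<le> w x} \<subseteq> {i \<in> M. lv i \<le> j}"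
      using level_ge[OF that] by (auto simp: lv_def V_def)
    then have "card {x \<in> M. w e \<le> w x} \<le> u j" unfolding u_def by (rule card_mono[rotated]) (use finM in simp)
    then show ?thesis using e(3) by simp
  qed
  define \<kappa> where "\<kappa> j = cap_index (u j)" for j
  have k1: "\<kappa> a \<le> \<kappa> b" if "a \<le> b" for a b unfolding \<kappa>_def by (intro cap_index_mono u_mono that)
  \<comment> \<open>Since \<open>u j \<le> m \<le> 2 ^ l\<close>, the capacity index climbs at most
    \<open>2 * l\<close> times; together with \<open>J\<close> levels this is the number of
    digits.\<close>
  have k2: "\<kappa> j \<le> 2 * l" for j unfolding \<kappa>_def
    by (rule cap_index_le) (use u_m[of j] m in \<open>simp only: cap_seq_even\<close>)
  obtain g where g: "g < 2 ^ (J + 2 * l)"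
    "\<And>c a. decode (J + 2 * l) g 0 0 c a = (if a < J then cap_seq (\<kappa> a) else c a)"
    using ex_decode[of \<kappa> J "2 * l" 0 0 "J + 2 * l", OF k1 k2] by auto
  have main: "q * (m - card D) \<le> m \<and> f (restrict_vec v (p ` D)) \<le> (8 + \<delta>) * f (restrict_vec v (p ` M))"
    if D: "D \<subseteq> N" and c: "\<forall>j\<le>J. c j = m" and cp': "\<forall>j\<le>J. cp' j = decode (J + 2 * l) g 0 0 c j"
      and feas': "feasible lft rgt lv cp' (\<lambda>i. w i \<le> V) add D"
      and opt': "local_opt (mv q) N (feasible lft rgt lv cp' (\<lambda>i. w i \<le> V) add)
      (cost (wgt q) (blk q) m lv cp' N) D" for D c cp'
  proof -
    \<comment> \<open>The path sets the levels below \<open>J\<close> only; level \<open>J\<close>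
      keeps the initial value \<open>m\<close>, which is no restriction.\<close>
    define cp where "cp j = (if j < J then cap_seq (\<kappa> j) else m)" for j
    have lvJ: "lv i \<le> J" for i unfolding lv_def by (rule level_le)
    have cp_eq: "cp' (lv i) = cp (lv i)" for i
    proof -
      have "cp' (lv i) = (if lv i < J then cap_seq (\<kappa> (lv i)) else c (lv i))"
        using cp' lvJ[of i] unfolding g(2) by blast
      then show ?thesis using c lvJ[of i] by (simp add: cp_def)
    qed
    have feas_eq: "feasible lft rgt lv cp' (\<lambda>i. w i \<le> V) add = feasible lft rgt lv cp (\<lambda>i. w i \<le> V) add"
      by (rule ext) (simp add: feasible_def cp_eq)
    have cost_eq: "cost (wgt q) (blk q) m lv cp' N = cost (wgt q) (blk q) m lv cp N"
      unfolding cost_def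
      by (intro ext arg_cong2[of _ _ _ _ "(+)"] sum.cong refl) (auto simp: cp_eq)
    note feas = feas'[unfolded feas_eq] and opt = opt'[unfolded feas_eq cost_eq]
    have finD: "finite D" using D finN by (auto intro: finite_subset)
    have cap: "lcount lv M j \<le> cp j" for j
    proof (cases "j < J")
      case True
      have "lcount lv M j \<le> u j" unfolding lcount_def u_def using finM by (intro card_mono) auto
      then show ?thesis using True cap_index_ge[of "u j"] by (simp add: cp_def \<kappa>_def)
    qed (use lcount_le_card[OF finM, of lv j] M in \<open>simp add: cp_def\<close>)
    have Dm: "card D \<le> m"
    proof -
      have "card D = card (lft ` D)" using feas by (simp add: feasible_def card_image)
      also have "\<dots> \<le> card (lft ` M)"
        by (rule card_mono[OF finite_imageI[OF finM] order.trans[OF image_mono[OF D] M(5)]])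
      also have "\<dots> = m" using M by (simp add: card_image)
      finally show ?thesis .
    qed
    have size: "q * (m - card D) \<le> m"
    proof (cases "m < small q")
      case True
      \<comment> \<open>With \<open>C = 1\<close> no edge of \<open>M\<close> is heavier than
        \<open>V\<close>, so \<open>M\<close> itself is feasible.\<close>
      then have "card {x \<in> M. V < w x} = 0" using e by (simp add: C_def V_def)
      then have "{x \<in> M. V < w x} = {}" using finM by (simp only: card_eq_0_iff) simp
      then have "\<forall>x\<in>M. w x \<le> V" by force
      then have "feasible lft rgt lv cp (\<lambda>i. w i \<le> V) add M"
        using M cap by (simp add: feasible_def trans_le_add1)
      from local_opt_small[OF finN D M(1,4) this cap _ Dm _ opt]
      have "card D = m" using True par by (simp add: mv_def)
      then show ?thesis by simp
    next
      case False
      then have add: "add = wgt q + 6 * blk q" by (simp add: add_def exc_def)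
      let ?F = "card {a \<in> M. \<not> w a \<le> V}"
      have "blk q * wgt q * (m - card D) \<le> blk q * wgt q * ?F + 2 * wgt q * m + 3 * blk q * blk q * m"
        by (rule local_opt_card[OF finN D M feas[unfolded add] cap par(1) _ opt[unfolded add]]) (simp add: mv_def)
      \<comment> \<open>\<open>wgt q\<close> is chosen such that the last term becomes
        \<open>wgt q * m\<close>. After cancelling \<open>wgt q\<close>, the forbidden edges add a
        fourth \<open>m\<close>, which \<open>blk q = 4 * q\<close> compensates.\<close>
      also have "\<dots> = wgt q * (blk q * ?F + 3 * m)" by (simp add: wgt_def algebra_simps)
      finally have "wgt q * (blk q * (m - card D)) \<le> wgt q * (blk q * ?F + 3 * m)" by (simp add: algebra_simps)
      then have "blk q * (m - card D) \<le> blk q * ?F + 3 * m" using par by simp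
      also have "blk q * ?F \<le> blk q * C" using e by (intro mult_le_mono2) (simp add: V_def not_le)
      also have "blk q * C \<le> m" using C(3) False by (simp add: mult.commute)
      finally show ?thesis by (simp add: blk_def)
    qed
    have count: "lcount lv D j \<le> 2 * u j" if j: "j < J" for j
    proof (cases "\<exists>i\<in>D. lv i = j")
      case False
      then have "{i \<in> D. lv i = j} = {}" by auto
      then show ?thesis unfolding lcount_def by (simp only: card.empty)
    next
      case True
      then obtain i where i: "i \<in> D" "lv i = j" by blast
      have vi: "w i \<le> V" "0 \<le> w i" using feas i D w0 by (auto simp: feasible_def)
      \<comment> \<open>For \<open>V = 0\<close> all allowed edges have value 0 and thus level
        \<open>J\<close>, but \<open>j < J\<close> is occupied.\<close>
      have "V \<noteq> 0"
      proof
        assume "V = 0"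
        then have "w i = 0" using vi by simp
        then have "lv i = J" using level_zero[of V J] V0 by (simp add: lv_def)
        then show False using i j by simp
      qed
      then have C_u: "C \<le> u j" using u_C V0 by simp
      have D_cp: "lcount lv D j \<le> cap_seq (\<kappa> j) + add" using feas i j unfolding feasible_def cp_def by fastforce
      show ?thesis
      proof (cases "m < small q")
        case True
        then have "add = 0" by (simp add: add_def)
        then show ?thesis using D_cp cap_index_double[of "u j"] C_u C(1) by (simp add: \<kappa>_def)
      next
        case False
        then have "add = exc q" "2 * exc q \<le> u j" "2 \<le> u j"
          using C_u par by (auto simp: add_def C_def exc_def)
        then show ?thesis using D_cp cap_index_upper[of "u j"] by (simp add: \<kappa>_def)
      qed
    qed
    have inj: "inj_on p A" if "A \<subseteq> N" for A using p that by (auto simp: bij_betw_def intro: inj_on_subset)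
    have transport: "card {x \<in> p ` A. Q (v x)} = card {i \<in> A. Q (w i)}" if "A \<subseteq> N" for A Q
    proof -
      have "{x \<in> p ` A. Q (v x)} = p ` {i \<in> A. Q (w i)}" using that by (auto simp: w subset_iff)
      then show ?thesis using inj[of "{i \<in> A. Q (w i)}"] that by (simp add: card_image subset_iff)
    qed
    have "f (restrict_vec v (p ` D)) \<le> (8 + \<delta>) * f (restrict_vec v (p ` M))"
    proof (rule f_le_level_counts[where V = V and ?e0.0 = "p e" and J = J])
      show "p ` D \<subseteq> E" "p ` M \<subseteq> E" using D M pE by auto
      show "v d \<le> V" if "d \<in> p ` D" for d
        using that feas D w by (auto simp: feasible_def subset_iff)
      show "p e \<in> p ` M" "V \<le> v (p e)" using e M w by (auto simp: V_def)
      have "real m \<le> 2 ^ l * 1" using m(2) by (metis mult_1_right of_nat_le_iff of_nat_numeral of_nat_power)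
      also have "\<dots> \<le> 2 ^ l * (\<delta> * 2 ^ dc)" using \<delta> by (intro mult_left_mono) auto
      finally show "real (card (p ` D)) \<le> \<delta> * 2 ^ J"
        using Dm inj[OF D] by (simp add: card_image J_def power_add algebra_simps)
      show "card {d \<in> p ` D. level J V (v d) = j} \<le> 2 * card {e \<in> p ` M. level J V (v e) \<le> j}"
        if "j < J" for j
        using count[OF that] transport[OF D, of "\<lambda>x. level J V x = j"] transport[OF M(1), of "\<lambda>x. level J V x \<le> j"]
        by (simp add: lcount_def u_def lv_def)
    qed
    with size show ?thesis by blast
  qed
  show ?thesis using e M g(1) main unfolding lv_def V_def by blast
qed

end

section \<open>Programs with running time bounds\<close>

text \<open>Total correctness with a time bound from one fixed start state, so that postconditions
  can mention this state directly.\<close>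

definition runs :: "(real list \<Rightarrow> real) \<Rightarrow> com \<Rightarrow> nat \<Rightarrow> (state \<Rightarrow> bool) \<Rightarrow> state \<Rightarrow> bool" where
  "runs orc c B Q s \<longleftrightarrow> (\<exists>t s'. exec orc c s t s' \<and> t \<le> B \<and> Q s')"

text \<open>One set of names covers all four sorts of variables; a written name counts as changed in
  each of them.\<close>

primrec writes :: "com \<Rightarrow> vname set" where
  "writes Skip = {}"
| "writes (NAssign x a) = {x}"
| "writes (NArrAssign x i a) = {x}"
| "writes (RAssign x a) = {x}"
| "writes (RArrAssign x i a) = {x}"
| "writes (Query x a k) = {x}"
| "writes (Seq c1 c2) = writes c1 \<union> writes c2"
| "writes (Cond b c1 c2) = writes c1 \<union> writes c2"
| "writes (While b c) = writes c"

definition agree :: "vname set \<Rightarrow> state \<Rightarrow> state \<Rightarrow> bool" where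
  "agree W s s' \<longleftrightarrow> (\<forall>x. x \<notin> W \<longrightarrow>
     nvar s' x = nvar s x \<and> rvar s' x = rvar s x \<and> narr s' x = narr s x \<and> rarr s' x = rarr s x)"

lemma agree_refl: "agree W s s" by (simp add: agree_def)

lemma agree_trans: "agree W s s' \<Longrightarrow> agree W' s' s'' \<Longrightarrow> agree (W \<union> W') s s''"
  by (simp add: agree_def)

lemma agreeD:
  assumes "agree W s s'" "x \<notin> W"
  shows "nvar s' x = nvar s x" "rvar s' x = rvar s x" "narr s' x = narr s x" "rarr s' x = rarr s x"
  using assms by (auto simp: agree_def)

lemma exec_agree: "exec orc c s t s' \<Longrightarrow> agree (writes c) s s'"
  by (induction rule: exec.induct) (auto simp: agree_def)

lemma runs_conseq:
  assumes "runs orc c B Q s" "B \<le> B'" "\<And>s'. Q s' \<Longrightarrow> agree (writes c) s s' \<Longrightarrow> Q' s'"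
  shows "runs orc c B' Q' s"
  using assms exec_agree unfolding runs_def by (meson le_trans)

lemma runs_Seq:
  assumes "runs orc c1 B1 P s" "\<And>s1. P s1 \<Longrightarrow> agree (writes c1) s s1 \<Longrightarrow> runs orc c2 B2 Q s1"
    and "1 + B1 + B2 \<le> B"
  shows "runs orc (Seq c1 c2) B Q s"
proof -
  obtain t1 s1 where 1: "exec orc c1 s t1 s1" "t1 \<le> B1" "P s1" using assms(1) by (auto simp: runs_def)
  from assms(2)[OF 1(3) exec_agree[OF 1(1)]]
  obtain t2 s2 where 2: "exec orc c2 s1 t2 s2" "t2 \<le> B2" "Q s2" by (auto simp: runs_def)
  have "exec orc (Seq c1 c2) s (1 + t1 + t2) s2" by (rule exec.Seq[OF 1(1) 2(1)])
  then show ?thesis using 1 2 assms(3) unfolding runs_def by (intro exI[of _ "1 + t1 + t2"] exI[of _ s2]) auto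
qed

lemma runs_Cond:
  assumes "bval b s \<Longrightarrow> runs orc c1 B1 Q s" "\<not> bval b s \<Longrightarrow> runs orc c2 B1 Q s" "Suc B1 \<le> B"
  shows "runs orc (Cond b c1 c2) B Q s"
proof (cases "bval b s")
  case True
  then obtain t s' where "exec orc c1 s t s'" "t \<le> B1" "Q s'" using assms by (auto simp: runs_def)
  with True assms(3) show ?thesis
    unfolding runs_def by (intro exI[of _ "1 + t"] exI[of _ s']) (auto intro: exec.CondTrue[where t = t, simplified])
next
  case False
  then obtain t s' where "exec orc c2 s t s'" "t \<le> B1" "Q s'" using assms by (auto simp: runs_def)
  with False assms(3) show ?thesis
    unfolding runs_def by (intro exI[of _ "1 + t"] exI[of _ s']) (auto intro: exec.CondFalse[where t = t, simplified])
qed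

text \<open>The measure bounds the number of rounds and so yields termination and running time at
  once. The body may use that what it never writes still has its initial value.\<close>

lemma runs_While:
  assumes "I s"
    and step: "\<And>s'. I s' \<Longrightarrow> bval b s' \<Longrightarrow> agree (writes c) s s' \<Longrightarrow>
      runs orc c B (\<lambda>s''. I s'' \<and> \<mu> s'' < \<mu> s') s'"
    and "\<mu> s * (B + 1) + 1 \<le> B'"
  shows "runs orc (While b c) B' (\<lambda>s'. I s' \<and> \<not> bval b s') s"
proof -
  have "runs orc (While b c) (\<mu> s' * (B + 1) + 1) (\<lambda>s'. I s' \<and> \<not> bval b s') s'"
    if "I s'" "agree (writes c) s s'" for s'
    using that
  proof (induction "\<mu> s'" arbitrary: s' rule: less_induct)
    case less
    show ?case
    proof (cases "bval b s'")
      case False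
      then have "exec orc (While b c) s' 1 s'" by (rule exec.WhileFalse)
      then show ?thesis using less.prems False unfolding runs_def
        by (intro exI[of _ 1] exI[of _ s']) auto
    next
      case True
      obtain t1 s1 where 1: "exec orc c s' t1 s1" "t1 \<le> B" "I s1" "\<mu> s1 < \<mu> s'"
        using step[OF less.prems(1) True less.prems(2)] by (auto simp: runs_def)
      have "agree (writes c) s s1" using agree_trans[OF less.prems(2) exec_agree[OF 1(1)]] by simp
      from less.hyps[OF 1(4,3) this] obtain t2 s2 where 2: "exec orc (While b c) s1 t2 s2"
        "t2 \<le> \<mu> s1 * (B + 1) + 1" "I s2" "\<not> bval b s2" by (auto simp: runs_def)
      have "Suc (\<mu> s1) * (B + 1) \<le> \<mu> s' * (B + 1)" using 1 by (intro mult_le_mono1) simp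
      then have "1 + t1 + t2 \<le> \<mu> s' * (B + 1) + 1" using 1 2 by simp
      moreover have "exec orc (While b c) s' (1 + t1 + t2) s2" by (rule exec.WhileTrue[OF True 1(1) 2(1)])
      ultimately show ?thesis using 2 unfolding runs_def by blast
    qed
  qed
  from this[OF assms(1) agree_refl] show ?thesis
    by (rule runs_conseq[OF _ assms(3)])
qed

definition for_com :: "vname \<Rightarrow> vname \<Rightarrow> com \<Rightarrow> com" where
  "for_com x hi c = Seq (NAssign x (NConst 0))
     (While (NLess (NVar x) (NVar hi)) (Seq c (NAssign x (NPlus (NVar x) (NConst 1)))))"

lemma writes_for_com [simp]: "writes (for_com x hi c) = insert x (writes c)"
  by (auto simp: for_com_def)

lemma runs_NAssign: "Q (s\<lparr>nvar := (nvar s)(x := nval a s)\<rparr>) \<Longrightarrow> 1 \<le> B \<Longrightarrow> runs orc (NAssign x a) B Q s"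
  using exec.NAssign unfolding runs_def by blast

text \<open>The invariant is demanded for the state with advanced counter, so applications need not
  treat the increment. Of the extra 3 units per round, one each goes to the increment, the
  sequencing and the loop test.\<close>

lemma runs_for:
  assumes x: "x \<notin> writes c" "hi \<notin> writes c" "x \<noteq> hi" and N: "nvar s hi = N"
    and start: "I 0 (s\<lparr>nvar := (nvar s)(x := 0)\<rparr>)"
    and step: "\<And>k s'. k < N \<Longrightarrow> I k s' \<Longrightarrow> nvar s' x = k \<Longrightarrow> agree (insert x (writes c)) s s' \<Longrightarrow>
      runs orc c B (\<lambda>s''. I (Suc k) (s''\<lparr>nvar := (nvar s'')(x := Suc k)\<rparr>)) s'"
    and time: "N * (B + 3) + 3 \<le> B'"
  shows "runs orc (for_com x hi c) B' (I N) s"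
  unfolding for_com_def
proof (rule runs_Seq[where ?B1.0 = 1 and ?B2.0 = "N * (B + 2 + 1) + 1"])
  let ?s0 = "s\<lparr>nvar := (nvar s)(x := 0)\<rparr>"
  show "runs orc (NAssign x (NConst 0)) 1 (\<lambda>s'. s' = ?s0) s" by (rule runs_NAssign) simp_all
  fix s1 assume "s1 = ?s0"
  let ?c = "Seq c (NAssign x (NPlus (NVar x) (NConst 1)))"
  let ?J = "\<lambda>s'. agree (insert x (writes c)) s s' \<and> nvar s' x \<le> N \<and> I (nvar s' x) s'"
  have "runs orc (While (NLess (NVar x) (NVar hi)) ?c) (N * (B + 2 + 1) + 1)
    (\<lambda>s'. ?J s' \<and> \<not> bval (NLess (NVar x) (NVar hi)) s') ?s0"
  proof (rule runs_While[where \<mu> = "\<lambda>s'. N - nvar s' x" and B = "B + 2"])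
    show "?J ?s0" using start by (auto simp: agree_def)
    show "(N - nvar ?s0 x) * (B + 2 + 1) + 1 \<le> N * (B + 2 + 1) + 1" by simp
    fix s' assume J: "?J s'" and "bval (NLess (NVar x) (NVar hi)) s'"
    moreover have hi2: "nvar s' hi = N" using J x N agreeD(1)[of _ s s' hi] by auto
    ultimately have lt: "nvar s' x < N" by simp
    have "runs orc c B (\<lambda>s''. I (Suc (nvar s' x)) (s''\<lparr>nvar := (nvar s'')(x := Suc (nvar s' x))\<rparr>)) s'"
      using step[OF lt] J by simp
    then show "runs orc ?c (B + 2) (\<lambda>s''. ?J s'' \<and> N - nvar s'' x < N - nvar s' x) s'"
    proof (rule runs_Seq[where ?B2.0 = 1])
      fix s'' assume I: "I (Suc (nvar s' x)) (s''\<lparr>nvar := (nvar s'')(x := Suc (nvar s' x))\<rparr>)"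
        and ag: "agree (writes c) s' s''"
      have "nvar s'' x = nvar s' x" using ag x by (simp add: agree_def)
      moreover have "agree (insert x (writes c)) s (s''\<lparr>nvar := (nvar s'')(x := Suc (nvar s' x))\<rparr>)"
        using J ag by (simp add: agree_def)
      ultimately show "runs orc (NAssign x (NPlus (NVar x) (NConst 1))) 1
        (\<lambda>s''. ?J s'' \<and> N - nvar s'' x < N - nvar s' x) s''"
        using lt I by (intro runs_NAssign) auto
    qed simp
  qed
  then show "runs orc (While (NLess (NVar x) (NVar hi)) ?c) (N * (B + 2 + 1) + 1) (I N) s1"
    unfolding \<open>s1 = ?s0\<close>
  proof (rule runs_conseq[OF _ order.refl])
    fix s' assume s': "?J s' \<and> \<not> bval (NLess (NVar x) (NVar hi)) s'"
    then have "nvar s' hi = N" using x N agreeD(1)[of _ s s' hi] by auto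
    then show "I N s'" using s' by simp (metis order.antisym not_less)
  qed
qed (use time in \<open>simp add: algebra_simps\<close>)

text \<open>Code without loops and queries can be executed by the simplifier: \<open>denote\<close>
  is its effect and \<open>line_time\<close> bounds its time. Their clauses for \<open>Query\<close>
  and \<open>While\<close> are dummies that \<open>straight\<close> excludes.\<close>

primrec straight :: "com \<Rightarrow> bool" where
  "straight Skip = True"
| "straight (NAssign x a) = True"
| "straight (NArrAssign x i a) = True"
| "straight (RAssign x a) = True"
| "straight (RArrAssign x i a) = True"
| "straight (Query x a k) = False"
| "straight (Seq c1 c2) = (straight c1 \<and> straight c2)"
| "straight (Cond b c1 c2) = (straight c1 \<and> straight c2)"
| "straight (While b c) = False"

primrec denote :: "com \<Rightarrow> state \<Rightarrow> state" where
  "denote Skip s = s"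
| "denote (NAssign x a) s = s\<lparr>nvar := (nvar s)(x := nval a s)\<rparr>"
| "denote (NArrAssign x i a) s = s\<lparr>narr := (narr s)(x := (narr s x)(nval i s := nval a s))\<rparr>"
| "denote (RAssign x a) s = s\<lparr>rvar := (rvar s)(x := rval a s)\<rparr>"
| "denote (RArrAssign x i a) s = s\<lparr>rarr := (rarr s)(x := (rarr s x)(nval i s := rval a s))\<rparr>"
| "denote (Query x a k) s = s"
| "denote (Seq c1 c2) s = denote c2 (denote c1 s)"
| "denote (Cond b c1 c2) s = (if bval b s then denote c1 s else denote c2 s)"
| "denote (While b c) s = s"

primrec line_time :: "com \<Rightarrow> nat" where
  "line_time Skip = 1"
| "line_time (NAssign x a) = 1"
| "line_time (NArrAssign x i a) = 1"
| "line_time (RAssign x a) = 1"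
| "line_time (RArrAssign x i a) = 1"
| "line_time (Query x a k) = 1"
| "line_time (Seq c1 c2) = 1 + line_time c1 + line_time c2"
| "line_time (Cond b c1 c2) = 1 + line_time c1 + line_time c2"
| "line_time (While b c) = 1"

lemma exec_straight: "straight c \<Longrightarrow> \<exists>t\<le>line_time c. exec orc c s t (denote c s)"
proof (induction c arbitrary: s)
  case (Seq c1 c2)
  then obtain t1 t2 where "t1 \<le> line_time c1" "exec orc c1 s t1 (denote c1 s)"
    "t2 \<le> line_time c2" "exec orc c2 (denote c1 s) t2 (denote c2 (denote c1 s))" by fastforce
  then show ?case by (intro exI[of _ "1 + t1 + t2"]) (auto intro: exec.Seq[of orc _ _ t1, simplified])
next
  case (Cond b c1 c2)
  show ?case
  proof (cases "bval b s")
    case True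
    obtain t where "t \<le> line_time c1" "exec orc c1 s t (denote c1 s)" using Cond by fastforce
    then show ?thesis using True by (intro exI[of _ "1 + t"]) (auto intro: exec.CondTrue[simplified])
  next
    case False
    obtain t where "t \<le> line_time c2" "exec orc c2 s t (denote c2 s)" using Cond by fastforce
    then show ?thesis using False by (intro exI[of _ "1 + t"]) (auto intro: exec.CondFalse[simplified])
  qed
qed (auto intro: exec.intros exI[of _ 1])

lemma runs_straight:
  assumes "straight c" "Q (denote c s)" "line_time c \<le> B"
  shows "runs orc c B Q s"
  using exec_straight[OF assms(1), of orc s] assms(2,3) unfolding runs_def by (meson order_trans)

text \<open>The language has no multiplication; a factor fixed with the program is unrolled into a
  sum.\<close>

primrec ntimes :: "nat \<Rightarrow> nexp \<Rightarrow> nexp" where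
  "ntimes 0 e = NConst 0"
| "ntimes (Suc k) e = NPlus e (ntimes k e)"

lemma nval_ntimes [simp]: "nval (ntimes k e) s = k * nval e s"
  by (induction k) auto

section \<open>Evaluating a selection of edges\<close>

lemma lcount_insert:
  "finite I \<Longrightarrow> k \<notin> I \<Longrightarrow> lcount lv (insert k I) j = (if lv k = j then Suc (lcount lv I j) else lcount lv I j)"
proof -
  assume I: "finite I" "k \<notin> I"
  have "{i \<in> insert k I. lv i = j} = (if lv k = j then insert k {i \<in> I. lv i = j} else {i \<in> I. lv i = j})"
    by auto
  then show ?thesis using I by (simp add: lcount_def)
qed

text \<open>Each edge can be tested against those before it. Feasibility passes to subsets, so a
  violation is permanent and a flag that is only ever set during the pass suffices.\<close>

lemma feasible_insert:
  assumes "finite I" "k \<notin> I"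
  shows "feasible lft rgt lv cp ok add (insert k I) \<longleftrightarrow> feasible lft rgt lv cp ok add I \<and>
    lft k \<notin> lft ` I \<and> rgt k \<notin> rgt ` I \<and> ok k \<and> lcount lv I (lv k) < cp (lv k) + add"
proof -
  have "(\<forall>i\<in>insert k I. lcount lv (insert k I) (lv i) \<le> cp (lv i) + add) \<longleftrightarrow>
    (\<forall>i\<in>I. lcount lv I (lv i) \<le> cp (lv i) + add) \<and> lcount lv I (lv k) < cp (lv k) + add"
    (is "?l \<longleftrightarrow> ?r")
  proof
    assume l: ?l
    have "lcount lv I (lv i) \<le> cp (lv i) + add" if "i \<in> I" for i
      using l lcount_mono[of "insert k I" I lv "lv i"] assms that by fastforce
    moreover have "lcount lv (insert k I) (lv k) \<le> cp (lv k) + add" using l by blast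
    ultimately show ?r by (simp add: lcount_insert[OF assms] Suc_le_eq)
  next
    assume ?r
    then show ?l by (simp add: lcount_insert[OF assms] Suc_le_eq) metis
  qed
  then show ?thesis using assms by (auto simp: feasible_def)
qed

lemma soft_sum_insert:
  assumes "finite N" "k \<in> N" "finite I" "k \<notin> I"
  shows "(\<Sum>j\<in>lv ` N. soft (T j) (lcount lv (insert k I) j)) =
    (\<Sum>j\<in>lv ` N. soft (T j) (lcount lv I j)) + (lcount lv I (lv k) - T (lv k))"
proof -
  have "(\<Sum>j\<in>lv ` N. soft (T j) (lcount lv (insert k I) j)) =
      (\<Sum>j\<in>lv ` N. soft (T j) (lcount lv I j) + (if lv k = j then lcount lv I (lv k) - T (lv k) else 0))"
    using assms by (intro sum.cong) (auto simp: lcount_insert soft_def)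
  then show ?thesis using assms by (simp add: sum.distrib sum.delta')
qed

definition sel :: "vname \<Rightarrow> nat \<Rightarrow> state \<Rightarrow> nat set" where
  "sel a n s = {i. i < n \<and> narr s a i \<noteq> 0}"

lemma sel_subset: "sel a n s \<subseteq> {..<n}" by (auto simp: sel_def)

definition for_copy :: "vname \<Rightarrow> vname \<Rightarrow> com" where
  "for_copy a b = for_com ''i'' ''n'' (NArrAssign a (NVar ''i'') (NArr b (NVar ''i'')))"

lemma writes_for_copy [simp]: "writes (for_copy a b) = {''i'', a}" by (simp add: for_copy_def)

lemma runs_for_copy:
  assumes "nvar s ''n'' = n" "a \<notin> {''i'', ''n''}" "b \<notin> {''i'', a}"
  shows "runs orc (for_copy a b) (4 * n + 3) (\<lambda>s'. \<forall>i<n. narr s' a i = narr s b i) s"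
  unfolding for_copy_def
proof (rule runs_for[where N = n and B = 1 and I = "\<lambda>k s'. \<forall>i<k. narr s' a i = narr s b i"])
  fix k s' assume k: "\<forall>i<k. narr s' a i = narr s b i" "nvar s' ''i'' = k"
    and ag: "agree (insert ''i'' (writes (NArrAssign a (NVar ''i'') (NArr b (NVar ''i''))))) s s'"
  have "narr s' b = narr s b" using agreeD(3)[OF ag, of b] assms by auto
  then show "runs orc (NArrAssign a (NVar ''i'') (NArr b (NVar ''i''))) 1
     (\<lambda>s''. \<forall>i<Suc k. narr (s''\<lparr>nvar := (nvar s'')(''i'' := Suc k)\<rparr>) a i = narr s b i) s'"
    using k by (intro runs_straight) (auto simp: less_Suc_eq)
qed (use assms in auto)

text \<open>The arrays are dirty from earlier evaluations. Only cells addressed by some edge are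
  read, so clearing these along the edge list suffices.\<close>

definition eval_reset :: com where
  "eval_reset = Seq (NArrAssign ''cl'' (NArr ''left'' (NVar ''i'')) (NConst 0))
     (Seq (NArrAssign ''cr'' (NArr ''right'' (NVar ''i'')) (NConst 0))
          (NArrAssign ''cn'' (NArr ''lev'' (NVar ''i'')) (NConst 0)))"

definition eval_good :: bexp where
  "eval_good =
     BAnd (NLess (NArr ''cl'' (NArr ''left'' (NVar ''i''))) (NConst 1))
    (BAnd (NLess (NArr ''cr'' (NArr ''right'' (NVar ''i''))) (NConst 1))
    (BAnd (BNot (RLess (RVar ''V'') (RArr ''val'' (NVar ''i''))))
          (NLess (NArr ''cn'' (NArr ''lev'' (NVar ''i'')))
                 (NPlus (NArr ''cap'' (NArr ''lev'' (NVar ''i''))) (NVar ''add'')))))"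

text \<open>The penalty grows by the marginal cost of the new edge, so the test and the penalty use
  the level counter before it is incremented.\<close>

definition eval_step :: "nat \<Rightarrow> com" where
  "eval_step K = Cond (NLess (NConst 0) (NArr ''cur'' (NVar ''i'')))
     (Seq (Cond eval_good Skip (NAssign ''bad'' (NConst 1)))
     (Seq (NAssign ''pen'' (NPlus (NVar ''pen'') (NMinus (NArr ''cn'' (NArr ''lev'' (NVar ''i'')))
        (NPlus (NArr ''cap'' (NArr ''lev'' (NVar ''i''))) (NConst (3 * K))))))
     (Seq (NArrAssign ''cl'' (NArr ''left'' (NVar ''i'')) (NConst 1))
     (Seq (NArrAssign ''cr'' (NArr ''right'' (NVar ''i'')) (NConst 1))
     (Seq (NArrAssign ''cn'' (NArr ''lev'' (NVar ''i'')) (NPlus (NArr ''cn'' (NArr ''lev'' (NVar ''i''))) (NConst 1)))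
          (NAssign ''d'' (NPlus (NVar ''d'') (NConst 1))))))))
     Skip"

definition eval_com :: "nat \<Rightarrow> nat \<Rightarrow> com" where
  "eval_com S K = Seq (for_com ''i'' ''n'' eval_reset)
    (Seq (Seq (NAssign ''d'' (NConst 0)) (Seq (NAssign ''pen'' (NConst 0)) (NAssign ''bad'' (NConst 0))))
    (Seq (for_com ''i'' ''n'' (eval_step K))
         (NAssign ''new'' (NPlus (ntimes S (NMinus (NVar ''m'') (NVar ''d''))) (NVar ''pen'')))))"

lemma writes_eval [simp]: "writes (eval_com S K) = {''i'', ''cl'', ''cr'', ''cn'', ''d'', ''pen'', ''bad'', ''new''}"
  by (auto simp: eval_com_def eval_reset_def eval_step_def)

locale search_instance =
  fixes n m add :: nat and lf rg lv cp :: "nat \<Rightarrow> nat" and w :: "nat \<Rightarrow> real" and V :: real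
    and S K :: nat
begin

definition env :: "state \<Rightarrow> bool" where
  "env s \<longleftrightarrow> nvar s ''n'' = n \<and> nvar s ''m'' = m \<and> nvar s ''add'' = add \<and> narr s ''left'' = lf \<and>
     narr s ''right'' = rg \<and> rarr s ''val'' = w \<and> rvar s ''V'' = V \<and>
     (\<forall>i<n. narr s ''lev'' i = lv i) \<and> narr s ''cap'' = cp"

lemma env_agree:
  "agree W s s' \<Longrightarrow> W \<inter> {''n'', ''m'', ''add'', ''left'', ''right'', ''val'', ''V'', ''lev'', ''cap''} = {} \<Longrightarrow>
    env s \<Longrightarrow> env s'"
  unfolding env_def agree_def disjoint_iff by (metis insertCI)

abbreviation feas :: "nat set \<Rightarrow> bool" where
  "feas \<equiv> feasible lf rg lv cp (\<lambda>i. w i \<le> V) add"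

abbreviation cst :: "nat set \<Rightarrow> nat" where
  "cst \<equiv> cost S K m lv cp {..<n}"

lemma runs_eval:
  assumes env: "env s"
  shows "runs orc (eval_com S K) (50 * n + 50)
    (\<lambda>s'. (nvar s' ''bad'' = 0 \<longleftrightarrow> feas (sel ''cur'' n s)) \<and> nvar s' ''new'' = cst (sel ''cur'' n s)) s"
proof -
  define c0 where "c0 = narr s ''cur''"
  define I where "I k = {i. i < k \<and> c0 i \<noteq> 0}" for k
  have finI: "finite (I k)" and notI: "k \<notin> I k" for k by (auto simp: I_def)
  have I_Suc: "I (Suc k) = (if c0 k \<noteq> 0 then insert k (I k) else I k)" for k
    by (auto simp: I_def less_Suc_eq)
  have reset: "runs orc (for_com ''i'' ''n'' eval_reset) (8 * n + 3)
    (\<lambda>s'. \<forall>i<n. narr s' ''cl'' (lf i) = 0 \<and> narr s' ''cr'' (rg i) = 0 \<and> narr s' ''cn'' (lv i) = 0) s"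
  proof (rule runs_for[where N = n and B = 5 and I = "\<lambda>k s'. \<forall>i<k. narr s' ''cl'' (lf i) = 0 \<and>
      narr s' ''cr'' (rg i) = 0 \<and> narr s' ''cn'' (lv i) = 0"])
    fix k s' assume k: "k < n" "\<forall>i<k. narr s' ''cl'' (lf i) = 0 \<and>
      narr s' ''cr'' (rg i) = 0 \<and> narr s' ''cn'' (lv i) = 0" "nvar s' ''i'' = k"
      and ag: "agree (insert ''i'' (writes eval_reset)) s s'"
    have "env s'" by (rule env_agree[OF ag _ env]) (simp add: eval_reset_def)
    then show "runs orc eval_reset 5 (\<lambda>s''. \<forall>i<Suc k. narr (s''\<lparr>nvar := (nvar s'')(''i'' := Suc k)\<rparr>) ''cl'' (lf i) = 0 \<and>
      narr (s''\<lparr>nvar := (nvar s'')(''i'' := Suc k)\<rparr>) ''cr'' (rg i) = 0 \<and>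
      narr (s''\<lparr>nvar := (nvar s'')(''i'' := Suc k)\<rparr>) ''cn'' (lv i) = 0) s'"
      using k by (intro runs_straight) (simp_all add: eval_reset_def env_def less_Suc_eq)
  qed (use env in \<open>auto simp: eval_reset_def env_def\<close>)
  define Inv where "Inv k s' \<longleftrightarrow> (\<forall>i<n. (narr s' ''cl'' (lf i) \<noteq> 0 \<longleftrightarrow> lf i \<in> lf ` I k) \<and>
      (narr s' ''cr'' (rg i) \<noteq> 0 \<longleftrightarrow> rg i \<in> rg ` I k) \<and> narr s' ''cn'' (lv i) = lcount lv (I k) (lv i)) \<and>
    nvar s' ''d'' = card (I k) \<and> nvar s' ''pen'' = (\<Sum>j\<in>lv ` {..<n}. soft (cp j + 3 * K) (lcount lv (I k) j)) \<and>
    (nvar s' ''bad'' = 0 \<longleftrightarrow> feas (I k))" for k and s' :: state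
  have loop: "runs orc (for_com ''i'' ''n'' (eval_step K)) (18 * n + 3) (Inv n) s2"
    if s2: "Inv 0 (s2\<lparr>nvar := (nvar s2)(''i'' := 0)\<rparr>)" "env s2" "narr s2 ''cur'' = c0" for s2 :: state
  proof (rule runs_for[where N = n and B = 15 and I = Inv])
    fix k s' assume k: "k < n" "Inv k s'" "nvar s' ''i'' = k"
      and ag: "agree (insert ''i'' (writes (eval_step K))) s2 s'"
    have env': "env s'" by (rule env_agree[OF ag _ s2(2)]) (simp add: eval_step_def)
    have cur: "narr s' ''cur'' = c0" using agreeD(3)[OF ag, of "''cur''"] s2 by (simp add: eval_step_def)
    show "runs orc (eval_step K) 15 (\<lambda>s''. Inv (Suc k) (s''\<lparr>nvar := (nvar s'')(''i'' := Suc k)\<rparr>)) s'"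
    proof (rule runs_straight)
      show "straight (eval_step K)" "line_time (eval_step K) \<le> 15" by (simp_all add: eval_step_def)
      show "Inv (Suc k) (denote (eval_step K) s'\<lparr>nvar := (nvar (denote (eval_step K) s'))(''i'' := Suc k)\<rparr>)"
      proof (cases "c0 k = 0")
        case True
        then show ?thesis using k cur by (simp add: eval_step_def Inv_def I_Suc)
      next
        case False
        have e: "narr s' ''left'' = lf" "narr s' ''right'' = rg" "narr s' ''cap'' = cp" "narr s' ''lev'' k = lv k"
          "rarr s' ''val'' = w" "rvar s' ''V'' = V" "nvar s' ''add'' = add"
          using env' k by (auto simp: env_def)
        have inv: "narr s' ''cl'' (lf i) \<noteq> 0 \<longleftrightarrow> lf i \<in> lf ` I k" "narr s' ''cr'' (rg i) \<noteq> 0 \<longleftrightarrow> rg i \<in> rg ` I k"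
          "narr s' ''cn'' (lv i) = lcount lv (I k) (lv i)" if "i < n" for i
          using k(2) that unfolding Inv_def by blast+
        have inv2: "nvar s' ''d'' = card (I k)"
          "nvar s' ''pen'' = (\<Sum>j\<in>lv ` {..<n}. soft (cp j + 3 * K) (lcount lv (I k) j))"
          "nvar s' ''bad'' = 0 \<longleftrightarrow> feas (I k)" using k(2) unfolding Inv_def by blast+
        have IS: "I (Suc k) = insert k (I k)" using False by (simp add: I_Suc)
        have good: "bval eval_good s' \<longleftrightarrow> lf k \<notin> lf ` I k \<and> rg k \<notin> rg ` I k \<and> w k \<le> V \<and>
            lcount lv (I k) (lv k) < cp (lv k) + add"
          using inv[OF k(1)] k(3) e by (auto simp: eval_good_def)
        define t where "t = denote (eval_step K) s'"
        have t: "narr t ''cl'' = (narr s' ''cl'')(lf k := 1)" "narr t ''cr'' = (narr s' ''cr'')(rg k := 1)"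
          "narr t ''cn'' = (narr s' ''cn'')(lv k := Suc (lcount lv (I k) (lv k)))"
          "nvar t ''d'' = Suc (card (I k))"
          "nvar t ''pen'' = nvar s' ''pen'' + (lcount lv (I k) (lv k) - (cp (lv k) + 3 * K))"
          "nvar t ''bad'' = (if bval eval_good s' then nvar s' ''bad'' else 1)"
          using False cur k(3) e inv(3)[OF k(1)] inv2(1) by (simp_all add: t_def eval_step_def)
        have "\<forall>i<n. (narr t ''cl'' (lf i) \<noteq> 0 \<longleftrightarrow> lf i \<in> lf ` insert k (I k)) \<and>
            (narr t ''cr'' (rg i) \<noteq> 0 \<longleftrightarrow> rg i \<in> rg ` insert k (I k)) \<and>
            narr t ''cn'' (lv i) = lcount lv (insert k (I k)) (lv i)"
          unfolding t lcount_insert[OF finI notI] using inv by simp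
        moreover have "nvar t ''bad'' = 0 \<longleftrightarrow> feas (insert k (I k))"
          unfolding t feasible_insert[OF finI notI] using inv2(3) good by simp
        moreover have "nvar t ''pen'' = (\<Sum>j\<in>lv ` {..<n}. soft (cp j + 3 * K) (lcount lv (insert k (I k)) j))"
          unfolding t soft_sum_insert[OF finite_lessThan lessThan_iff[THEN iffD2, OF k(1)] finI notI] inv2(2) ..
        moreover have "nvar t ''d'' = card (insert k (I k))"
          unfolding t card_insert_disjoint[OF finI notI] ..
        ultimately show ?thesis unfolding t_def[symmetric] Inv_def IS by simp
      qed
    qed
  qed (use s2 in \<open>auto simp: eval_step_def env_def\<close>)
  show ?thesis unfolding eval_com_def
  proof (rule runs_Seq[OF reset, where ?B2.0 = "18 * n + 20"])
    fix s1 assume s1: "\<forall>i<n. narr s1 ''cl'' (lf i) = 0 \<and> narr s1 ''cr'' (rg i) = 0 \<and> narr s1 ''cn'' (lv i) = 0"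
      and ag1: "agree (writes (for_com ''i'' ''n'' eval_reset)) s s1"
    have env1: "env s1" by (rule env_agree[OF ag1 _ env]) (simp add: eval_reset_def)
    have cur1: "narr s1 ''cur'' = c0" using agreeD(3)[OF ag1, of "''cur''"] by (simp add: eval_reset_def c0_def)
    let ?c = "Seq (NAssign ''d'' (NConst 0)) (Seq (NAssign ''pen'' (NConst 0)) (NAssign ''bad'' (NConst 0)))"
    have "runs orc ?c 5 (\<lambda>s2. Inv 0 (s2\<lparr>nvar := (nvar s2)(''i'' := 0)\<rparr>) \<and> env s2 \<and> narr s2 ''cur'' = c0) s1"
      using s1 env1 cur1 by (intro runs_straight)
        (auto simp: Inv_def I_def env_def feasible_def soft_def lcount_def)
    then show "runs orc (Seq ?c (Seq (for_com ''i'' ''n'' (eval_step K))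
         (NAssign ''new'' (NPlus (ntimes S (NMinus (NVar ''m'') (NVar ''d''))) (NVar ''pen''))))) (18 * n + 20)
      (\<lambda>s'. (nvar s' ''bad'' = 0 \<longleftrightarrow> feas (sel ''cur'' n s)) \<and> nvar s' ''new'' = cst (sel ''cur'' n s)) s1"
    proof (rule runs_Seq[where ?B2.0 = "18 * n + 5"])
      fix s2 assume s2: "Inv 0 (s2\<lparr>nvar := (nvar s2)(''i'' := 0)\<rparr>) \<and> env s2 \<and> narr s2 ''cur'' = c0"
      show "runs orc (Seq (for_com ''i'' ''n'' (eval_step K))
         (NAssign ''new'' (NPlus (ntimes S (NMinus (NVar ''m'') (NVar ''d''))) (NVar ''pen'')))) (18 * n + 5)
      (\<lambda>s'. (nvar s' ''bad'' = 0 \<longleftrightarrow> feas (sel ''cur'' n s)) \<and> nvar s' ''new'' = cst (sel ''cur'' n s)) s2"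
      proof (rule runs_Seq[OF loop, where ?B2.0 = 1])
        fix s3 assume inv: "Inv n s3" and ag: "agree (writes (for_com ''i'' ''n'' (eval_step K))) s2 s3"
        have "env s3" using env_agree[OF ag] s2 by (simp add: eval_step_def)
        moreover have "I n = sel ''cur'' n s" by (simp add: I_def sel_def c0_def)
        ultimately show "runs orc (NAssign ''new'' (NPlus (ntimes S (NMinus (NVar ''m'') (NVar ''d''))) (NVar ''pen''))) 1
          (\<lambda>s'. (nvar s' ''bad'' = 0 \<longleftrightarrow> feas (sel ''cur'' n s)) \<and> nvar s' ''new'' = cst (sel ''cur'' n s)) s3"
          using inv by (intro runs_NAssign) (simp_all add: Inv_def cost_def env_def)
      qed (use s2 in auto)
    qed simp
  qed simp
qed

end

section \<open>Local search\<close>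

definition try_com :: "nat \<Rightarrow> nat \<Rightarrow> com" where
  "try_com S K = Seq (eval_com S K)
     (Cond (BAnd (NLess (NVar ''bad'') (NConst 1)) (NLess (NVar ''new'') (NVar ''best'')))
        (Seq (NAssign ''best'' (NVar ''new'')) (for_copy ''bst'' ''cur'')) Skip)"

text \<open>One loop variable per nesting depth: \<open>x\<close>, \<open>xx\<close>,
  \<open>xxx\<close> and so on. No other variable starts with \<open>x\<close>, so the first letter
  rules out clashes.\<close>

definition xv :: "nat \<Rightarrow> vname" where
  "xv k = CHR ''x'' # replicate k (CHR ''x'')"

text \<open>This is an involution on the flags 0 and 1 only, hence the invariants that bound flags
  by 1.\<close>

definition toggle :: "vname \<Rightarrow> com" where
  "toggle x = NArrAssign ''cur'' (NVar x) (NMinus (NConst 1) (NArr ''cur'' (NVar x)))"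

text \<open>The number \<open>k\<close> is fixed with the program, so the nested loops over up to
  \<open>k\<close> positions are unrolled. The second \<open>toggle\<close> restores
  \<open>cur\<close>, which remains the centre of the neighbourhood while improvements go to
  \<open>bst\<close>.\<close>

primrec explore :: "nat \<Rightarrow> nat \<Rightarrow> nat \<Rightarrow> com" where
  "explore S K 0 = try_com S K"
| "explore S K (Suc k) = Seq (explore S K k)
     (for_com (xv k) ''n'' (Seq (toggle (xv k)) (Seq (explore S K k) (toggle (xv k)))))"

primrec explore_time :: "nat \<Rightarrow> nat \<Rightarrow> nat" where
  "explore_time n 0 = 60 * n + 70"
| "explore_time n (Suc k) = explore_time n k + n * (explore_time n k + 7) + 4"

text \<open>\<open>phi\<close> is the potential of the centre and \<open>best\<close> that of the
  best set seen; the loop ends when an exploration finds nothing smaller. Starting with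
  \<open>phi\<close> one above \<open>best\<close> forces a first round.\<close>

definition search_com :: "nat \<Rightarrow> nat \<Rightarrow> nat \<Rightarrow> com" where
  "search_com S K M = Seq (for_com ''i'' ''n'' (NArrAssign ''bst'' (NVar ''i'') (NConst 0)))
    (Seq (Seq (NAssign ''best'' (ntimes S (NVar ''m''))) (NAssign ''phi'' (NPlus (NVar ''best'') (NConst 1))))
    (While (NLess (NVar ''best'') (NVar ''phi''))
      (Seq (NAssign ''phi'' (NVar ''best'')) (Seq (for_copy ''cur'' ''bst'') (explore S K M)))))"

definition search_vars :: "vname set" where
  "search_vars = {''i'', ''cl'', ''cr'', ''cn'', ''d'', ''pen'', ''bad'', ''new'', ''best'', ''bst'', ''cur'', ''phi''}"

lemma writes_try: "writes (try_com S K) = search_vars - {''cur'', ''phi''}"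
  by (auto simp: try_com_def search_vars_def)

lemma writes_explore: "writes (explore S K k) \<subseteq> search_vars - {''phi''} \<union> xv ` {..<k}"
proof (induction k)
  case 0
  show ?case by (auto simp: writes_try)
next
  case (Suc k)
  have "writes (explore S K (Suc k)) \<subseteq> writes (explore S K k) \<union> {''cur'', xv k}"
    by (auto simp: toggle_def)
  also have "\<dots> \<subseteq> search_vars - {''phi''} \<union> xv ` {..<Suc k}"
  proof -
    have "''cur'' \<in> search_vars - {''phi''}" by (simp add: search_vars_def)
    then show ?thesis using Suc unfolding lessThan_Suc by blast
  qed
  finally show ?case .
qed

lemma xv_inj: "xv k = xv l \<longleftrightarrow> k = l"
  by (auto simp: xv_def dest: arg_cong[of _ _ length])

lemma xv_notin_explore: "xv k \<notin> writes (explore S K k)"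
proof -
  have "xv k \<notin> search_vars" by (simp add: xv_def search_vars_def)
  moreover have "xv k \<notin> xv ` {..<k}" unfolding image_iff by (simp only: xv_inj) simp
  ultimately show ?thesis using writes_explore[of S K k] by blast
qed

lemma notin_explore: "hd y \<noteq> CHR ''x'' \<Longrightarrow> y \<notin> search_vars - {''phi''} \<Longrightarrow> y \<notin> writes (explore S K k)"
proof -
  assume y: "hd y \<noteq> CHR ''x''" "y \<notin> search_vars - {''phi''}"
  have "hd (xv l) = CHR ''x''" for l by (simp add: xv_def)
  then have "y \<notin> xv ` {..<k}" using y(1) by (metis imageE)
  then show ?thesis using writes_explore[of S K k] y(2) by blast
qed

lemma writes_search: "writes (search_com S K M) \<subseteq> search_vars \<union> xv ` {..<M}"
proof -
  have "{''i'', ''bst'', ''best'', ''phi'', ''cur''} \<subseteq> search_vars" by (simp add: search_vars_def)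
  then show ?thesis using writes_explore[of S K M] unfolding search_com_def writes.simps writes_for_com
    writes_for_copy by blast
qed

context search_instance
begin

definition best_ok :: "state \<Rightarrow> bool" where
  "best_ok s \<longleftrightarrow> feas (sel ''bst'' n s) \<and> nvar s ''best'' = cst (sel ''bst'' n s) \<and> (\<forall>i<n. narr s ''bst'' i \<le> 1)"

lemma best_ok_agree: "agree W s s' \<Longrightarrow> ''bst'' \<notin> W \<Longrightarrow> ''best'' \<notin> W \<Longrightarrow> best_ok s \<Longrightarrow> best_ok s'"
  by (simp add: best_ok_def agree_def sel_def)

lemma runs_try:
  assumes env: "env s" and ok: "best_ok s" and cur: "\<forall>i<n. narr s ''cur'' i \<le> 1"
  shows "runs orc (try_com S K) (60 * n + 70) (\<lambda>s'. best_ok s' \<and> nvar s' ''best'' \<le> nvar s ''best'' \<and>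
    (feas (sel ''cur'' n s) \<longrightarrow> nvar s' ''best'' \<le> cst (sel ''cur'' n s))) s"
  unfolding try_com_def
proof (rule runs_Seq[OF runs_eval[OF env], where ?B2.0 = "4 * n + 10"])
  fix s1 assume s1: "(nvar s1 ''bad'' = 0 \<longleftrightarrow> feas (sel ''cur'' n s)) \<and> nvar s1 ''new'' = cst (sel ''cur'' n s)"
    and ag: "agree (writes (eval_com S K)) s s1"
  have ok1: "best_ok s1" by (rule best_ok_agree[OF ag _ _ ok]) simp_all
  have cur1: "narr s1 ''cur'' = narr s ''cur''" "nvar s1 ''best'' = nvar s ''best''" "nvar s1 ''n'' = n"
    using agreeD[OF ag, of "''cur''"] agreeD[OF ag, of "''best''"] agreeD[OF ag, of "''n''"] env
    by (simp_all add: env_def)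
  show "runs orc (Cond (BAnd (NLess (NVar ''bad'') (NConst 1)) (NLess (NVar ''new'') (NVar ''best'')))
        (Seq (NAssign ''best'' (NVar ''new'')) (for_copy ''bst'' ''cur'')) Skip) (4 * n + 10)
     (\<lambda>s'. best_ok s' \<and> nvar s' ''best'' \<le> nvar s ''best'' \<and>
    (feas (sel ''cur'' n s) \<longrightarrow> nvar s' ''best'' \<le> cst (sel ''cur'' n s))) s1"
  proof (rule runs_Cond[where ?B1.0 = "4 * n + 8"])
    assume b: "bval (BAnd (NLess (NVar ''bad'') (NConst 1)) (NLess (NVar ''new'') (NVar ''best''))) s1"
    let ?s2 = "s1\<lparr>nvar := (nvar s1)(''best'' := nvar s1 ''new'')\<rparr>"
    show "runs orc (Seq (NAssign ''best'' (NVar ''new'')) (for_copy ''bst'' ''cur'')) (4 * n + 8)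
     (\<lambda>s'. best_ok s' \<and> nvar s' ''best'' \<le> nvar s ''best'' \<and>
    (feas (sel ''cur'' n s) \<longrightarrow> nvar s' ''best'' \<le> cst (sel ''cur'' n s))) s1"
    proof (rule runs_Seq[where ?B1.0 = 1 and P = "\<lambda>s2. s2 = ?s2"])
      show "runs orc (NAssign ''best'' (NVar ''new'')) 1 (\<lambda>s2. s2 = ?s2) s1" by (rule runs_NAssign) simp_all
      fix s2 assume s2: "s2 = ?s2"
      have "runs orc (for_copy ''bst'' ''cur'') (4 * n + 3) (\<lambda>s'. \<forall>i<n. narr s' ''bst'' i = narr s2 ''cur'' i) s2"
        by (rule runs_for_copy) (use s2 cur1 in auto)
      then show "runs orc (for_copy ''bst'' ''cur'') (4 * n + 3) (\<lambda>s'. best_ok s' \<and> nvar s' ''best'' \<le> nvar s ''best'' \<and>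
        (feas (sel ''cur'' n s) \<longrightarrow> nvar s' ''best'' \<le> cst (sel ''cur'' n s))) s2"
      proof (rule runs_conseq[OF _ order.refl])
        fix s' assume s': "\<forall>i<n. narr s' ''bst'' i = narr s2 ''cur'' i" and ag': "agree (writes (for_copy ''bst'' ''cur'')) s2 s'"
        have "nvar s' ''best'' = nvar s1 ''new''" using agreeD(1)[OF ag', of "''best''"] s2 by simp
        moreover have "sel ''bst'' n s' = sel ''cur'' n s" using s' s2 cur1 by (auto simp: sel_def)
        moreover have "\<forall>i<n. narr s' ''bst'' i \<le> 1" using s' s2 cur1 cur by simp
        ultimately show "best_ok s' \<and> nvar s' ''best'' \<le> nvar s ''best'' \<and>
           (feas (sel ''cur'' n s) \<longrightarrow> nvar s' ''best'' \<le> cst (sel ''cur'' n s))"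
          using b s1 cur1 by (auto simp: best_ok_def)
      qed
    qed simp
  next
    assume b: "\<not> bval (BAnd (NLess (NVar ''bad'') (NConst 1)) (NLess (NVar ''new'') (NVar ''best''))) s1"
    show "runs orc Skip (4 * n + 8) (\<lambda>s'. best_ok s' \<and> nvar s' ''best'' \<le> nvar s ''best'' \<and>
        (feas (sel ''cur'' n s) \<longrightarrow> nvar s' ''best'' \<le> cst (sel ''cur'' n s))) s1"
      using b s1 cur1 ok1 by (intro runs_straight) auto
  qed simp
qed simp

lemma sel_toggle:
  assumes "\<forall>i<n. narr s ''cur'' i \<le> 1" "x < n" "narr s' ''cur'' = (narr s ''cur'')(x := 1 - narr s ''cur'' x)"
  shows "sel ''cur'' n s' = sym_diff (sel ''cur'' n s) {x}"
proof -
  have "narr s ''cur'' x = 0 \<or> narr s ''cur'' x = 1" using assms by (metis le_less_Suc_eq less_one One_nat_def le_neq_implies_less)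
  then show ?thesis using assms by (auto simp: sel_def)
qed

text \<open>A nonempty \<open>X\<close> is reached by flipping some \<open>y \<in> X\<close> and
  exploring \<open>X - {y}\<close> from there. As \<open>best\<close> never increases, a bound
  reached in one round persists.\<close>

lemma runs_explore:
  assumes "env s" "best_ok s" "\<forall>i<n. narr s ''cur'' i \<le> 1"
  shows "runs orc (explore S K k) (explore_time n k) (\<lambda>s'. best_ok s' \<and> nvar s' ''best'' \<le> nvar s ''best'' \<and>
    narr s' ''cur'' = narr s ''cur'' \<and> (\<forall>X\<subseteq>{..<n}. card X \<le> k \<longrightarrow> feas (sym_diff (sel ''cur'' n s) X) \<longrightarrow>
      nvar s' ''best'' \<le> cst (sym_diff (sel ''cur'' n s) X))) s"
  using assms
proof (induction k arbitrary: s)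
  case 0
  show ?case unfolding explore.simps explore_time.simps
  proof (rule runs_conseq[OF runs_try[OF 0] order.refl])
    fix s' assume s': "best_ok s' \<and> nvar s' ''best'' \<le> nvar s ''best'' \<and>
      (feas (sel ''cur'' n s) \<longrightarrow> nvar s' ''best'' \<le> cst (sel ''cur'' n s))"
      and ag: "agree (writes (try_com S K)) s s'"
    have "narr s' ''cur'' = narr s ''cur''" using agreeD(3)[OF ag, of "''cur''"] by (simp add: writes_try)
    moreover have "nvar s' ''best'' \<le> cst (sym_diff (sel ''cur'' n s) X)"
      if X: "X \<subseteq> {..<n}" "card X \<le> 0" "feas (sym_diff (sel ''cur'' n s) X)" for X
    proof -
      have "X = {}" using X finite_subset[OF X(1)] by simp
      then show ?thesis using s' X(3) by simp
    qed
    ultimately show "best_ok s' \<and> nvar s' ''best'' \<le> nvar s ''best'' \<and> narr s' ''cur'' = narr s ''cur'' \<and>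
      (\<forall>X\<subseteq>{..<n}. card X \<le> 0 \<longrightarrow> feas (sym_diff (sel ''cur'' n s) X) \<longrightarrow>
        nvar s' ''best'' \<le> cst (sym_diff (sel ''cur'' n s) X))"
      using s' by blast
  qed
next
  case (Suc k)
  let ?D = "sel ''cur'' n s" and ?b = "\<lambda>s'. nvar s' ''best''" and ?x = "xv k"
  let ?c = "Seq (toggle ?x) (Seq (explore S K k) (toggle ?x))"
  have wr: "writes (explore S K k) \<inter> {''n'', ''m'', ''add'', ''left'', ''right'', ''val'', ''V'', ''lev'', ''cap''} = {}"
    "?x \<notin> writes (explore S K k)" "?x \<notin> writes ?c" "''n'' \<notin> writes ?c"
    "writes ?c \<inter> {''n'', ''m'', ''add'', ''left'', ''right'', ''val'', ''V'', ''lev'', ''cap''} = {}"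
    by (simp_all add: toggle_def notin_explore xv_notin_explore search_vars_def Int_Un_distrib2)
      (simp_all add: xv_def)
  have wx: "?x \<notin> {''n'', ''m'', ''add'', ''left'', ''right'', ''val'', ''V'', ''lev'', ''cap''}" "?x \<noteq> ''best''" "?x \<noteq> ''bst''" "?x \<noteq> ''cur''"
    by (simp_all add: xv_def)
  show ?case unfolding explore.simps
  proof (rule runs_Seq[OF Suc.IH[OF Suc.prems], where ?B2.0 = "n * (explore_time n k + 4 + 3) + 3"])
    fix s1 assume s1: "best_ok s1 \<and> ?b s1 \<le> ?b s \<and> narr s1 ''cur'' = narr s ''cur'' \<and>
      (\<forall>X\<subseteq>{..<n}. card X \<le> k \<longrightarrow> feas (sym_diff ?D X) \<longrightarrow> ?b s1 \<le> cst (sym_diff ?D X))"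
      and ag1: "agree (writes (explore S K k)) s s1"
    have env1: "env s1" by (rule env_agree[OF ag1 wr(1) Suc.prems(1)])
    define Inv where "Inv a s' \<longleftrightarrow> best_ok s' \<and> ?b s' \<le> ?b s1 \<and> narr s' ''cur'' = narr s ''cur'' \<and>
      (\<forall>y<a. \<forall>X\<subseteq>{..<n}. card X \<le> k \<longrightarrow> feas (sym_diff (sym_diff ?D {y}) X) \<longrightarrow>
        ?b s' \<le> cst (sym_diff (sym_diff ?D {y}) X))" for a s'
    have Inv_upd: "Inv a (s'\<lparr>nvar := (nvar s')(?x := y)\<rparr>) \<longleftrightarrow> Inv a s'" for a s' y
      using wx by (simp add: Inv_def best_ok_def sel_def)
    have "runs orc (for_com ?x ''n'' ?c) (n * (explore_time n k + 4 + 3) + 3) (Inv n) s1"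
    proof (rule runs_for[where N = n and I = Inv and B = "explore_time n k + 4"])
      show "nvar s1 ''n'' = n" using env1 by (simp add: env_def)
      show "Inv 0 (s1\<lparr>nvar := (nvar s1)(?x := 0)\<rparr>)" unfolding Inv_upd using s1 by (simp add: Inv_def)
      fix a s2 assume a: "a < n" and inv: "Inv a s2" and x: "nvar s2 ?x = a"
        and ag2: "agree (insert ?x (writes ?c)) s1 s2"
      have env2: "env s2" by (rule env_agree[OF ag2 _ env1]) (use wr wx in auto)
      have cur01: "narr s ''cur'' a = 0 \<or> narr s ''cur'' a = 1" using Suc.prems(3) a
        by (metis le_less_Suc_eq less_one One_nat_def le_neq_implies_less)
      let ?tog = "\<lambda>s'. s'\<lparr>narr := (narr s')(''cur'' := (narr s' ''cur'')(a := 1 - narr s' ''cur'' a))\<rparr>"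
      show "runs orc ?c (explore_time n k + 4) (\<lambda>s'. Inv (Suc a) (s'\<lparr>nvar := (nvar s')(?x := Suc a)\<rparr>)) s2"
        unfolding Inv_upd
      proof (rule runs_Seq[where P = "\<lambda>s3. s3 = ?tog s2" and ?B1.0 = 1 and ?B2.0 = "explore_time n k + 2"])
        show "runs orc (toggle ?x) 1 (\<lambda>s3. s3 = ?tog s2) s2"
          by (rule runs_straight) (use x in \<open>simp_all add: toggle_def\<close>)
        fix s3 assume s3: "s3 = ?tog s2"
        have cur2: "narr s2 ''cur'' = narr s ''cur''" using inv by (simp add: Inv_def)
        have D3: "sel ''cur'' n s3 = sym_diff ?D {a}"
          by (rule sel_toggle[OF Suc.prems(3) a]) (use s3 cur2 in simp)
        have p3: "env s3" "best_ok s3" "\<forall>i<n. narr s3 ''cur'' i \<le> 1" "?b s3 = ?b s2" "nvar s3 ?x = a"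
          using env2 inv s3 cur2 Suc.prems(3) x by (auto simp: env_def Inv_def best_ok_def sel_def)
        show "runs orc (Seq (explore S K k) (toggle ?x)) (explore_time n k + 2) (Inv (Suc a)) s3"
        proof (rule runs_Seq[OF Suc.IH[OF p3(1-3)], where ?B2.0 = 1])
          fix s4 assume s4: "best_ok s4 \<and> ?b s4 \<le> ?b s3 \<and> narr s4 ''cur'' = narr s3 ''cur'' \<and>
            (\<forall>X\<subseteq>{..<n}. card X \<le> k \<longrightarrow> feas (sym_diff (sel ''cur'' n s3) X) \<longrightarrow>
              ?b s4 \<le> cst (sym_diff (sel ''cur'' n s3) X))"
            and ag4: "agree (writes (explore S K k)) s3 s4"
          have x4: "nvar s4 ?x = a" using agreeD(1)[OF ag4 wr(2)] p3 by simp
          have "(narr s4 ''cur'')(a := 1 - narr s4 ''cur'' a) = narr s ''cur''"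
            using s4 s3 cur2 cur01 by auto
          then have cur5: "narr (?tog s4) ''cur'' = narr s ''cur''" by simp
          have inv5: "Inv (Suc a) (?tog s4)"
            unfolding Inv_def
          proof (intro conjI allI impI)
            show "best_ok (?tog s4)" using s4 by (simp add: best_ok_def sel_def)
            show "?b (?tog s4) \<le> ?b s1" using s4 p3(4) inv by (simp add: Inv_def)
            show "narr (?tog s4) ''cur'' = narr s ''cur''" by (rule cur5)
            fix y X assume yX: "y < Suc a" "X \<subseteq> {..<n}" "card X \<le> k" "feas (sym_diff (sym_diff ?D {y}) X)"
            show "?b (?tog s4) \<le> cst (sym_diff (sym_diff ?D {y}) X)"
            proof (cases "y = a")
              case True
              then show ?thesis using s4 yX unfolding D3 by simp
            next
              case False
              then have "?b s2 \<le> cst (sym_diff (sym_diff ?D {y}) X)" using inv yX unfolding Inv_def by auto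
              then show ?thesis using s4 p3(4) by simp
            qed
          qed
          show "runs orc (toggle ?x) 1 (Inv (Suc a)) s4"
            using inv5 x4 by (intro runs_straight) (simp_all add: toggle_def)
        qed simp
      qed simp
    qed (use wr wx in auto)
    then show "runs orc (for_com ?x ''n'' ?c) (n * (explore_time n k + 4 + 3) + 3) (\<lambda>s'. best_ok s' \<and> ?b s' \<le> ?b s \<and>
      narr s' ''cur'' = narr s ''cur'' \<and> (\<forall>X\<subseteq>{..<n}. card X \<le> Suc k \<longrightarrow> feas (sym_diff ?D X) \<longrightarrow>
      ?b s' \<le> cst (sym_diff ?D X))) s1"
    proof (rule runs_conseq[OF _ order.refl])
      fix s' assume inv: "Inv n s'"
      have "?b s' \<le> cst (sym_diff ?D X)" if X: "X \<subseteq> {..<n}" "card X \<le> Suc k" "feas (sym_diff ?D X)" for X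
      proof (cases "X = {}")
        case True
        then have "?b s1 \<le> cst (sym_diff ?D X)" using s1 X by auto
        then show ?thesis using inv by (simp add: Inv_def)
      next
        case False
        then obtain y where y: "y \<in> X" by auto
        have eq: "sym_diff ?D X = sym_diff (sym_diff ?D {y}) (X - {y})" using y by auto
        have "y < n" "X - {y} \<subseteq> {..<n}" "card (X - {y}) \<le> k"
          using y X finite_subset[OF X(1)] by auto
        then show ?thesis using inv X(3) unfolding Inv_def eq by blast
      qed
      then show "best_ok s' \<and> ?b s' \<le> ?b s \<and>
        narr s' ''cur'' = narr s ''cur'' \<and> (\<forall>X\<subseteq>{..<n}. card X \<le> Suc k \<longrightarrow> feas (sym_diff ?D X) \<longrightarrow>
        ?b s' \<le> cst (sym_diff ?D X))" using inv s1 by (auto simp: Inv_def)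
    qed
  qed simp
qed

definition search_time :: "nat \<Rightarrow> nat" where
  "search_time M = 4 * n + 10 + (S * m + 1) * (explore_time n M + 4 * n + 10)"

lemma runs_search:
  assumes env: "env s"
  shows "runs orc (search_com S K M) (search_time M)
    (\<lambda>s'. feas (sel ''cur'' n s') \<and> local_opt M {..<n} feas cst (sel ''cur'' n s')) s"
proof -
  let ?names = "{''n'', ''m'', ''add'', ''left'', ''right'', ''val'', ''V'', ''lev'', ''cap''}"
  let ?b = "\<lambda>s'. nvar s' ''best''" and ?phi = "\<lambda>s'. nvar s' ''phi''"
  have wr: "writes (explore S K M) \<inter> ?names = {}" "''phi'' \<notin> writes (explore S K M)"
    by (simp_all add: notin_explore search_vars_def)
  let ?P0 = "\<lambda>s1 :: state. (\<forall>i<n. narr s1 ''bst'' i = 0)"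
  have init: "runs orc (for_com ''i'' ''n'' (NArrAssign ''bst'' (NVar ''i'') (NConst 0))) (4 * n + 3) ?P0 s"
  proof (rule runs_for[where N = n and B = 1 and I = "\<lambda>k (s1 :: state). \<forall>i<k. narr s1 ''bst'' i = 0"])
    show "nvar s ''n'' = n" using env by (simp add: env_def)
    fix k and s' :: state assume "\<forall>i<k. narr s' ''bst'' i = 0" "nvar s' ''i'' = k"
    then show "runs orc (NArrAssign ''bst'' (NVar ''i'') (NConst 0)) 1
      (\<lambda>s''. \<forall>i<Suc k. narr (s''\<lparr>nvar := (nvar s'')(''i'' := Suc k)\<rparr>) ''bst'' i = 0) s'"
      by (intro runs_straight) (simp_all add: less_Suc_eq)
  qed simp_all
  define W where "W = While (NLess (NVar ''best'') (NVar ''phi''))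
      (Seq (NAssign ''phi'' (NVar ''best'')) (Seq (for_copy ''cur'' ''bst'') (explore S K M)))"
  define moves where "moves s' c \<longleftrightarrow> (\<forall>X\<subseteq>{..<n}. card X \<le> M \<longrightarrow> feas (sym_diff (sel ''cur'' n s') X) \<longrightarrow>
      c \<le> cst (sym_diff (sel ''cur'' n s') X))" for s' :: state and c
  \<comment> \<open>Either an improvement on \<open>phi\<close> waits in \<open>bst\<close>, or the
    neighbourhood of \<open>cur\<close> has been explored without finding one. On exit only the
    second case is left, which is local optimality.\<close>
  define Inv where "Inv s' \<longleftrightarrow> env s' \<and> best_ok s' \<and> (?b s' < ?phi s' \<or>
      feas (sel ''cur'' n s') \<and> ?phi s' = cst (sel ''cur'' n s') \<and> moves s' (?phi s'))" for s'
  have loop: "runs orc W ((S * m + 1) * (explore_time n M + 4 * n + 7 + 1) + 1)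
    (\<lambda>s'. Inv s' \<and> \<not> bval (NLess (NVar ''best'') (NVar ''phi'')) s') s2"
    if s2: "env s2" "best_ok s2" "?b s2 < ?phi s2" "?phi s2 = S * m + 1" for s2
    unfolding W_def
  \<comment> \<open>Each round lowers \<open>phi\<close> to the old \<open>best\<close>. It starts
    one above \<open>S * m\<close>, the potential of the empty set, which bounds the number of
    rounds.\<close>
  proof (rule runs_While[where \<mu> = "\<lambda>s'. nvar s' ''phi''" and B = "explore_time n M + 4 * n + 7"])
    show "Inv s2" using s2 by (simp add: Inv_def)
    fix s3 assume inv: "Inv s3" and b: "bval (NLess (NVar ''best'') (NVar ''phi'')) s3"
    let ?s4 = "s3\<lparr>nvar := (nvar s3)(''phi'' := ?b s3)\<rparr>"
    show "runs orc (Seq (NAssign ''phi'' (NVar ''best'')) (Seq (for_copy ''cur'' ''bst'') (explore S K M)))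
      (explore_time n M + 4 * n + 7) (\<lambda>s'. Inv s' \<and> ?phi s' < ?phi s3) s3"
    proof (rule runs_Seq[where P = "\<lambda>s4. s4 = ?s4" and ?B1.0 = 1 and ?B2.0 = "explore_time n M + 4 * n + 5"])
      show "runs orc (NAssign ''phi'' (NVar ''best'')) 1 (\<lambda>s4. s4 = ?s4) s3" by (rule runs_NAssign) simp_all
      fix s4 assume s4: "s4 = ?s4"
      have p4: "env s4" "best_ok s4" "?phi s4 = ?b s4" "?phi s4 < ?phi s3"
        using s4 inv b by (auto simp: Inv_def env_def best_ok_def sel_def)
      have "runs orc (for_copy ''cur'' ''bst'') (4 * n + 3) (\<lambda>s'. \<forall>i<n. narr s' ''cur'' i = narr s4 ''bst'' i) s4"
        by (rule runs_for_copy) (use p4 in \<open>auto simp: env_def\<close>)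
      then show "runs orc (Seq (for_copy ''cur'' ''bst'') (explore S K M)) (explore_time n M + 4 * n + 5)
        (\<lambda>s'. Inv s' \<and> ?phi s' < ?phi s3) s4"
      proof (rule runs_Seq[where ?B2.0 = "explore_time n M"])
        fix s5 assume s5: "\<forall>i<n. narr s5 ''cur'' i = narr s4 ''bst'' i"
          and ag5: "agree (writes (for_copy ''cur'' ''bst'')) s4 s5"
        have env5: "env s5" by (rule env_agree[OF ag5 _ p4(1)]) simp
        have ok5: "best_ok s5" by (rule best_ok_agree[OF ag5 _ _ p4(2)]) simp_all
        have e5: "narr s5 ''bst'' = narr s4 ''bst''" "?b s5 = ?b s4" "?phi s5 = ?phi s4"
          using agreeD[OF ag5, of "''bst''"] agreeD[OF ag5, of "''best''"] agreeD[OF ag5, of "''phi''"] by simp_all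
        have cur5: "\<forall>i<n. narr s5 ''cur'' i \<le> 1" using s5 p4 by (simp add: best_ok_def)
        have sel5: "sel ''cur'' n s5 = sel ''bst'' n s5" using s5 e5 by (auto simp: sel_def)
        show "runs orc (explore S K M) (explore_time n M) (\<lambda>s'. Inv s' \<and> ?phi s' < ?phi s3) s5"
        proof (rule runs_conseq[OF runs_explore[OF env5 ok5 cur5] order.refl])
          fix s6 assume s6: "best_ok s6 \<and> ?b s6 \<le> ?b s5 \<and> narr s6 ''cur'' = narr s5 ''cur'' \<and>
            (\<forall>X\<subseteq>{..<n}. card X \<le> M \<longrightarrow> feas (sym_diff (sel ''cur'' n s5) X) \<longrightarrow>
              ?b s6 \<le> cst (sym_diff (sel ''cur'' n s5) X))"
            and ag6: "agree (writes (explore S K M)) s5 s6"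
          have env6: "env s6" by (rule env_agree[OF ag6 wr(1) env5])
          have phi6: "?phi s6 = ?phi s5" by (rule agreeD(1)[OF ag6 wr(2)])
          have sel6: "sel ''cur'' n s6 = sel ''cur'' n s5" using s6 by (simp add: sel_def)
          have feas6: "feas (sel ''cur'' n s6)" "cst (sel ''cur'' n s6) = ?phi s6"
            using ok5 sel6 sel5 phi6 e5 p4(3) by (simp_all add: best_ok_def)
          have "moves s6 (?b s6)" using s6 sel6 by (simp add: moves_def)
          then have "?b s6 < ?phi s6 \<or> moves s6 (?phi s6)"
            unfolding moves_def by (meson le_trans not_less)
          then show "Inv s6 \<and> ?phi s6 < ?phi s3"
            using env6 s6 feas6 phi6 e5 p4(4) by (auto simp: Inv_def)
        qed
      qed simp
    qed simp
  qed (use s2 in simp)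
  show ?thesis unfolding search_com_def W_def[symmetric]
  proof (rule runs_Seq[OF init, where ?B2.0 = "6 + (S * m + 1) * (explore_time n M + 4 * n + 10)"])
    fix s1 assume s1: "?P0 s1"
      and ag: "agree (writes (for_com ''i'' ''n'' (NArrAssign ''bst'' (NVar ''i'') (NConst 0)))) s s1"
    have env1: "env s1" by (rule env_agree[OF ag _ env]) simp
    have sel1: "{i. i < n \<and> 0 < narr s1 ''bst'' i} = {}" using s1 by auto
    have e: "feas {}" "cst {} = S * m" by (simp_all add: feasible_def cost_def lcount_def soft_def)
    let ?c = "Seq (NAssign ''best'' (ntimes S (NVar ''m''))) (NAssign ''phi'' (NPlus (NVar ''best'') (NConst 1)))"
    have "runs orc ?c 3 (\<lambda>s2. env s2 \<and> best_ok s2 \<and> ?b s2 < ?phi s2 \<and> ?phi s2 = S * m + 1) s1"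
      using env1 s1 e by (intro runs_straight) (simp_all add: env_def best_ok_def sel_def sel1)
    then show "runs orc (Seq ?c W) (6 + (S * m + 1) * (explore_time n M + 4 * n + 10))
      (\<lambda>s'. feas (sel ''cur'' n s') \<and> local_opt M {..<n} feas cst (sel ''cur'' n s')) s1"
    proof (rule runs_Seq[where ?B2.0 = "(S * m + 1) * (explore_time n M + 4 * n + 7 + 1) + 1"])
      fix s2 assume "env s2 \<and> best_ok s2 \<and> ?b s2 < ?phi s2 \<and> ?phi s2 = S * m + 1"
      then show "runs orc W ((S * m + 1) * (explore_time n M + 4 * n + 7 + 1) + 1)
        (\<lambda>s'. feas (sel ''cur'' n s') \<and> local_opt M {..<n} feas cst (sel ''cur'' n s')) s2"
        by (intro runs_conseq[OF loop order.refl]) (auto simp: Inv_def moves_def local_opt_def)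
    qed (simp add: algebra_simps)
  qed (simp add: search_time_def)
qed

end

section \<open>Levels, capacities and the oracle query\<close>

definition level_com :: com where
  "level_com = Seq (Seq (RAssign ''y'' (RArr ''val'' (NVar ''i''))) (NAssign ''j'' (NConst 0)))
    (Seq (While (BAnd (NLess (NVar ''j'') (NVar ''J'')) (BNot (RLess (RVar ''V'') (RPlus (RVar ''y'') (RVar ''y'')))))
           (Seq (RAssign ''y'' (RPlus (RVar ''y'') (RVar ''y''))) (NAssign ''j'' (NPlus (NVar ''j'') (NConst 1)))))
         (NArrAssign ''lev'' (NVar ''i'') (NVar ''j'')))"

lemma writes_level [simp]: "writes level_com = {''y'', ''j'', ''lev''}"
  by (auto simp: level_com_def)

lemma runs_level:
  assumes s: "nvar s ''J'' = J" "nvar s ''i'' = i" "rarr s ''val'' = w" "rvar s ''V'' = V"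
  shows "runs orc level_com (4 * J + 7) (\<lambda>s'. narr s' ''lev'' = (narr s ''lev'')(i := level J V (w i))) s"
  unfolding level_com_def
proof (rule runs_Seq[where P = "\<lambda>s1. s1 = s\<lparr>rvar := (rvar s)(''y'' := w i), nvar := (nvar s)(''j'' := 0)\<rparr>" and
      ?B1.0 = 3 and ?B2.0 = "4 * J + 3"])
  let ?s1 = "s\<lparr>rvar := (rvar s)(''y'' := w i), nvar := (nvar s)(''j'' := 0)\<rparr>"
  show "runs orc (Seq (RAssign ''y'' (RArr ''val'' (NVar ''i''))) (NAssign ''j'' (NConst 0))) 3 (\<lambda>s1. s1 = ?s1) s"
    by (rule runs_straight) (use s in simp_all)
  fix s1 assume s1: "s1 = ?s1"
  let ?b = "BAnd (NLess (NVar ''j'') (NVar ''J'')) (BNot (RLess (RVar ''V'') (RPlus (RVar ''y'') (RVar ''y''))))"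
  let ?c = "Seq (RAssign ''y'' (RPlus (RVar ''y'') (RVar ''y''))) (NAssign ''j'' (NPlus (NVar ''j'') (NConst 1)))"
  \<comment> \<open>The doublings made so far plus the level still to be found for the doubled value
    is constant.\<close>
  let ?I = "\<lambda>s' :: state. nvar s' ''J'' = J \<and> nvar s' ''i'' = i \<and> rvar s' ''V'' = V \<and> narr s' = narr s \<and> nvar s' ''j'' \<le> J \<and>
    nvar s' ''j'' + level (J - nvar s' ''j'') V (rvar s' ''y'') = level J V (w i)"
  have "runs orc (While ?b ?c) (4 * J + 1) (\<lambda>s'. ?I s' \<and> \<not> bval ?b s') s1"
  proof (rule runs_While[where B = 3 and \<mu> = "\<lambda>s'. J - nvar s' ''j''"])
    show "?I s1" using s s1 by simp
    show "(J - nvar s1 ''j'') * (3 + 1) + 1 \<le> 4 * J + 1" by simp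
    fix s' assume I: "?I s'" and b: "bval ?b s'"
    then have "level (J - nvar s' ''j'') V (rvar s' ''y'') =
        Suc (level (J - Suc (nvar s' ''j'')) V (rvar s' ''y'' + rvar s' ''y''))"
      by (simp add: Suc_diff_Suc[symmetric] del: level.simps) simp
    then show "runs orc ?c 3 (\<lambda>s''. ?I s'' \<and> J - nvar s'' ''j'' < J - nvar s' ''j'') s'"
      using I b by (intro runs_straight) auto
  qed
  then show "runs orc (Seq (While ?b ?c) (NArrAssign ''lev'' (NVar ''i'') (NVar ''j''))) (4 * J + 3)
    (\<lambda>s'. narr s' ''lev'' = (narr s ''lev'')(i := level J V (w i))) s1"
  proof (rule runs_Seq[where ?B2.0 = 1])
    fix s2 assume s2: "?I s2 \<and> \<not> bval ?b s2"
    have "level (J - nvar s2 ''j'') V (rvar s2 ''y'') = 0"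
      using s2 by (cases "J - nvar s2 ''j''") auto
    then show "runs orc (NArrAssign ''lev'' (NVar ''i'') (NVar ''j'')) 1
      (\<lambda>s'. narr s' ''lev'' = (narr s ''lev'')(i := level J V (w i))) s2"
      using s2 by (intro runs_straight) auto
  qed simp
qed simp

lemma runs_levels:
  assumes s: "nvar s ''J'' = J" "nvar s ''n'' = n" "rarr s ''val'' = w" "rvar s ''V'' = V"
  shows "runs orc (for_com ''i'' ''n'' level_com) (n * (4 * J + 10) + 3)
    (\<lambda>s'. \<forall>i<n. narr s' ''lev'' i = level J V (w i)) s"
proof (rule runs_for[where N = n and B = "4 * J + 7" and I = "\<lambda>k s'. \<forall>i<k. narr s' ''lev'' i = level J V (w i)"])
  fix k s' assume k: "\<forall>i<k. narr s' ''lev'' i = level J V (w i)" "nvar s' ''i'' = k"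
    and ag: "agree (insert ''i'' (writes level_com)) s s'"
  have "nvar s' ''J'' = J" "rarr s' ''val'' = w" "rvar s' ''V'' = V"
    using agreeD[OF ag, of "''J''"] agreeD[OF ag, of "''val''"] agreeD[OF ag, of "''V''"] s by simp_all
  from runs_level[OF this(1) k(2) this(2,3)]
  show "runs orc level_com (4 * J + 7) (\<lambda>s''. \<forall>i<Suc k. narr (s''\<lparr>nvar := (nvar s'')(''i'' := Suc k)\<rparr>) ''lev'' i =
      level J V (w i)) s'"
    by (rule runs_conseq) (use k in \<open>auto simp: less_Suc_eq\<close>)
qed (use s in auto)

text \<open>\<open>pw\<close> is a table of powers of 2, so digits are extracted by comparison and
  subtraction. \<open>na\<close> and \<open>nb\<close> hold consecutive values of
  \<open>cap_seq\<close>, and a digit 1 replaces them by \<open>nb\<close> and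
  \<open>2 * na\<close>.\<close>

definition decode_step :: com where
  "decode_step = Seq (NAssign ''kk'' (NMinus (NVar ''kk'') (NConst 1)))
    (Cond (NLess (NVar ''gg'') (NArr ''pw'' (NVar ''kk'')))
      (Seq (NArrAssign ''cap'' (NVar ''j'') (NVar ''na'')) (NAssign ''j'' (NPlus (NVar ''j'') (NConst 1))))
      (Seq (NAssign ''gg'' (NMinus (NVar ''gg'') (NArr ''pw'' (NVar ''kk''))))
      (Seq (NAssign ''tt'' (NVar ''na''))
      (Seq (NAssign ''na'' (NVar ''nb'')) (NAssign ''nb'' (NPlus (NVar ''tt'') (NVar ''tt'')))))))"

definition decode_com :: com where
  "decode_com = Seq (for_com ''k'' ''L1'' (NArrAssign ''cap'' (NVar ''k'') (NVar ''m'')))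
    (Seq (Seq (NAssign ''gg'' (NVar ''g'')) (Seq (NAssign ''j'' (NConst 0)) (Seq (NAssign ''na'' (NConst 2))
           (Seq (NAssign ''nb'' (NConst 3)) (NAssign ''kk'' (NVar ''L''))))))
         (While (NLess (NConst 0) (NVar ''kk'')) decode_step))"

lemma writes_decode [simp]: "writes decode_com = {''k'', ''cap'', ''gg'', ''j'', ''na'', ''nb'', ''kk'', ''tt''}"
  by (auto simp: decode_com_def decode_step_def)

lemma runs_decode:
  assumes s: "nvar s ''L'' = L" "nvar s ''L1'' = L + 1" "nvar s ''g'' = g" "nvar s ''m'' = m" "\<forall>k\<le>L. narr s ''pw'' k = 2 ^ k"
  shows "runs orc decode_com (18 * L + 25)
    (\<lambda>s'. \<exists>c. (\<forall>j\<le>L. c j = m) \<and> narr s' ''cap'' = decode L g 0 0 c) s"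
  unfolding decode_com_def
proof (rule runs_Seq[where P = "\<lambda>s1. \<forall>j<L + 1. narr s1 ''cap'' j = m" and ?B2.0 = "14 * L + 12"])
  show "runs orc (for_com ''k'' ''L1'' (NArrAssign ''cap'' (NVar ''k'') (NVar ''m''))) (4 * (L + 1) + 3)
    (\<lambda>s1. \<forall>j<L + 1. narr s1 ''cap'' j = m) s"
  proof (rule runs_for[where N = "L + 1" and B = 1 and I = "\<lambda>k s1. \<forall>j<k. narr s1 ''cap'' j = m"])
    fix k s' assume k: "\<forall>j<k. narr s' ''cap'' j = m" "nvar s' ''k'' = k"
      and ag: "agree (insert ''k'' (writes (NArrAssign ''cap'' (NVar ''k'') (NVar ''m'')))) s s'"
    have "nvar s' ''m'' = m" using agreeD(1)[OF ag, of "''m''"] s by simp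
    then show "runs orc (NArrAssign ''cap'' (NVar ''k'') (NVar ''m'')) 1
      (\<lambda>s''. \<forall>j<Suc k. narr (s''\<lparr>nvar := (nvar s'')(''k'' := Suc k)\<rparr>) ''cap'' j = m) s'"
      using k by (intro runs_straight) (auto simp: less_Suc_eq)
  qed (use s in auto)
  fix s1 assume cap: "\<forall>j<L + 1. narr s1 ''cap'' j = m"
    and ag: "agree (writes (for_com ''k'' ''L1'' (NArrAssign ''cap'' (NVar ''k'') (NVar ''m'')))) s s1"
  define c where "c = narr s1 ''cap''"
  have s1: "nvar s1 ''L'' = L" "nvar s1 ''g'' = g" "narr s1 ''pw'' = narr s ''pw''"
    using agreeD[OF ag, of "''L''"] agreeD[OF ag, of "''g''"] agreeD[OF ag, of "''pw''"] s by simp_all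
  \<comment> \<open>The program stores two capacities instead of the index \<open>i\<close>, which
    is therefore existential.\<close>
  let ?I = "\<lambda>s' :: state. narr s' ''pw'' = narr s ''pw'' \<and> nvar s' ''kk'' \<le> L \<and>
    (\<exists>i. nvar s' ''na'' = cap_seq i \<and> nvar s' ''nb'' = cap_seq (Suc i) \<and>
      decode (nvar s' ''kk'') (nvar s' ''gg'') (nvar s' ''j'') i (narr s' ''cap'') = decode L g 0 0 c)"
  show "runs orc (Seq (Seq (NAssign ''gg'' (NVar ''g'')) (Seq (NAssign ''j'' (NConst 0)) (Seq (NAssign ''na'' (NConst 2))
           (Seq (NAssign ''nb'' (NConst 3)) (NAssign ''kk'' (NVar ''L''))))))
         (While (NLess (NConst 0) (NVar ''kk'')) decode_step)) (14 * L + 12)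
    (\<lambda>s'. \<exists>c. (\<forall>j\<le>L. c j = m) \<and> narr s' ''cap'' = decode L g 0 0 c) s1"
  proof (rule runs_Seq[where P = "\<lambda>s2. ?I s2 \<and> nvar s2 ''kk'' = L" and ?B1.0 = 9 and ?B2.0 = "14 * L + 1"])
    show "runs orc (Seq (NAssign ''gg'' (NVar ''g'')) (Seq (NAssign ''j'' (NConst 0)) (Seq (NAssign ''na'' (NConst 2))
           (Seq (NAssign ''nb'' (NConst 3)) (NAssign ''kk'' (NVar ''L'')))))) 9 (\<lambda>s2. ?I s2 \<and> nvar s2 ''kk'' = L) s1"
      using s1 by (intro runs_straight) (auto simp: c_def intro!: exI[of _ 0])
    fix s2 assume s2: "?I s2 \<and> nvar s2 ''kk'' = L"
    have "runs orc (While (NLess (NConst 0) (NVar ''kk'')) decode_step) (14 * L + 1)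
      (\<lambda>s'. ?I s' \<and> \<not> bval (NLess (NConst 0) (NVar ''kk'')) s') s2"
    proof (rule runs_While[where B = 13 and \<mu> = "\<lambda>s'. nvar s' ''kk''"])
      show "?I s2" using s2 by blast
      show "nvar s2 ''kk'' * (13 + 1) + 1 \<le> 14 * L + 1" using s2 by simp
      fix s' assume I: "?I s'" and "bval (NLess (NConst 0) (NVar ''kk'')) s'"
      then obtain k where k: "nvar s' ''kk'' = Suc k" by (auto simp: gr0_conv_Suc)
      obtain i where i: "nvar s' ''na'' = cap_seq i" "nvar s' ''nb'' = cap_seq (Suc i)"
        "decode (Suc k) (nvar s' ''gg'') (nvar s' ''j'') i (narr s' ''cap'') = decode L g 0 0 c"
        using I k by auto
      have pw: "narr s' ''pw'' k = 2 ^ k" "narr s ''pw'' k = 2 ^ k" using I k s(5) by auto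
      show "runs orc decode_step 13 (\<lambda>s''. ?I s'' \<and> nvar s'' ''kk'' < nvar s' ''kk'') s'"
      proof (rule runs_straight)
        show "?I (denote decode_step s') \<and> nvar (denote decode_step s') ''kk'' < nvar s' ''kk''"
        proof (cases "nvar s' ''gg'' < 2 ^ k")
          case True
          then show ?thesis using i I k pw
            by (intro conjI exI[of _ i]) (simp_all add: decode_step_def)
        next
          case False
          then show ?thesis using i I k pw
            by (intro conjI exI[of _ "Suc i"]) (simp_all add: decode_step_def)
        qed
      qed (simp_all add: decode_step_def)
    qed
    then show "runs orc (While (NLess (NConst 0) (NVar ''kk'')) decode_step) (14 * L + 1)
      (\<lambda>s'. \<exists>c. (\<forall>j\<le>L. c j = m) \<and> narr s' ''cap'' = decode L g 0 0 c) s2"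
    proof (rule runs_conseq[OF _ order.refl])
      fix s' assume "?I s' \<and> \<not> bval (NLess (NConst 0) (NVar ''kk'')) s'"
      then have "narr s' ''cap'' = decode L g 0 0 c" by auto
      then show "\<exists>c. (\<forall>j\<le>L. c j = m) \<and> narr s' ''cap'' = decode L g 0 0 c"
        using cap by (intro exI[of _ c]) (auto simp: c_def)
    qed
  qed simp
qed simp

lemma runs_Query:
  "Q (s\<lparr>rvar := (rvar s)(x := orc (map (rarr s a) [0..<nval k s]))\<rparr>) \<Longrightarrow> 1 + nval k s \<le> B \<Longrightarrow> runs orc (Query x a k) B Q s"
  using exec.Query unfolding runs_def by blast

section \<open>Querying the oracle and keeping the best matching\<close>

definition load_step :: com where
  "load_step = Cond (NLess (NConst 0) (NArr ''cur'' (NVar ''i'')))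
     (Seq (RArrAssign ''qv'' (NVar ''i'') (RArr ''val'' (NVar ''i''))) (NAssign ''d'' (NPlus (NVar ''d'') (NConst 1))))
     (RArrAssign ''qv'' (NVar ''i'') (RConst 0))"

text \<open>\<open>q * (m - d) \<le> m\<close> is the integer form of the size requirement for
  \<open>q \<ge> 1 / \<epsilon>\<close>. The second conjunct is a disjunction: nothing has been
  found yet, or the new value is smaller.\<close>

definition accept_cond :: "nat \<Rightarrow> bexp" where
  "accept_cond q = BAnd (BNot (NLess (NVar ''m'') (ntimes q (NMinus (NVar ''m'') (NVar ''d'')))))
     (BNot (BAnd (BNot (NLess (NVar ''found'') (NConst 1))) (BNot (RLess (RVar ''fv'') (RVar ''bestv'')))))"

definition accept_com :: "nat \<Rightarrow> com" where
  "accept_com q = Seq (NAssign ''d'' (NConst 0)) (Seq (for_com ''i'' ''n'' load_step)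
    (Seq (Query ''fv'' ''qv'' (NVar ''n''))
    (Cond (accept_cond q)
      (Seq (Seq (NAssign ''found'' (NConst 1)) (RAssign ''bestv'' (RVar ''fv''))) (for_copy ''out'' ''cur'')) Skip)))"

lemma writes_accept [simp]: "writes (accept_com q) = {''d'', ''i'', ''qv'', ''fv'', ''found'', ''bestv'', ''out''}"
  by (auto simp: accept_com_def load_step_def)

locale program_instance =
  fixes n m l dc q :: nat and lf rg :: "nat \<Rightarrow> nat" and w :: "nat \<Rightarrow> real" and orc :: "real list \<Rightarrow> real"
    and bnd :: real
begin

definition value_of :: "nat set \<Rightarrow> real" where
  "value_of I = orc (map (\<lambda>i. if i \<in> I then w i else 0) [0..<n])"

text \<open>This is kept under right and wrong guesses alike: only matchings that are large enough
  are stored, with their true value.\<close>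

definition result :: "state \<Rightarrow> bool" where
  "result s \<longleftrightarrow> (nvar s ''found'' = 0 \<longrightarrow> sel ''out'' n s = {}) \<and>
    (nvar s ''found'' \<noteq> 0 \<longrightarrow> inj_on lf (sel ''out'' n s) \<and> inj_on rg (sel ''out'' n s) \<and>
      q * (m - card (sel ''out'' n s)) \<le> m \<and> rvar s ''bestv'' = value_of (sel ''out'' n s))"

text \<open>Makes success permanent: once the stored value meets the target, later guesses cannot
  spoil it.\<close>

definition improves :: "state \<Rightarrow> state \<Rightarrow> bool" where
  "improves s s' \<longleftrightarrow> (nvar s ''found'' \<noteq> 0 \<longrightarrow> nvar s' ''found'' \<noteq> 0 \<and> rvar s' ''bestv'' \<le> rvar s ''bestv'')"

lemma runs_accept:
  assumes s: "nvar s ''n'' = n" "nvar s ''m'' = m" "rarr s ''val'' = w" "result s"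
    "inj_on lf (sel ''cur'' n s)" "inj_on rg (sel ''cur'' n s)"
  shows "runs orc (accept_com q) (20 * n + 30) (\<lambda>s'. result s' \<and> improves s s' \<and>
    (q * (m - card (sel ''cur'' n s)) \<le> m \<longrightarrow> nvar s' ''found'' \<noteq> 0 \<and> rvar s' ''bestv'' \<le> value_of (sel ''cur'' n s))) s"
proof -
  let ?D = "sel ''cur'' n s"
  let ?Q = "\<lambda>s'. result s' \<and> improves s s' \<and>
    (q * (m - card ?D) \<le> m \<longrightarrow> nvar s' ''found'' \<noteq> 0 \<and> rvar s' ''bestv'' \<le> value_of ?D)"
  let ?I = "\<lambda>k (s' :: state). nvar s' ''d'' = card {i. i < k \<and> narr s ''cur'' i \<noteq> 0} \<and>
    (\<forall>i<k. rarr s' ''qv'' i = (if narr s ''cur'' i \<noteq> 0 then w i else 0))"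
  show ?thesis unfolding accept_com_def
  proof (rule runs_Seq[where P = "\<lambda>s1. s1 = s\<lparr>nvar := (nvar s)(''d'' := 0)\<rparr>" and ?B1.0 = 1 and ?B2.0 = "20 * n + 28"])
    let ?s1 = "s\<lparr>nvar := (nvar s)(''d'' := 0)\<rparr>"
    show "runs orc (NAssign ''d'' (NConst 0)) 1 (\<lambda>s1. s1 = ?s1) s" by (rule runs_straight) simp_all
    fix s1 assume s1: "s1 = ?s1"
    have "runs orc (for_com ''i'' ''n'' load_step) (9 * n + 3) (?I n) s1"
    proof (rule runs_for[where N = n and B = 6 and I = ?I])
      fix k s' assume I: "?I k s'" and k: "nvar s' ''i'' = k" and ag: "agree (insert ''i'' (writes load_step)) s1 s'"
      have e: "narr s' ''cur'' = narr s ''cur''" "rarr s' ''val'' = w"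
        using agreeD(3)[OF ag, of "''cur''"] agreeD(4)[OF ag, of "''val''"] s s1 by (simp_all add: load_step_def)
      have set: "{i. i < Suc k \<and> narr s ''cur'' i \<noteq> 0} =
          (if narr s ''cur'' k \<noteq> 0 then insert k {i. i < k \<and> narr s ''cur'' i \<noteq> 0} else {i. i < k \<and> narr s ''cur'' i \<noteq> 0})"
        by (auto simp: less_Suc_eq)
      show "runs orc load_step 6 (\<lambda>s''. ?I (Suc k) (s''\<lparr>nvar := (nvar s'')(''i'' := Suc k)\<rparr>)) s'"
        unfolding set using I k e by (intro runs_straight) (simp_all add: load_step_def less_Suc_eq)
    qed (use s s1 in \<open>auto simp: load_step_def\<close>)
    then show "runs orc (Seq (for_com ''i'' ''n'' load_step) (Seq (Query ''fv'' ''qv'' (NVar ''n''))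
      (Cond (accept_cond q)
      (Seq (Seq (NAssign ''found'' (NConst 1)) (RAssign ''bestv'' (RVar ''fv''))) (for_copy ''out'' ''cur'')) Skip))) (20 * n + 28) ?Q s1"
    proof (rule runs_Seq[where ?B2.0 = "8 * n + 20"])
      fix s2 assume I: "?I n s2" and ag2: "agree (writes (for_com ''i'' ''n'' load_step)) s1 s2"
      have e2: "nvar s2 ''n'' = n" "nvar s2 ''m'' = m" "nvar s2 ''found'' = nvar s ''found''"
        "rvar s2 ''bestv'' = rvar s ''bestv''" "narr s2 ''cur'' = narr s ''cur''" "narr s2 ''out'' = narr s ''out''"
        using agreeD[OF ag2, of "''n''"] agreeD[OF ag2, of "''m''"] agreeD[OF ag2, of "''found''"]
          agreeD[OF ag2, of "''bestv''"] agreeD[OF ag2, of "''cur''"] agreeD[OF ag2, of "''out''"] s s1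
        by (simp_all add: load_step_def)
      have d2: "nvar s2 ''d'' = card ?D" using I by (simp add: sel_def)
      have "map (rarr s2 ''qv'') [0..<n] = map (\<lambda>i. if i \<in> ?D then w i else 0) [0..<n]"
        using I by (auto simp: sel_def)
      then have v2: "orc (map (rarr s2 ''qv'') [0..<n]) = value_of ?D" by (simp only: value_of_def)
      let ?s3 = "s2\<lparr>rvar := (rvar s2)(''fv'' := value_of ?D)\<rparr>"
      show "runs orc (Seq (Query ''fv'' ''qv'' (NVar ''n'')) (Cond (accept_cond q)
      (Seq (Seq (NAssign ''found'' (NConst 1)) (RAssign ''bestv'' (RVar ''fv''))) (for_copy ''out'' ''cur'')) Skip)) (8 * n + 20) ?Q s2"
      proof (rule runs_Seq[where P = "\<lambda>s3. s3 = ?s3" and ?B1.0 = "1 + n" and ?B2.0 = "4 * n + 8"])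
        show "runs orc (Query ''fv'' ''qv'' (NVar ''n'')) (1 + n) (\<lambda>s3. s3 = ?s3) s2"
          by (rule runs_Query) (use e2 v2 in simp_all)
        fix s3 assume s3: "s3 = ?s3"
        have cond: "bval (accept_cond q) s3 \<longleftrightarrow> q * (m - card ?D) \<le> m \<and>
            (nvar s ''found'' = 0 \<or> value_of ?D < rvar s ''bestv'')"
          using s3 e2 d2 by (auto simp: accept_cond_def not_less)
        show "runs orc (Cond (accept_cond q)
          (Seq (Seq (NAssign ''found'' (NConst 1)) (RAssign ''bestv'' (RVar ''fv''))) (for_copy ''out'' ''cur'')) Skip) (4 * n + 8) ?Q s3"
        proof (rule runs_Cond[where ?B1.0 = "4 * n + 7"])
          assume b: "bval (accept_cond q) s3"
          let ?s4 = "s3\<lparr>nvar := (nvar s3)(''found'' := 1), rvar := (rvar s3)(''bestv'' := value_of ?D)\<rparr>"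
          show "runs orc (Seq (Seq (NAssign ''found'' (NConst 1)) (RAssign ''bestv'' (RVar ''fv''))) (for_copy ''out'' ''cur''))
            (4 * n + 7) ?Q s3"
          proof (rule runs_Seq[where P = "\<lambda>s4. s4 = ?s4" and ?B1.0 = 3])
            show "runs orc (Seq (NAssign ''found'' (NConst 1)) (RAssign ''bestv'' (RVar ''fv''))) 3 (\<lambda>s4. s4 = ?s4) s3"
              by (rule runs_straight) (use s3 in simp_all)
            fix s4 assume s4: "s4 = ?s4"
            have "runs orc (for_copy ''out'' ''cur'') (4 * n + 3) (\<lambda>s'. \<forall>i<n. narr s' ''out'' i = narr s4 ''cur'' i) s4"
              by (rule runs_for_copy) (use s4 s3 e2 in auto)
            then show "runs orc (for_copy ''out'' ''cur'') (4 * n + 3) ?Q s4"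
            proof (rule runs_conseq[OF _ order.refl])
              fix s5 assume s5: "\<forall>i<n. narr s5 ''out'' i = narr s4 ''cur'' i"
                and ag5: "agree (writes (for_copy ''out'' ''cur'')) s4 s5"
              have e5: "nvar s5 ''found'' = 1" "rvar s5 ''bestv'' = value_of ?D"
                using agreeD[OF ag5, of "''found''"] agreeD[OF ag5, of "''bestv''"] s4 by simp_all
              have "sel ''out'' n s5 = ?D" using s5 s4 s3 e2 by (auto simp: sel_def)
              then show "?Q s5" using e5 s(5,6) b cond by (auto simp: result_def improves_def)
            qed
          qed simp
        next
          assume "\<not> bval (accept_cond q) s3"
          moreover have "result s3" using s(4) s3 e2 by (simp add: result_def sel_def)
          ultimately show "runs orc Skip (4 * n + 7) ?Q s3"
            using s3 e2 cond by (intro runs_straight) (auto simp: improves_def)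
        qed simp
      qed simp
    qed simp
  qed simp
qed

end

section \<open>The complete program\<close>

definition guess_com :: "nat \<Rightarrow> com" where
  "guess_com q = Seq decode_com (Seq (search_com (wgt q) (blk q) (mv q)) (accept_com q))"

definition guess_time :: "nat \<Rightarrow> nat \<Rightarrow> nat \<Rightarrow> nat \<Rightarrow> nat" where
  "guess_time n m L q = (18 * L + 25) + (4 * n + 10 + (wgt q * m + 1) * (explore_time n (mv q) + 4 * n + 10)) +
     (20 * n + 30) + 2"

definition main_com :: "nat \<Rightarrow> com" where
  "main_com q = for_com ''c'' ''n'' (Seq (RAssign ''V'' (RArr ''val'' (NVar ''c'')))
     (Seq (for_com ''i'' ''n'' level_com) (for_com ''g'' ''G'' (guess_com q))))"

definition main_time :: "nat \<Rightarrow> nat \<Rightarrow> nat \<Rightarrow> nat \<Rightarrow> nat \<Rightarrow> nat \<Rightarrow> nat" where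
  "main_time n m J L G q = n * (n * (4 * J + 10) + G * (guess_time n m L q + 3) + 12) + 3"

text \<open>\<open>p = 2 ^ l\<close> doubles until it reaches \<open>m\<close>, so
  \<open>2 ^ l \<le> 2 * m + 1\<close>, where the 1 covers \<open>m = 0\<close>. The number of
  guesses \<open>2 ^ (3 * l + dc)\<close> is then at most cubic in \<open>m\<close> up to a constant
  factor.\<close>

definition setup_com :: "nat \<Rightarrow> nat \<Rightarrow> com" where
  "setup_com q dc = Seq (Seq (Cond (NLess (NVar ''m'') (NConst (small q))) (NAssign ''add'' (NConst 0)) (NAssign ''add'' (NConst (exc q))))
      (Seq (NAssign ''p'' (NConst 1)) (NAssign ''l'' (NConst 0))))
    (Seq (While (NLess (NVar ''p'') (NVar ''m''))
        (Seq (NAssign ''p'' (NPlus (NVar ''p'') (NVar ''p''))) (NAssign ''l'' (NPlus (NVar ''l'') (NConst 1)))))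
    (Seq (Seq (NAssign ''J'' (NPlus (NVar ''l'') (NConst dc)))
         (Seq (NAssign ''L'' (NPlus (NVar ''J'') (NPlus (NVar ''l'') (NVar ''l''))))
         (Seq (NAssign ''L1'' (NPlus (NVar ''L'') (NConst 1))) (NArrAssign ''pw'' (NConst 0) (NConst 1)))))
    (Seq (for_com ''k'' ''L'' (NArrAssign ''pw'' (NPlus (NVar ''k'') (NConst 1))
           (NPlus (NArr ''pw'' (NVar ''k'')) (NArr ''pw'' (NVar ''k'')))))
         (NAssign ''G'' (NArr ''pw'' (NVar ''L''))))))"

lemma agreeD_disjoint:
  assumes "agree W s s'" "W \<inter> B = {}" "x \<in> B"
  shows "nvar s' x = nvar s x" "rvar s' x = rvar s x" "narr s' x = narr s x" "rarr s' x = rarr s x"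
proof -
  have "x \<notin> W" using assms by blast
  then show "nvar s' x = nvar s x" "rvar s' x = rvar s x" "narr s' x = narr s x" "rarr s' x = rarr s x"
    using agreeD[OF assms(1)] by simp_all
qed

context program_instance
begin

abbreviation "J \<equiv> l + dc"
abbreviation "L \<equiv> J + 2 * l"
abbreviation "add \<equiv> if m < small q then 0 else exc q"

definition base :: "state \<Rightarrow> bool" where
  "base s \<longleftrightarrow> nvar s ''n'' = n \<and> nvar s ''m'' = m \<and> nvar s ''add'' = add \<and> nvar s ''J'' = J \<and>
     nvar s ''L'' = L \<and> nvar s ''L1'' = L + 1 \<and> nvar s ''G'' = 2 ^ L \<and> (\<forall>k\<le>L. narr s ''pw'' k = 2 ^ k) \<and>
     narr s ''left'' = lf \<and> narr s ''right'' = rg \<and> rarr s ''val'' = w"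

lemma base_agree:
  "agree W s s' \<Longrightarrow> W \<inter> {''n'', ''m'', ''add'', ''J'', ''L'', ''L1'', ''G'', ''pw'', ''left'', ''right'', ''val''} = {} \<Longrightarrow>
    base s \<Longrightarrow> base s'"
proof -
  assume a: "agree W s s'" "W \<inter> {''n'', ''m'', ''add'', ''J'', ''L'', ''L1'', ''G'', ''pw'', ''left'', ''right'', ''val''} = {}" "base s"
  note eq = agreeD_disjoint[OF a(1,2)]
  show "base s'" using a(3) unfolding base_def by (simp only: eq insert_iff simp_thms) (elim conjE, assumption)
qed

lemma result_agree:
  assumes "agree W s s'" "''found'' \<notin> W" "''bestv'' \<notin> W" "''out'' \<notin> W"
  shows "result s' \<longleftrightarrow> result s" "improves s s'" "improves s' t \<longleftrightarrow> improves s t"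
proof -
  have "nvar s' ''found'' = nvar s ''found''" "rvar s' ''bestv'' = rvar s ''bestv''" "narr s' ''out'' = narr s ''out''"
    using assms agreeD[OF assms(1)] by blast+
  then show "result s' \<longleftrightarrow> result s" "improves s s'" "improves s' t \<longleftrightarrow> improves s t"
    by (simp_all add: result_def improves_def sel_def)
qed

text \<open>The property that \<open>ex_right_guess\<close> provides, with \<open>bnd\<close> as the
  target for the norm.\<close>

definition right :: "nat \<Rightarrow> nat \<Rightarrow> bool" where
  "right c g \<longleftrightarrow> (\<forall>D cp c'. D \<subseteq> {..<n} \<longrightarrow> (\<forall>j\<le>J. c' j = m) \<longrightarrow> (\<forall>j\<le>J. cp j = decode L g 0 0 c' j) \<longrightarrow>
    feasible lf rg (\<lambda>i. level J (w c) (w i)) cp (\<lambda>i. w i \<le> w c) add D \<longrightarrow>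
    local_opt (mv q) {..<n} (feasible lf rg (\<lambda>i. level J (w c) (w i)) cp (\<lambda>i. w i \<le> w c) add)
      (cost (wgt q) (blk q) m (\<lambda>i. level J (w c) (w i)) cp {..<n}) D \<longrightarrow>
    q * (m - card D) \<le> m \<and> value_of D \<le> bnd)"

definition solved :: "state \<Rightarrow> bool" where
  "solved s \<longleftrightarrow> nvar s ''found'' \<noteq> 0 \<and> rvar s ''bestv'' \<le> bnd"

lemma solved_improves: "solved s \<Longrightarrow> improves s s' \<Longrightarrow> solved s'"
  by (auto simp: solved_def improves_def)

lemma notin_search: "hd y \<noteq> CHR ''x'' \<Longrightarrow> y \<notin> search_vars \<Longrightarrow> y \<notin> writes (search_com S K M)"
proof -
  assume y: "hd y \<noteq> CHR ''x''" "y \<notin> search_vars"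
  have "hd (xv i) = CHR ''x''" for i by (simp add: xv_def)
  then have "y \<notin> xv ` {..<M}" using y(1) by (metis imageE)
  then show ?thesis using writes_search[of S K M] y(2) by blast
qed

lemma notin_guess:
  "hd y \<noteq> CHR ''x'' \<Longrightarrow> y \<notin> search_vars \<union> {''k'', ''cap'', ''gg'', ''j'', ''na'', ''nb'', ''kk'', ''tt'',
     ''d'', ''i'', ''qv'', ''fv'', ''found'', ''bestv'', ''out''} \<Longrightarrow> y \<notin> writes (guess_com q)"
  using notin_search[of y] by (simp add: guess_com_def)

lemma runs_guess:
  assumes base: "base s" and V: "rvar s ''V'' = w c" and g: "nvar s ''g'' = g"
    and lev: "\<forall>i<n. narr s ''lev'' i = level J (w c) (w i)" and res: "result s"
  shows "runs orc (guess_com q) (guess_time n m L q)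
    (\<lambda>s'. result s' \<and> improves s s' \<and> (right c g \<longrightarrow> solved s')) s"
  unfolding guess_com_def
proof (rule runs_Seq[where ?B1.0 = "18 * L + 25" and
      ?B2.0 = "4 * n + 10 + (wgt q * m + 1) * (explore_time n (mv q) + 4 * n + 10) + (20 * n + 30) + 1"])
  show "runs orc decode_com (18 * L + 25) (\<lambda>s'. \<exists>c. (\<forall>j\<le>L. c j = m) \<and> narr s' ''cap'' = decode L g 0 0 c) s"
    by (rule runs_decode) (use base g in \<open>auto simp: base_def\<close>)
  fix s1 assume s1: "\<exists>c. (\<forall>j\<le>L. c j = m) \<and> narr s1 ''cap'' = decode L g 0 0 c" and ag1: "agree (writes decode_com) s s1"
  define cp where "cp = narr s1 ''cap''"
  obtain c' where c': "\<forall>j\<le>L. c' j = m" "cp = decode L g 0 0 c'" using s1 by (auto simp: cp_def)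
  interpret SI: search_instance n m add lf rg "\<lambda>i. level J (w c) (w i)" cp w "w c" "wgt q" "blk q" .
  have base1: "base s1" by (rule base_agree[OF ag1 _ base]) simp
  have "rvar s1 ''V'' = w c" "narr s1 ''lev'' = narr s ''lev''"
    using agreeD[OF ag1, of "''V''"] agreeD[OF ag1, of "''lev''"] V by simp_all
  then have "rvar s1 ''V'' = w c" "\<forall>i<n. narr s1 ''lev'' i = level J (w c) (w i)" using lev by simp_all
  then have env1: "SI.env s1" using base1[unfolded base_def]
    unfolding SI.env_def unfolding cp_def by - (elim conjE, intro conjI; (assumption | rule refl))
  have res1: "result s1" "improves s s1" using result_agree[OF ag1] res by simp_all
  have "runs orc (search_com (wgt q) (blk q) (mv q)) (SI.search_time (mv q))
      (\<lambda>s'. SI.feas (sel ''cur'' n s') \<and> local_opt (mv q) {..<n} SI.feas SI.cst (sel ''cur'' n s')) s1"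
    by (rule SI.runs_search[OF env1])
  then show "runs orc (Seq (search_com (wgt q) (blk q) (mv q)) (accept_com q))
     (4 * n + 10 + (wgt q * m + 1) * (explore_time n (mv q) + 4 * n + 10) + (20 * n + 30) + 1)
     (\<lambda>s'. result s' \<and> improves s s' \<and> (right c g \<longrightarrow> solved s')) s1"
  proof (rule runs_Seq[where ?B2.0 = "20 * n + 30"])
    fix s2 assume s2: "SI.feas (sel ''cur'' n s2) \<and> local_opt (mv q) {..<n} SI.feas SI.cst (sel ''cur'' n s2)"
      and ag2: "agree (writes (search_com (wgt q) (blk q) (mv q))) s1 s2"
    have base2: "base s2" by (rule base_agree[OF ag2 _ base1]) (simp add: notin_search search_vars_def)
    have res2: "result s2" "improves s2 t \<longleftrightarrow> improves s1 t" for t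
      using result_agree[OF ag2] res1 by (simp_all add: notin_search search_vars_def)
    have inj: "inj_on lf (sel ''cur'' n s2)" "inj_on rg (sel ''cur'' n s2)" using s2 by (simp_all add: feasible_def)
    have "runs orc (accept_com q) (20 * n + 30) (\<lambda>s'. result s' \<and> improves s2 s' \<and>
      (q * (m - card (sel ''cur'' n s2)) \<le> m \<longrightarrow> nvar s' ''found'' \<noteq> 0 \<and> rvar s' ''bestv'' \<le> value_of (sel ''cur'' n s2))) s2"
      by (rule runs_accept) (use base2 res2 inj in \<open>auto simp: base_def\<close>)
    then show "runs orc (accept_com q) (20 * n + 30) (\<lambda>s'. result s' \<and> improves s s' \<and> (right c g \<longrightarrow> solved s')) s2"
    proof (rule runs_conseq[OF _ order.refl])
      fix s3 assume s3: "result s3 \<and> improves s2 s3 \<and>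
      (q * (m - card (sel ''cur'' n s2)) \<le> m \<longrightarrow> nvar s3 ''found'' \<noteq> 0 \<and> rvar s3 ''bestv'' \<le> value_of (sel ''cur'' n s2))"
      have "improves s s3" using s3 res1(2) res2(2) result_agree(3)[OF ag1] by simp
      moreover have "solved s3" if "right c g"
      proof -
        have "q * (m - card (sel ''cur'' n s2)) \<le> m \<and> value_of (sel ''cur'' n s2) \<le> bnd"
          using that[unfolded right_def, rule_format, of "sel ''cur'' n s2" c' cp] s2 c' sel_subset by auto
        then show ?thesis using s3 by (auto simp: solved_def)
      qed
      ultimately show "result s3 \<and> improves s s3 \<and> (right c g \<longrightarrow> solved s3)" using s3 by blast
    qed
  qed (simp add: SI.search_time_def)
qed (simp add: guess_time_def)

text \<open>The program never learns which pair of pivot \<open>c\<close> and bit string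
  \<open>g\<close> is right. Every round keeps \<open>result\<close> and can only improve the stored
  value, so one right pair anywhere suffices.\<close>

lemma runs_main:
  assumes base: "base s" and res: "result s"
  shows "runs orc (main_com q) (main_time n m J L (2 ^ L) q)
    (\<lambda>s'. result s' \<and> ((\<exists>c<n. \<exists>g<2 ^ L. right c g) \<longrightarrow> solved s')) s"
  unfolding main_com_def main_time_def
proof (rule runs_for[where N = n and B = "n * (4 * J + 10) + 2 ^ L * (guess_time n m L q + 3) + 9" and
      I = "\<lambda>k s'. result s' \<and> ((\<exists>c<k. \<exists>g<2 ^ L. right c g) \<longrightarrow> solved s')"])
  let ?names = "{''n'', ''m'', ''add'', ''J'', ''L'', ''L1'', ''G'', ''pw'', ''left'', ''right'', ''val''}"
  let ?body = "Seq (RAssign ''V'' (RArr ''val'' (NVar ''c'')))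
     (Seq (for_com ''i'' ''n'' level_com) (for_com ''g'' ''G'' (guess_com q)))"
  have wr: "writes ?body \<inter> ?names = {}" "''c'' \<notin> writes ?body" "''n'' \<notin> writes ?body"
    by (simp_all add: notin_guess search_vars_def)
  then show "''c'' \<notin> writes ?body" "''n'' \<notin> writes ?body" by blast+
  fix c s1 assume I1: "result s1 \<and> ((\<exists>c'<c. \<exists>g<2 ^ L. right c' g) \<longrightarrow> solved s1)" and c: "nvar s1 ''c'' = c"
    and ag1: "agree (insert ''c'' (writes ?body)) s s1"
  have base1: "base s1" by (rule base_agree[OF ag1 _ base]) (use wr in simp)
  let ?s2 = "s1\<lparr>rvar := (rvar s1)(''V'' := w c)\<rparr>"
  have upd: "result (t\<lparr>nvar := (nvar t)(x := y)\<rparr>) \<longleftrightarrow> result t" "solved (t\<lparr>nvar := (nvar t)(x := y)\<rparr>) \<longleftrightarrow> solved t"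
    "improves t' (t\<lparr>nvar := (nvar t)(x := y)\<rparr>) \<longleftrightarrow> improves t' t" if "x \<noteq> ''found''" for t t' x y
    using that by (simp_all add: result_def solved_def improves_def sel_def)
  show "runs orc ?body (n * (4 * J + 10) + 2 ^ L * (guess_time n m L q + 3) + 9)
    (\<lambda>s''. result (s''\<lparr>nvar := (nvar s'')(''c'' := Suc c)\<rparr>) \<and>
      ((\<exists>c'<Suc c. \<exists>g<2 ^ L. right c' g) \<longrightarrow> solved (s''\<lparr>nvar := (nvar s'')(''c'' := Suc c)\<rparr>))) s1"
  proof (rule runs_Seq[where P = "\<lambda>s2. s2 = ?s2" and ?B1.0 = 1 and
        ?B2.0 = "n * (4 * J + 10) + 2 ^ L * (guess_time n m L q + 3) + 7"])
    show "runs orc (RAssign ''V'' (RArr ''val'' (NVar ''c''))) 1 (\<lambda>s2. s2 = ?s2) s1"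
      by (rule runs_straight) (use base1 c in \<open>simp_all add: base_def\<close>)
    fix s2 assume s2: "s2 = ?s2"
    have base2: "base s2" using base1 s2 by (simp add: base_def)
    have res2: "result s2" "solved s2 \<longleftrightarrow> solved s1" using I1 s2 by (simp_all add: result_def solved_def sel_def)
    have "runs orc (for_com ''i'' ''n'' level_com) (n * (4 * J + 10) + 3)
      (\<lambda>s'. \<forall>i<n. narr s' ''lev'' i = level J (w c) (w i)) s2"
      by (rule runs_levels) (use base2 s2 in \<open>auto simp: base_def\<close>)
    then show "runs orc (Seq (for_com ''i'' ''n'' level_com) (for_com ''g'' ''G'' (guess_com q)))
      (n * (4 * J + 10) + 2 ^ L * (guess_time n m L q + 3) + 7)
      (\<lambda>s''. result (s''\<lparr>nvar := (nvar s'')(''c'' := Suc c)\<rparr>) \<and>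
      ((\<exists>c'<Suc c. \<exists>g<2 ^ L. right c' g) \<longrightarrow> solved (s''\<lparr>nvar := (nvar s'')(''c'' := Suc c)\<rparr>))) s2"
    proof (rule runs_Seq[where ?B2.0 = "2 ^ L * (guess_time n m L q + 3) + 3"])
      fix s3 assume lev: "\<forall>i<n. narr s3 ''lev'' i = level J (w c) (w i)"
        and ag3: "agree (writes (for_com ''i'' ''n'' level_com)) s2 s3"
      have base3: "base s3" by (rule base_agree[OF ag3 _ base2]) simp
      have res3: "result s3" "improves s2 s3" using result_agree[OF ag3] res2 by simp_all
      have V3: "rvar s3 ''V'' = w c" using agreeD(2)[OF ag3, of "''V''"] s2 by simp
      let ?I = "\<lambda>k s'. result s' \<and> improves s3 s' \<and> ((\<exists>g<k. right c g) \<longrightarrow> solved s')"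
      have "runs orc (for_com ''g'' ''G'' (guess_com q)) (2 ^ L * (guess_time n m L q + 3) + 3) (?I (2 ^ L)) s3"
      proof (rule runs_for[where N = "2 ^ L" and B = "guess_time n m L q" and I = ?I])
        show "''g'' \<notin> writes (guess_com q)" "''G'' \<notin> writes (guess_com q)" by (simp_all add: notin_guess search_vars_def)
        show "nvar s3 ''G'' = 2 ^ L" using base3 by (simp add: base_def)
        show "?I 0 (s3\<lparr>nvar := (nvar s3)(''g'' := 0)\<rparr>)" using res3 by (simp add: upd) (simp add: improves_def)
        fix g s4 assume I4: "?I g s4" and g: "nvar s4 ''g'' = g" and ag4: "agree (insert ''g'' (writes (guess_com q))) s3 s4"
        have base4: "base s4" by (rule base_agree[OF ag4 _ base3]) (simp add: notin_guess search_vars_def)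
        have V4: "rvar s4 ''V'' = w c" using agreeD(2)[OF ag4, of "''V''"] V3 by (simp add: notin_guess search_vars_def)
        have lev4: "narr s4 ''lev'' = narr s3 ''lev''" using agreeD(3)[OF ag4, of "''lev''"] by (simp add: notin_guess search_vars_def)
        have "runs orc (guess_com q) (guess_time n m L q)
           (\<lambda>s'. result s' \<and> improves s4 s' \<and> (right c g \<longrightarrow> solved s')) s4"
          by (rule runs_guess) (use base4 V4 g lev lev4 I4 in auto)
        then show "runs orc (guess_com q) (guess_time n m L q) (\<lambda>s''. ?I (Suc g) (s''\<lparr>nvar := (nvar s'')(''g'' := Suc g)\<rparr>)) s4"
        proof (rule runs_conseq[OF _ order.refl])
          fix s5 assume s5: "result s5 \<and> improves s4 s5 \<and> (right c g \<longrightarrow> solved s5)"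
          have "improves s3 s5" using I4 s5 unfolding improves_def by linarith
          moreover have "solved s5" if "\<exists>g'<Suc g. right c g'"
          proof (cases "right c g")
            case False
            then have "\<exists>g'<g. right c g'" using that less_Suc_eq by auto
            then show ?thesis using I4 s5 solved_improves by blast
          qed (use s5 in simp)
          ultimately show "?I (Suc g) (s5\<lparr>nvar := (nvar s5)(''g'' := Suc g)\<rparr>)" using s5 by (simp add: upd)
        qed
      qed simp_all
      then show "runs orc (for_com ''g'' ''G'' (guess_com q)) (2 ^ L * (guess_time n m L q + 3) + 3)
        (\<lambda>s''. result (s''\<lparr>nvar := (nvar s'')(''c'' := Suc c)\<rparr>) \<and>
      ((\<exists>c'<Suc c. \<exists>g<2 ^ L. right c' g) \<longrightarrow> solved (s''\<lparr>nvar := (nvar s'')(''c'' := Suc c)\<rparr>))) s3"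
      proof (rule runs_conseq[OF _ order.refl])
        fix s6 assume s6: "?I (2 ^ L) s6"
        have "solved s6" if "\<exists>c'<Suc c. \<exists>g<2 ^ L. right c' g"
        proof (cases "\<exists>g<2 ^ L. right c g")
          case False
          then have "\<exists>c'<c. \<exists>g<2 ^ L. right c' g" using that less_Suc_eq by auto
          then have "solved s3" using I1 res2(2) res3(2) solved_improves by blast
          then show ?thesis using s6 solved_improves by blast
        qed (use s6 in blast)
        then show "result (s6\<lparr>nvar := (nvar s6)(''c'' := Suc c)\<rparr>) \<and>
          ((\<exists>c'<Suc c. \<exists>g<2 ^ L. right c' g) \<longrightarrow> solved (s6\<lparr>nvar := (nvar s6)(''c'' := Suc c)\<rparr>))"
          using s6 by (simp add: upd)
      qed
    qed simp
  qed simp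
qed (use base res in \<open>simp_all add: base_def result_def sel_def algebra_simps\<close>)

end

lemma runs_setup:
  assumes s: "nvar s ''n'' = n" "nvar s ''m'' = m" "narr s ''left'' = lf" "narr s ''right'' = rg" "rarr s ''val'' = w"
  shows "runs orc (setup_com q dc) (40 * m + 4 * dc + 80)
    (\<lambda>s'. \<exists>l. m \<le> 2 ^ l \<and> 2 ^ l \<le> 2 * m + 1 \<and> program_instance.base n m l dc q lf rg w s') s"
proof -
  let ?in = "\<lambda>s' :: state. nvar s' ''n'' = n \<and> nvar s' ''m'' = m \<and> narr s' ''left'' = lf \<and> narr s' ''right'' = rg \<and> rarr s' ''val'' = w \<and>
    nvar s' ''add'' = (if m < small q then 0 else exc q)"
  let ?I = "\<lambda>s' :: state. ?in s' \<and> nvar s' ''p'' = 2 ^ nvar s' ''l'' \<and> 2 ^ nvar s' ''l'' \<le> 2 * m + 1"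
  let ?Q = "\<lambda>s'. \<exists>l. m \<le> 2 ^ l \<and> 2 ^ l \<le> 2 * m + 1 \<and> program_instance.base n m l dc q lf rg w s'"
  show ?thesis unfolding setup_com_def
  proof (rule runs_Seq[where P = "\<lambda>s'. ?I s' \<and> nvar s' ''l'' = 0" and ?B1.0 = 8 and ?B2.0 = "40 * m + 4 * dc + 70"])
    show "runs orc (Seq (Cond (NLess (NVar ''m'') (NConst (small q))) (NAssign ''add'' (NConst 0)) (NAssign ''add'' (NConst (exc q))))
      (Seq (NAssign ''p'' (NConst 1)) (NAssign ''l'' (NConst 0)))) 8 (\<lambda>s'. ?I s' \<and> nvar s' ''l'' = 0) s"
      by (rule runs_straight) (use s in simp_all)
    fix s1 assume s1: "?I s1 \<and> nvar s1 ''l'' = 0"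
    let ?c = "Seq (NAssign ''p'' (NPlus (NVar ''p'') (NVar ''p''))) (NAssign ''l'' (NPlus (NVar ''l'') (NConst 1)))"
    let ?b = "NLess (NVar ''p'') (NVar ''m'')"
    let ?c3 = "Seq (NAssign ''J'' (NPlus (NVar ''l'') (NConst dc)))
         (Seq (NAssign ''L'' (NPlus (NVar ''J'') (NPlus (NVar ''l'') (NVar ''l''))))
         (Seq (NAssign ''L1'' (NPlus (NVar ''L'') (NConst 1))) (NArrAssign ''pw'' (NConst 0) (NConst 1))))"
    let ?c4 = "NArrAssign ''pw'' (NPlus (NVar ''k'') (NConst 1))
           (NPlus (NArr ''pw'' (NVar ''k'')) (NArr ''pw'' (NVar ''k'')))"
    have "runs orc (While ?b ?c) (4 * m + 1) (\<lambda>s'. ?I s' \<and> \<not> bval ?b s') s1"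
    proof (rule runs_While[where B = 3 and \<mu> = "\<lambda>s'. m - nvar s' ''p''"])
      show "?I s1" using s1 by blast
      show "(m - nvar s1 ''p'') * (3 + 1) + 1 \<le> 4 * m + 1" by simp
      fix s' assume I: "?I s'" and b: "bval ?b s'"
      \<comment> \<open>Powers of 2 are positive, so doubling \<open>p\<close> strictly decreases
        \<open>m - p\<close>.\<close>
      have "m - (x + x) < m - x" if "x < m" "0 < x" for x using that by linarith
      from this[of "2 ^ nvar s' ''l''"]
      show "runs orc ?c 3 (\<lambda>s''. ?I s'' \<and> m - nvar s'' ''p'' < m - nvar s' ''p'') s'"
        using I b by (intro runs_straight) auto
    qed
    then show "runs orc (Seq (While ?b ?c) (Seq ?c3 (Seq (for_com ''k'' ''L'' ?c4) (NAssign ''G'' (NArr ''pw'' (NVar ''L''))))))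
       (40 * m + 4 * dc + 70) ?Q s1"
    proof (rule runs_Seq[where ?B2.0 = "36 * m + 4 * dc + 60"])
      fix s2 assume s2: "?I s2 \<and> \<not> bval ?b s2"
      define l where "l = nvar s2 ''l''"
      have l: "m \<le> 2 ^ l" "2 ^ l \<le> 2 * m + 1" using s2 by (auto simp: l_def)
      have "l < 2 ^ l" by (rule less_exp)
      then have l_le: "l \<le> 2 * m" using l(2) by linarith
      let ?L = "l + dc + 2 * l"
      let ?P = "\<lambda>s' :: state. ?in s' \<and> nvar s' ''J'' = l + dc \<and> nvar s' ''L'' = ?L \<and> nvar s' ''L1'' = ?L + 1"
      show "runs orc (Seq ?c3 (Seq (for_com ''k'' ''L'' ?c4) (NAssign ''G'' (NArr ''pw'' (NVar ''L''))))) (36 * m + 4 * dc + 60) ?Q s2"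
      proof (rule runs_Seq[where P = "\<lambda>s3. ?P s3 \<and> narr s3 ''pw'' 0 = 1" and ?B1.0 = 7 and ?B2.0 = "4 * ?L + 5"])
        show "runs orc ?c3 7 (\<lambda>s3. ?P s3 \<and> narr s3 ''pw'' 0 = 1) s2"
          by (rule runs_straight) (use s2 in \<open>simp_all add: l_def\<close>)
        show "1 + 7 + (4 * ?L + 5) \<le> 36 * m + 4 * dc + 60" using l_le by simp
        fix s3 assume s3: "?P s3 \<and> narr s3 ''pw'' 0 = 1"
        have "runs orc (for_com ''k'' ''L'' ?c4) (4 * ?L + 3) (\<lambda>s4 :: state. \<forall>k\<le>?L. narr s4 ''pw'' k = 2 ^ k) s3"
          by (rule runs_for[where N = ?L and B = 1 and I = "\<lambda>k (s4 :: state). \<forall>i\<le>k. narr s4 ''pw'' i = 2 ^ i"])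
            (use s3 in \<open>auto intro!: runs_straight simp: le_Suc_eq mult_2\<close>)
        then show "runs orc (Seq (for_com ''k'' ''L'' ?c4) (NAssign ''G'' (NArr ''pw'' (NVar ''L'')))) (4 * ?L + 5) ?Q s3"
        proof (rule runs_Seq[where ?B2.0 = 1])
          fix s4 assume pw: "\<forall>k\<le>?L. narr s4 ''pw'' k = 2 ^ k" and ag: "agree (writes (for_com ''k'' ''L'' ?c4)) s3 s4"
          have "nvar s4 x = nvar s3 x \<and> narr s4 x = narr s3 x \<and> rarr s4 x = rarr s3 x" if "x \<notin> {''k'', ''pw''}" for x
            using agreeD[OF ag, of x] that by simp
          then have "?P s4" using s3 by simp
          then have "program_instance.base n m l dc q lf rg w (s4\<lparr>nvar := (nvar s4)(''G'' := narr s4 ''pw'' ?L)\<rparr>)"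
            using pw by (simp add: program_instance.base_def)
          then have "?Q (s4\<lparr>nvar := (nvar s4)(''G'' := narr s4 ''pw'' ?L)\<rparr>)" using l by blast
          then show "runs orc (NAssign ''G'' (NArr ''pw'' (NVar ''L''))) 1 ?Q s4"
            using \<open>?P s4\<close> by (intro runs_NAssign) simp_all
        qed simp
      qed
    qed simp
  qed simp
qed

section \<open>Polynomial bounds on the running time\<close>

definition poly_bounded :: "(nat \<Rightarrow> nat) \<Rightarrow> bool" where
  "poly_bounded F \<longleftrightarrow> (\<exists>p :: nat poly. \<forall>z. F z \<le> poly p z)"

lemma poly_bounded_const: "poly_bounded (\<lambda>_. c)"
  unfolding poly_bounded_def by (intro exI[of _ "[:c:]"]) simp

lemma poly_bounded_id: "poly_bounded (\<lambda>z. z)"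
  unfolding poly_bounded_def by (intro exI[of _ "[:0, 1:]"]) simp

lemma poly_bounded_add:
  assumes "poly_bounded F" "poly_bounded H"
  shows "poly_bounded (\<lambda>z. F z + H z)"
proof -
  obtain a b where "\<And>z. F z \<le> poly a z" "\<And>z. H z \<le> poly b z" using assms by (auto simp: poly_bounded_def)
  then show ?thesis unfolding poly_bounded_def by (intro exI[of _ "a + b"]) (simp add: add_mono)
qed

lemma poly_bounded_mult:
  assumes "poly_bounded F" "poly_bounded H"
  shows "poly_bounded (\<lambda>z. F z * H z)"
proof -
  obtain a b where "\<And>z. F z \<le> poly a z" "\<And>z. H z \<le> poly b z" using assms by (auto simp: poly_bounded_def)
  then show ?thesis unfolding poly_bounded_def by (intro exI[of _ "a * b"]) (simp add: mult_le_mono)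
qed

lemmas poly_bounded_intros = poly_bounded_add poly_bounded_mult poly_bounded_id poly_bounded_const

lemma poly_bounded_explore: "poly_bounded (\<lambda>z. explore_time z k)"
  by (induction k) (simp_all only: explore_time.simps, (intro poly_bounded_intros | assumption)+)

lemma explore_time_mono: "n \<le> n' \<Longrightarrow> explore_time n k \<le> explore_time n' k"
  by (induction k) (simp_all add: add_mono mult_le_mono)

lemma main_time_mono:
  assumes "n \<le> n'" "m \<le> m'" "J \<le> J'" "L \<le> L'" "G \<le> G'"
  shows "main_time n m J L G q \<le> main_time n' m' J' L' G' q"
proof -
  have "guess_time n m L q \<le> guess_time n' m' L' q"
    unfolding guess_time_def by (intro add_mono mult_le_mono order.refl explore_time_mono assms)
  then show ?thesis unfolding main_time_def by (intro add_mono mult_le_mono order.refl assms)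
qed

section \<open>Correctness and running time\<close>

lemma value_oracle_restrict:
  assumes es: "distinct es" and w: "\<And>i. i < length es \<Longrightarrow> w i = v (es ! i)" and I: "I \<subseteq> {..<length es}"
  shows "value_oracle es f (map (\<lambda>i. if i \<in> I then w i else 0) [0..<length es]) = f (restrict_vec v ((!) es ` I))"
proof -
  let ?xs = "map (\<lambda>i. if i \<in> I then w i else 0) [0..<length es]"
  have "(case map_of (zip es ?xs) e of None \<Rightarrow> 0 | Some r \<Rightarrow> r) = restrict_vec v ((!) es ` I) e" for e
  proof (cases "e \<in> set es")
    case True
    then obtain i where i: "i < length es" "e = es ! i" by (auto simp: in_set_conv_nth)
    have "map_of (zip es ?xs) e = Some (?xs ! i)"
      unfolding i(2) using i(1) es by (intro map_of_zip_nth) simp_all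
    moreover have "e \<in> (!) es ` I \<longleftrightarrow> i \<in> I"
      using i I es by (auto simp: nth_eq_iff_index_eq subset_iff)
    ultimately show ?thesis using i w by (simp add: restrict_vec_def)
  next
    case False
    then have "map_of (zip es ?xs) e = None" by (simp add: map_of_zip_is_None)
    moreover have "e \<notin> (!) es ` I" using False I by auto
    ultimately show ?thesis by (simp only: restrict_vec_def option.case if_False)
  qed
  then show ?thesis by (simp add: value_oracle_def)
qed

text \<open>Moves the instance to array positions, where \<open>MI\<close> represents
  \<open>M\<close>, and joins the search with \<open>ex_right_guess\<close>. The time still mentions
  \<open>l\<close>; the bound on \<open>2 ^ l\<close> lets it become a polynomial later.\<close>

lemma program_correct:
  fixes L :: "'l set" and R :: "'r set" and E :: "('l \<times> 'r) set" and \<delta> :: real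
  assumes q: "q \<ge> 1" and dc: "1 \<le> \<delta> * 2 ^ dc" and "\<delta> > 0"
    and G: "bipartite_graph L R E" "card L = m"
    and f: "norm_on E f" "monotone_norm_on E f" "symmetric_norm_on E f"
    and v: "\<forall>e\<in>E. 0 \<le> v e"
    and M: "perfect_matching L R E M"
    and pres: "presentation L R E \<alpha> \<beta> es"
  shows "\<exists>l. 2 ^ l \<le> 2 * m + 1 \<and> runs (value_oracle es f) (Seq (setup_com q dc) (main_com q))
    (40 * m + 4 * dc + 81 + main_time (length es) m (l + dc) (l + dc + 2 * l) (2 ^ (l + dc + 2 * l)) q)
    (\<lambda>s. matching E (output_edges es s) \<and> q * (m - card (output_edges es s)) \<le> m \<and>
      f (restrict_vec v (output_edges es s)) \<le> (8 + \<delta>) * f (restrict_vec v M))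
    (input_state m \<alpha> \<beta> es v)"
proof -
  let ?orc = "value_oracle es f" and ?s = "input_state m \<alpha> \<beta> es v"
  define n where "n = length es"
  define lf where "lf i = (if i < n then \<alpha> (fst (es ! i)) else 0)" for i
  define rg where "rg i = (if i < n then \<beta> (snd (es ! i)) else 0)" for i
  define w where "w i = (if i < n then v (es ! i) else 0)" for i
  define p where "p i = es ! i" for i
  define MI where "MI = {i. i < n \<and> es ! i \<in> M}"
  define Q where "Q s \<longleftrightarrow> matching E (output_edges es s) \<and> q * (m - card (output_edges es s)) \<le> m \<and>
      f (restrict_vec v (output_edges es s)) \<le> (8 + \<delta>) * f (restrict_vec v M)" for s
  have es: "distinct es" "set es = E" and \<alpha>: "bij_betw \<alpha> L {..<card L}" and \<beta>: "bij_betw \<beta> R {..<card R}"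
    using pres by (auto simp: presentation_def)
  have finE: "finite E" using es by auto
  have EL: "fst e \<in> L" "snd e \<in> R" if "e \<in> E" for e
    using that G(1) by (auto simp: bipartite_graph_def)
  have pm: "matching E M" "fst ` M = L" "snd ` M = R" "M \<subseteq> E"
    using M by (auto simp: perfect_matching_def matching_def)
  have p: "bij_betw p {..<n} E"
    unfolding p_def n_def es(2)[symmetric] by (rule bij_betw_nth[OF es(1)]) simp_all
  have pE: "es ! i \<in> E" if "i < n" for i using that es by (auto simp: n_def)
  have p_inj: "i = j" if "i < n" "j < n" "es ! i = es ! j" for i j
    using that es by (simp add: n_def nth_eq_iff_index_eq)
  have lf_iff: "lf i = lf j \<longleftrightarrow> fst (es ! i) = fst (es ! j)" if "i < n" "j < n" for i j
    using that \<alpha> EL(1)[OF pE] by (auto simp: lf_def bij_betw_def inj_on_eq_iff)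
  have rg_iff: "rg i = rg j \<longleftrightarrow> snd (es ! i) = snd (es ! j)" if "i < n" "j < n" for i j
    using that \<beta> EL(2)[OF pE] by (auto simp: rg_def bij_betw_def inj_on_eq_iff)
  have MI: "MI \<subseteq> {..<n}" "p ` MI = M"
  proof -
    show "MI \<subseteq> {..<n}" by (auto simp: MI_def)
    have "\<exists>i<n. es ! i = e" if "e \<in> M" for e using that pm(4) es by (auto simp: n_def in_set_conv_nth)
    then show "p ` MI = M" unfolding MI_def p_def by blast
  qed
  have MI_inj: "inj_on lf MI" "inj_on rg MI"
    using pm(1) p_inj lf_iff rg_iff unfolding inj_on_def MI_def matching_def by blast+
  have card_MI: "card MI = m"
  proof -
    have "inj_on p MI" using p MI by (auto simp: bij_betw_def intro: inj_on_subset)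
    then have "card MI = card M" using MI(2) by (metis card_image)
    moreover have "inj_on fst M" using pm(1) by (auto simp: matching_def inj_on_def)
    then have "card M = card L" using pm(2) by (metis card_image)
    ultimately show ?thesis using G by simp
  qed
  have cover: "lf ` {..<n} \<subseteq> lf ` MI" "rg ` {..<n} \<subseteq> rg ` MI"
  proof -
    have ex: "\<exists>j\<in>MI. fst (es ! j) = fst (es ! i)" "\<exists>j\<in>MI. snd (es ! j) = snd (es ! i)" if "i < n" for i
    proof -
      have "fst (es ! i) \<in> fst ` p ` MI" "snd (es ! i) \<in> snd ` p ` MI"
        using EL[OF pE[OF that]] pm MI by simp_all
      then show "\<exists>j\<in>MI. fst (es ! j) = fst (es ! i)" "\<exists>j\<in>MI. snd (es ! j) = snd (es ! i)"
        unfolding p_def by (auto simp: image_iff)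
    qed
    show "lf ` {..<n} \<subseteq> lf ` MI"
    proof
      fix y assume "y \<in> lf ` {..<n}"
      then obtain i where i: "i < n" "y = lf i" by auto
      then obtain j where "j \<in> MI" "fst (es ! j) = fst (es ! i)" using ex(1) by blast
      then show "y \<in> lf ` MI" using i lf_iff[of j i] MI(1) by (intro image_eqI[of _ _ j]) auto
    qed
    show "rg ` {..<n} \<subseteq> rg ` MI"
    proof
      fix y assume "y \<in> rg ` {..<n}"
      then obtain i where i: "i < n" "y = rg i" by auto
      then obtain j where "j \<in> MI" "snd (es ! j) = snd (es ! i)" using ex(2) by blast
      then show "y \<in> rg ` MI" using i rg_iff[of j i] MI(1) by (intro image_eqI[of _ _ j]) auto
    qed
  qed
  interpret N: monotone_symmetric_norm E f v
    using finE f v by unfold_locales auto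
  define bnd where "bnd = (8 + \<delta>) * f (restrict_vec v M)"
  have in_s: "nvar ?s ''n'' = n" "nvar ?s ''m'' = m" "narr ?s ''left'' = lf" "narr ?s ''right'' = rg" "rarr ?s ''val'' = w"
    "nvar ?s ''found'' = 0" "narr ?s ''out'' = (\<lambda>_. 0)"
    by (auto simp: input_state_def n_def lf_def rg_def w_def)
  obtain t1 s1 l where 1: "exec ?orc (setup_com q dc) ?s t1 s1" "t1 \<le> 40 * m + 4 * dc + 80"
    "m \<le> 2 ^ l" "2 ^ l \<le> 2 * m + 1" "program_instance.base n m l dc q lf rg w s1"
    using runs_setup[OF in_s(1-5)] unfolding runs_def by blast
  interpret PI: program_instance n m l dc q lf rg w ?orc bnd .
  have ag: "agree (writes (setup_com q dc)) ?s s1" by (rule exec_agree[OF 1(1)])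
  have res1: "PI.result s1"
    using agreeD[OF ag, of "''found''"] agreeD[OF ag, of "''out''"] in_s
    by (simp add: setup_com_def PI.result_def sel_def)
  have val: "PI.value_of I = f (restrict_vec v (p ` I))" if "I \<subseteq> {..<n}" for I
    unfolding PI.value_of_def unfolding p_def n_def
    by (rule value_oracle_restrict[OF es(1)]) (use that in \<open>auto simp: w_def n_def\<close>)
  have right: "\<exists>c<n. \<exists>g<2 ^ (l + dc + 2 * l). PI.right c g" if "m \<ge> 1"
  proof -
    have wv: "w i = v (p i)" if "i \<in> {..<n}" for i using that by (simp add: w_def p_def)
    from N.ex_right_guess[OF p wv MI(1) MI_inj card_MI cover q that 1(3) dc] obtain c g
      where cg: "c < n" "g < 2 ^ (l + dc + 2 * l)"
      and ok: "\<And>D cp c'. D \<subseteq> {..<n} \<Longrightarrow> (\<forall>j\<le>l + dc. c' j = m) \<Longrightarrow>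
        (\<forall>j\<le>l + dc. cp j = decode (l + dc + 2 * l) g 0 0 c' j) \<Longrightarrow>
        feasible lf rg (\<lambda>i. level (l + dc) (w c) (w i)) cp (\<lambda>i. w i \<le> w c) (if m < small q then 0 else exc q) D \<Longrightarrow>
        local_opt (mv q) {..<n} (feasible lf rg (\<lambda>i. level (l + dc) (w c) (w i)) cp (\<lambda>i. w i \<le> w c) (if m < small q then 0 else exc q))
          (cost (wgt q) (blk q) m (\<lambda>i. level (l + dc) (w c) (w i)) cp {..<n}) D \<Longrightarrow>
        q * (m - card D) \<le> m \<and> f (restrict_vec v (p ` D)) \<le> (8 + \<delta>) * f (restrict_vec v (p ` MI))"
      unfolding lessThan_iff by blast
    have "PI.right c g" unfolding PI.right_def
    proof (intro allI impI)
      fix D cp c' assume a: "D \<subseteq> {..<n}" "\<forall>j\<le>l + dc. c' j = m"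
        "\<forall>j\<le>l + dc. cp j = decode (l + dc + 2 * l) g 0 0 c' j"
        "feasible lf rg (\<lambda>i. level (l + dc) (w c) (w i)) cp (\<lambda>i. w i \<le> w c) (if m < small q then 0 else exc q) D"
        "local_opt (mv q) {..<n} (feasible lf rg (\<lambda>i. level (l + dc) (w c) (w i)) cp (\<lambda>i. w i \<le> w c) (if m < small q then 0 else exc q))
          (cost (wgt q) (blk q) m (\<lambda>i. level (l + dc) (w c) (w i)) cp {..<n}) D"
      from ok[OF a] show "q * (m - card D) \<le> m \<and> PI.value_of D \<le> bnd"
        unfolding val[OF a(1)] bnd_def MI(2) .
    qed
    with cg show ?thesis by blast
  qed
  have "runs ?orc (main_com q) (main_time n m (l + dc) (l + dc + 2 * l) (2 ^ (l + dc + 2 * l)) q) Q s1"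
  proof (rule runs_conseq[OF PI.runs_main[OF 1(5) res1] order.refl])
    fix s assume s: "PI.result s \<and> ((\<exists>c<n. \<exists>g<2 ^ (l + dc + 2 * l). PI.right c g) \<longrightarrow> PI.solved s)"
    let ?I = "sel ''out'' n s"
    have I: "?I \<subseteq> {..<n}" by (rule sel_subset)
    have out: "output_edges es s = p ` ?I" by (auto simp: output_edges_def p_def sel_def n_def)
    have inj: "inj_on lf ?I" "inj_on rg ?I" using s by (auto simp: PI.result_def)
    have "matching E (p ` ?I)"
      unfolding matching_def
    proof (intro conjI ballI impI)
      show "p ` ?I \<subseteq> E" using I pE by (auto simp: p_def)
      fix d e assume "d \<in> p ` ?I" "e \<in> p ` ?I" "d \<noteq> e"
      then obtain i j where ij: "i \<in> ?I" "j \<in> ?I" "d = es ! i" "e = es ! j" "i \<noteq> j" by (auto simp: p_def)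
      then have "lf i \<noteq> lf j" "rg i \<noteq> rg j" using inj by (auto dest: inj_onD)
      then show "fst d \<noteq> fst e" "snd d \<noteq> snd e" using ij I lf_iff[of i j] rg_iff[of i j] by auto
    qed
    moreover have "card (p ` ?I) = card ?I"
      using p I by (intro card_image) (auto simp: bij_betw_def intro: inj_on_subset)
    moreover have "q * (m - card ?I) \<le> m \<and> f (restrict_vec v (p ` ?I)) \<le> bnd"
    proof (cases "m = 0")
      \<comment> \<open>Without vertices no edge can serve as pivot, so
        \<open>ex_right_guess\<close> does not apply; \<open>E\<close> is empty then, and so is the
        output.\<close>
      case True
      then have "M = {}" using card_MI MI pm(4) finE by (metis card_0_eq finite_lessThan finite_subset image_is_empty)
      then have "L = {}" using pm by auto
      then have "E = {}" using EL by auto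
      then have "n = 0" using es by (simp add: n_def)
      then have "?I = {}" by (simp add: sel_def)
      moreover have "0 \<le> f (restrict_vec v M)" by (rule N.f_nonneg[OF pm(4)])
      ultimately show ?thesis using True \<open>M = {}\<close> \<open>\<delta> > 0\<close> by (simp add: bnd_def algebra_simps)
    next
      case False
      then have "PI.solved s" using right s by simp
      then show ?thesis using s val[OF I] by (auto simp: PI.solved_def PI.result_def)
    qed
    ultimately show "Q s" by (simp add: Q_def out bnd_def)
  qed
  then obtain t2 s2 where 2: "exec ?orc (main_com q) s1 t2 s2"
    "t2 \<le> main_time n m (l + dc) (l + dc + 2 * l) (2 ^ (l + dc + 2 * l)) q" "Q s2" unfolding runs_def by blast
  have "runs ?orc (Seq (setup_com q dc) (main_com q))
      (40 * m + 4 * dc + 81 + main_time n m (l + dc) (l + dc + 2 * l) (2 ^ (l + dc + 2 * l)) q) Q ?s"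
    unfolding runs_def using exec.Seq[OF 1(1) 2(1)] 1(2) 2(2,3)
    by (intro exI[of _ "1 + t1 + t2"] exI[of _ s2]) simp
  then show ?thesis using 1(4) unfolding Q_def n_def by blast
qed

theorem theorem9p5:
  fixes \<epsilon> \<delta> :: real
  assumes "0 < \<epsilon>" "\<epsilon> < 1" "0 < \<delta>" "\<delta> < 1"
  shows "\<exists>(P :: com) (p :: nat poly).
    \<forall>(L :: 'l set) (R :: 'r set) E m f v Dstar \<alpha> \<beta> es.
      bipartite_graph L R E \<and> card L = m \<and> card R = m \<and>
      (\<exists>M. perfect_matching L R E M) \<and>
      norm_on E f \<and> monotone_norm_on E f \<and> symmetric_norm_on E f \<and>
      v \<in> vectors_on E \<and> (\<forall>e\<in>E. 0 \<le> v e) \<and>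
      is_arg_min (\<lambda>D. f (restrict_vec v D)) (perfect_matching L R E) Dstar \<and>
      presentation L R E \<alpha> \<beta> es \<longrightarrow>
      (\<exists>t s. exec (value_oracle es f) P (input_state m \<alpha> \<beta> es v) t s \<and>
        t \<le> poly p (m + card E) \<and>
        (let D = output_edges es s in
          matching E D \<and>
          real (card D) \<ge> (1 - \<epsilon>) * real m \<and>
          f (restrict_vec v D) \<le> (8 + \<delta>) * f (restrict_vec v Dstar)))"
proof -
  \<comment> \<open>\<open>q\<close> and \<open>dc\<close> depend on \<open>\<epsilon>\<close> and
    \<open>\<delta>\<close> only, so the program is fixed before the instance.\<close>
  obtain q :: nat where "1 / \<epsilon> < real q" using reals_Archimedean2 by blast
  then have q: "1 \<le> \<epsilon> * real q" using assms by (simp add: field_simps)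
  have q1: "q \<ge> 1" using q by (cases q) auto
  obtain dc :: nat where "1 / \<delta> < real dc" using reals_Archimedean2 by blast
  moreover have "real dc < 2 ^ dc" by (rule of_nat_less_two_power)
  ultimately have "1 / \<delta> < 2 ^ dc" by linarith
  then have dc: "1 \<le> \<delta> * 2 ^ dc" using assms by (simp add: field_simps)
  \<comment> \<open>All sizes are bounded in terms of \<open>z = m + card E\<close>; the factor
    \<open>2 ^ (3 * l + dc)\<close> turns into a cube because of
    \<open>2 ^ l \<le> 2 * z + 1\<close>.\<close>
  define T where "T z = 40 * z + 4 * dc + 81 + main_time z z (2 * z + 1 + dc) (3 * (2 * z + 1) + dc)
      ((2 * z + 1) * (2 * z + 1) * (2 * z + 1) * 2 ^ dc) q" for z
  have "poly_bounded T"
    unfolding T_def main_time_def guess_time_def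
    by (intro poly_bounded_intros poly_bounded_explore)
  then obtain p where p: "\<And>z. T z \<le> poly p z" by (auto simp: poly_bounded_def)
  show ?thesis
  proof (intro exI[of _ "Seq (setup_com q dc) (main_com q)"] exI[of _ p] allI impI, elim conjE)
    fix L :: "'l set" and R :: "'r set" and E m f v Dstar \<alpha> \<beta> es
    assume G: "bipartite_graph L R E" "card L = m"
      and f: "norm_on E f" "monotone_norm_on E f" "symmetric_norm_on E f"
      and v: "\<forall>e\<in>E. 0 \<le> v e"
      and opt: "is_arg_min (\<lambda>D. f (restrict_vec v D)) (perfect_matching L R E) Dstar"
      and pres: "presentation L R E \<alpha> \<beta> es"
    have M: "perfect_matching L R E Dstar" using opt by (simp add: is_arg_min_def)
    have len: "length es = card E" using pres by (auto simp: presentation_def distinct_card)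
    obtain l t s where l: "2 ^ l \<le> 2 * m + 1"
      and ex: "exec (value_oracle es f) (Seq (setup_com q dc) (main_com q)) (input_state m \<alpha> \<beta> es v) t s"
      and t: "t \<le> 40 * m + 4 * dc + 81 + main_time (length es) m (l + dc) (l + dc + 2 * l) (2 ^ (l + dc + 2 * l)) q"
      and res: "matching E (output_edges es s)" "q * (m - card (output_edges es s)) \<le> m"
        "f (restrict_vec v (output_edges es s)) \<le> (8 + \<delta>) * f (restrict_vec v Dstar)"
      using program_correct[OF q1 dc assms(3) G f v M pres] unfolding runs_def by blast
    let ?z = "m + card E"
    have "l < 2 ^ l" by (rule less_exp)
    also note l
    finally have l': "l \<le> 2 * ?z + 1" by simp
    have z: "2 ^ l \<le> 2 * ?z + 1" using l by simp
    have "l + dc + 2 * l = l + l + l + dc" by simp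
    then have "(2::nat) ^ (l + dc + 2 * l) = 2 ^ l * 2 ^ l * 2 ^ l * 2 ^ dc"
      by (simp only: power_add)
    also have "\<dots> \<le> (2 * ?z + 1) * (2 * ?z + 1) * (2 * ?z + 1) * 2 ^ dc"
      by (intro mult_le_mono z order.refl)
    finally have main: "main_time (length es) m (l + dc) (l + dc + 2 * l) (2 ^ (l + dc + 2 * l)) q \<le>
        main_time ?z ?z (2 * ?z + 1 + dc) (3 * (2 * ?z + 1) + dc)
          ((2 * ?z + 1) * (2 * ?z + 1) * (2 * ?z + 1) * 2 ^ dc) q"
      using l' len by (intro main_time_mono) simp_all
    have "40 * m + 4 * dc + 81 \<le> 40 * ?z + 4 * dc + 81" by simp
    from order.trans[OF t add_mono[OF this main]] have "t \<le> T ?z" unfolding T_def .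
    then have time: "t \<le> poly p ?z" using p[of ?z] by linarith
    have size: "(1 - \<epsilon>) * real m \<le> real (card (output_edges es s))"
    proof -
      let ?k = "m - card (output_edges es s)"
      have "real ?k \<le> \<epsilon> * real q * real ?k" using mult_right_mono[OF q, of "real ?k"] by simp
      also have "\<dots> = \<epsilon> * real (q * ?k)" by simp
      also have "\<dots> \<le> \<epsilon> * real m" using res(2) assms(1) by (intro mult_left_mono) (simp_all only: of_nat_le_iff less_imp_le)
      finally have "real m - real (card (output_edges es s)) \<le> \<epsilon> * real m" by linarith
      then show ?thesis by (simp add: algebra_simps)
    qed
    show "\<exists>t s. exec (value_oracle es f) (Seq (setup_com q dc) (main_com q)) (input_state m \<alpha> \<beta> es v) t s \<and>
        t \<le> poly p (m + card E) \<and>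
        (let D = output_edges es s in
          matching E D \<and>
          real (card D) \<ge> (1 - \<epsilon>) * real m \<and>
          f (restrict_vec v D) \<le> (8 + \<delta>) * f (restrict_vec v Dstar))"
      unfolding Let_def using ex time res size by blast
  qed
qed

end
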